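(* Let $q\in(-1,1)$ and let $\mathfrak{H}$ be a real Hilbert space. For any $n\ge1$, any $n$-partitioned set $I$, any $(n-1)$-partitioned set $J$ and any $\boldsymbol\pi\in\mathcal{P}_I$, the map $\xi_q^{R;I,J;\boldsymbol\pi}$ extends to a continuous linear map $$\Big(\widehat{\bigotimes_{I_i\lhd(I\setminus\boldsymbol\pi)}}{}_{\!\alpha}\ \mathfrak{H}^{\widehat\otimes_\alpha I_i}\Big)\ \widehat\otimes_\pi\ \Big(\widehat{\bigotimes_{J_j\lhd J}}{}_{\!\pi}\ \mathfrak{H}^{\widehat\otimes_\alpha J_j}\Big)\longrightarrow\mathscr{A}_q(\mathfrak{H})$$ with operator norm $$\big\|\xi_q^{R;I,J;\boldsymbol\pi}\big\|\le C_q^{3/2}\,D_q^{|I\setminus\boldsymbol\pi|+|J|}\prod_{K\lhd(I\setminus\boldsymbol\pi)\wr J}(|K|+1).$$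
   Context: **$q$-Fock space.** $\mathcal{F}(\mathfrak{H})=\bigoplus_n\mathfrak{H}^{\otimes n}$ (algebraic), vacuum $\mathbf 1$, $\langle\cdot,\cdot\rangle_{\mathcal{F}_0}$ the usual tensor inner products. $P_q(f_1\otimes\cdots\otimes f_n)=\sum_{\sigma\in\mathfrak{S}_n}q^{|\sigma|}f_{\sigma(1)}\otimes\cdots\otimes f_{\sigma(n)}$ ($|\sigma|$ number of inversions, $0^0=1$); $\mathcal{F}_q(\mathfrak{H})$ is the completion under $\langle\cdot,P_q\cdot\rangle_{\mathcal{F}_0}$. $\alpha_q^\dagger(f)(f_1\otimes\cdots\otimes f_n)=f\otimes f_1\otimes\cdots\otimes f_n$, $\alpha_q(f)(f_1\otimes\cdots\otimes f_n)=\sum_iq^{i-1}\langle f,f_i\rangle f_1\otimes\cdots\widehat{f_i}\cdots\otimes f_n$, $\xi_q(f)=\alpha^\dagger_q(f)+\alpha_q(f)$; $\mathfrak{A}_q(\mathfrak{H})$ is the unital algebra they generate. Wick products: $\xi_q^{\diamond0}(c)=c\cdot\mathrm{id}$, $\xi_q^{\diamond1}=\xi_q$, $\xi_q^{\diamond n}(f_1\otimes\cdots\otimes f_n)=\xi_q(f_1)\xi_q^{\diamond(n-1)}(f_2\otimes\cdots\otimes f_n)-\sum_{i=2}^nq^{i-2}\langle f_1,f_i\rangle\xi_q^{\diamond(n-2)}(f_2\otimes\cdots\widehat{f_i}\cdots\otimes f_n)$. For a finite totally ordered set $K$, $\xi_q^{\diamond K}:\mathfrak{H}^{\otimes K}\to\mathfrak{A}_q(\mathfrak{H})$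 is $\xi_q^{\diamond|K|}$ via the order isomorphism $K\cong\{1,\dots,|K|\}$; $f_{\otimes K}=\bigotimes_{i\in K}f_i$. **$\mathscr{A}_q$.** Each $A\in\mathfrak{A}_q(\mathfrak{H})$ is uniquely $\sum_{k}\xi_q^{\diamond k}(F_k)$; $|||A|||=\sum_k(k+1)C_q^{3/2}D_q^k\|F_k\|_{\mathcal{F}_0}$, $C_q=\prod_{n\ge1}(1-|q|^n)^{-1}$, $D_q=(1-|q|)^{-1}$; $\mathscr{A}_q(\mathfrak{H})$ is the completion, a Banach algebra. **Contractions.** For a finite totally ordered set $K$, $\mathcal{P}_K$ is the set of all (possibly empty) collections $\boldsymbol\sigma$ of pairwise disjoint pairs $(i,j)$, $i<j$, of elements of $K$; $K\setminus\boldsymbol\sigma$ is the set of unpaired elements. With $\mathrm{cr}(\boldsymbol\sigma)=\#\{((i,j),(k,l))\in\boldsymbol\sigma^2:i<k<j<l\}$ and $\mathrm{sp}(\boldsymbol\sigma)=\sum_{(s,t)\in\boldsymbol\sigma}\#\{u\in K\setminus\boldsymbol\sigma:s<u<t\}$ put $\overline{\mathrm{cr}}(\boldsymbol\sigma)=\mathrm{cr}(\boldsymbol\sigma)+\mathrm{sp}(\boldsymbol\sigma)$ (relative to the base set $K$), and $$\xi_q^{\diamond\boldsymbol\sigma}(f_{\otimes K})=q^{\overline{\mathrm{cr}}(\boldsymbol\sigma)}\,\xi_q^{\diamond(K\setminus\boldsymbol\sigma)}(f_{\otimes K\setminus\boldsymbol\sigma})\prod_{(s,t)\in\boldsymbol\sigma}\langle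 f_s,f_t\rangle.$$ **Partitioned sets.** An $m$-partitioned set is a finite totally ordered set $I$ written as a disjoint union $I=I_1\sqcup\cdots\sqcup I_m$ of $m$ consecutive, possibly empty, intervals ("blocks"); $I_j\lhd I$ means $I_j$ is a block. Removing elements of $I$ gives again an $m$-partitioned set. $\widehat{\mathcal{P}}_I\subset\mathcal{P}_I$ consists of the contractions all of whose pairs have their two elements in different blocks. For $I$ $n$-partitioned and $J$ $(n-1)$-partitioned, $I\wr J=I_1\sqcup J_1\sqcup I_2\sqcup\cdots\sqcup J_{n-1}\sqcup I_n$ ($(2n-1)$-partitioned). $\mathcal{P}^R_{I,J}$ is the set of $\boldsymbol\sigma\in\widehat{\mathcal{P}}_{I\wr J}$ containing no pair with both elements in $I$. **The map.** For $\boldsymbol\pi\in\mathcal{P}_I$, $L=I\setminus\boldsymbol\pi$ (an $n$-partitioned set), $f\in\mathfrak{H}^L$, $g\in\mathfrak{H}^J$, $G_j=g_{\otimes J_j}$, let $f\wr g\in\mathfrak{H}^{L\wr J}$ be the natural interleaving and $$\xi_q^{R;I,J;\boldsymbol\pi}(f_{\otimes L};G_1,\dots,G_{n-1})=\sum_{\boldsymbol\sigma\in\mathcal{P}^R_{L,J}}q^{\overline{\mathrm{cr}}(\boldsymbol\pi,\boldsymbol\sigma)}\,\xi_q^{\diamond\boldsymbol\sigma}\big((f\wr g)_{\otimes(L\wr J)}\big),$$ extended multilinearly, where $\overline{\mathrm{cr}}(\boldsymbol\pi,\boldsymbol\sigma)=\overline{\mathrm{cr}}(\boldsymbol\pi\cup\boldsymbol\sigma)-\overline{\mathrm{cr}}(\boldsymbol\sigma)$,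 the first term computed in $I\wr J$ and the second in $L\wr J$. **Tensor products.** $\widehat\otimes_\alpha$ is the Hilbert space tensor product, $\widehat\otimes_\pi$ the completed projective tensor product of Banach spaces; empty tensor products are $\mathbb{R}$. *)

theory Defs
  imports "HOL-Analysis.Analysis"
begin

section \<open>The algebraic Fock space\<close>

definition multilinear :: "('h::real_vector list \<Rightarrow> 'b::real_vector) \<Rightarrow> bool" where
  "multilinear \<phi> \<longleftrightarrow>
     (\<forall>xs i x y c. i < length xs \<longrightarrow>
        \<phi> (xs[i := x + y]) = \<phi> (xs[i := x]) + \<phi> (xs[i := y]) \<and>
        \<phi> (xs[i := c *\<^sub>R x]) = c *\<^sub>R \<phi> (xs[i := x]))"

text \<open>The direct sum over \<open>n\<close> of the algebraic tensor powers of \<open>'h\<close>.  As usual the algebraic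
  tensor product is realised inside the functionals on multilinear forms, a form here being
  a function on lists that is multilinear on the lists of each length, and
  \<open>x\<^sub>1 \<otimes> \<dots> \<otimes> x\<^sub>n\<close> being evaluation at \<open>[x\<^sub>1, \<dots>, x\<^sub>n]\<close>.  The encoding is only used up to the universal
  property \<open>lin_ext_tensor\<close> below.\<close>

typedef (overloaded) 'h fock =
  "{u :: ('h::real_vector list \<Rightarrow> real) \<Rightarrow> real.
      \<exists>cs. u = (\<lambda>A. if multilinear A then \<Sum>(c, xs)\<leftarrow>cs. c * A xs else 0)}"
  by blast

setup_lifting type_definition_fock

lift_definition tensor :: "'h::real_vector list \<Rightarrow> 'h fock" is
  "\<lambda>xs A. if multilinear A then A xs else 0"
  subgoal for xs by (rule exI[of _ "[(1, xs)]"]) auto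
  done

instantiation fock :: (real_vector) real_vector
begin

lift_definition zero_fock :: "'a fock" is "\<lambda>_. 0"
  by (rule exI[of _ "[]"]) auto

lift_definition plus_fock :: "'a fock \<Rightarrow> 'a fock \<Rightarrow> 'a fock" is "\<lambda>u v A. u A + v A"
proof -
  fix u v :: "('a list \<Rightarrow> real) \<Rightarrow> real"
  assume "\<exists>cs. u = (\<lambda>A. if multilinear A then \<Sum>(c, xs)\<leftarrow>cs. c * A xs else 0)"
    and "\<exists>cs. v = (\<lambda>A. if multilinear A then \<Sum>(c, xs)\<leftarrow>cs. c * A xs else 0)"
  then obtain cs ds where
    "u = (\<lambda>A. if multilinear A then \<Sum>(c, xs)\<leftarrow>cs. c * A xs else 0)"
    "v = (\<lambda>A. if multilinear A then \<Sum>(c, xs)\<leftarrow>ds. c * A xs else 0)"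
    by blast
  then show "\<exists>cs. (\<lambda>A. u A + v A) =
      (\<lambda>A. if multilinear A then \<Sum>(c, xs)\<leftarrow>cs. c * A xs else 0)"
    by (intro exI[of _ "cs @ ds"]) auto
qed

lift_definition scaleR_fock :: "real \<Rightarrow> 'a fock \<Rightarrow> 'a fock" is "\<lambda>r u A. r * u A"
proof -
  fix r and u :: "('a list \<Rightarrow> real) \<Rightarrow> real"
  assume "\<exists>cs. u = (\<lambda>A. if multilinear A then \<Sum>(c, xs)\<leftarrow>cs. c * A xs else 0)"
  then obtain cs where
    "u = (\<lambda>A. if multilinear A then \<Sum>(c, xs)\<leftarrow>cs. c * A xs else 0)"
    by blast
  then show "\<exists>cs. (\<lambda>A. r * u A) =
      (\<lambda>A. if multilinear A then \<Sum>(c, xs)\<leftarrow>cs. c * A xs else 0)"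
    by (intro exI[of _ "map (\<lambda>(c, xs). (r * c, xs)) cs"])
       (auto simp: sum_list_const_mult[symmetric] comp_def case_prod_beta mult.assoc)
qed

definition uminus_fock :: "'a fock \<Rightarrow> 'a fock" where "uminus_fock u = (- 1) *\<^sub>R u"

definition minus_fock :: "'a fock \<Rightarrow> 'a fock \<Rightarrow> 'a fock" where "minus_fock u v = u + (- v)"

instance
  by standard
     (unfold uminus_fock_def minus_fock_def, (transfer, simp add: fun_eq_iff algebra_simps)+)

end

definition lin_ext ::
    "('h::real_vector list \<Rightarrow> 'b::real_vector) \<Rightarrow> 'h fock \<Rightarrow> 'b" where
  "lin_ext \<phi> = (THE T. linear T \<and> (\<forall>xs. T (tensor xs) = \<phi> xs))"

lemma Rep_fock_add: "Rep_fock (u + v) A = Rep_fock u A + Rep_fock v A"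
  by (transfer, simp)

lemma Rep_fock_scaleR: "Rep_fock (r *\<^sub>R u) A = r * Rep_fock u A"
  by (transfer, simp)

lemma Rep_fock_zero: "Rep_fock 0 A = 0"
  by (transfer, simp)

lemma Rep_fock_sum_list:
  "Rep_fock (\<Sum>(c, xs)\<leftarrow>cs. c *\<^sub>R tensor xs) A =
     (if multilinear A then \<Sum>(c, xs)\<leftarrow>cs. c * A xs else 0)"
  by (induction cs)
     (auto simp: Rep_fock_add Rep_fock_scaleR Rep_fock_zero tensor.rep_eq)

lemma fock_as_sum: "\<exists>cs. u = (\<Sum>(c, xs)\<leftarrow>cs. c *\<^sub>R tensor xs)"
proof -
  obtain cs where "Rep_fock u = (\<lambda>A. if multilinear A then \<Sum>(c, xs)\<leftarrow>cs. c * A xs else 0)"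
    using Rep_fock[of u] by blast
  then have "Rep_fock u = Rep_fock (\<Sum>(c, xs)\<leftarrow>cs. c *\<^sub>R tensor xs)"
    by (auto simp: Rep_fock_sum_list)
  then show ?thesis
    using Rep_fock_inject by blast
qed

lemma multilinear_tensor: "multilinear tensor"
  unfolding multilinear_def
proof (intro allI impI conjI)
  fix xs :: "'a list" and i x y and c :: real
  assume i: "i < length xs"
  show "tensor (xs[i := x + y]) = tensor (xs[i := x]) + tensor (xs[i := y])"
    by (rule Rep_fock_inject[THEN iffD1], rule ext)
       (use i in \<open>auto simp: Rep_fock_add tensor.rep_eq multilinear_def\<close>)
  show "tensor (xs[i := c *\<^sub>R x]) = c *\<^sub>R tensor (xs[i := x])"
    by (rule Rep_fock_inject[THEN iffD1], rule ext)
       (use i in \<open>auto simp: Rep_fock_scaleR tensor.rep_eq multilinear_def\<close>)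
qed

lemma linear_sum_list_tensor:
  assumes "linear T"
  shows "T (\<Sum>(c, xs)\<leftarrow>cs. c *\<^sub>R g xs) = (\<Sum>(c, xs)\<leftarrow>cs. c *\<^sub>R T (g xs))"
  by (induction cs)
     (auto simp: linear_add[OF assms] linear_scale[OF assms] linear_0[OF assms])

lemma fock_sum_zero:
  fixes \<phi> :: "'h::real_vector list \<Rightarrow> 'b::real_vector"
  assumes "multilinear \<phi>" and z: "(\<Sum>(c, xs)\<leftarrow>cs. c *\<^sub>R tensor xs) = (0 :: 'h fock)"
  shows "(\<Sum>(c, xs)\<leftarrow>cs. c *\<^sub>R \<phi> xs) = 0"
proof (rule ccontr)
  let ?v = "\<Sum>(c, xs)\<leftarrow>cs. c *\<^sub>R \<phi> xs"
  assume nz: "?v \<noteq> 0"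
  then have "independent {?v}" by simp
  then obtain g :: "'b \<Rightarrow> real" where g: "linear g" "\<forall>x\<in>{?v}. g x = 1"
    using linear_independent_extend[of "{?v}" "\<lambda>_. 1::real"] by blast
  have "multilinear (\<lambda>xs. g (\<phi> xs))"
    using assms(1) g(1) unfolding multilinear_def
    by (auto simp: linear_add linear_scale)
  then have "(\<Sum>(c, xs)\<leftarrow>cs. c * g (\<phi> xs)) = Rep_fock (\<Sum>(c, xs)\<leftarrow>cs. c *\<^sub>R tensor xs) (\<lambda>xs. g (\<phi> xs))"
    by (simp add: Rep_fock_sum_list)
  also have "\<dots> = 0" by (simp only: z Rep_fock_zero)
  finally have "g ?v = 0"
    by (simp add: linear_sum_list_tensor[OF g(1)])
  then show False using g(2) by simp
qed

lemma lin_ext_exists: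
  fixes \<phi> :: "'h::real_vector list \<Rightarrow> 'b::real_vector"
  assumes "multilinear \<phi>"
  shows "\<exists>!T. linear T \<and> (\<forall>xs. T (tensor xs) = \<phi> xs)"
proof (rule ex_ex1I)
  let ?S = "\<lambda>cs. \<Sum>(c, xs)\<leftarrow>cs. c *\<^sub>R (tensor xs :: 'h fock)"
  let ?P = "\<lambda>cs. \<Sum>(c, xs)\<leftarrow>cs. c *\<^sub>R \<phi> xs"
  have neg: "(\<Sum>(c, xs)\<leftarrow>map (\<lambda>(c, xs). (r * c, xs)) cs. c *\<^sub>R g xs) = r *\<^sub>R (\<Sum>(c, xs)\<leftarrow>cs. c *\<^sub>R g xs)"
    for r cs and g :: "'h list \<Rightarrow> 'c::real_vector"
    by (induction cs) (auto simp: scaleR_add_right)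
  have wd: "?P cs = ?P ds" if "?S cs = ?S ds" for cs ds
  proof -
    have "?S (cs @ map (\<lambda>(c, xs). ((-1) * c, xs)) ds) = 0"
      using that by (simp only: map_append sum_list_append neg) simp
    from fock_sum_zero[OF assms this]
    have "?P cs + (-1) *\<^sub>R ?P ds = 0"
      by (simp only: map_append sum_list_append neg)
    then show ?thesis by simp
  qed
  define R where "R u = (SOME cs. u = ?S cs)" for u
  have R: "u = ?S (R u)" for u
    unfolding R_def by (rule someI_ex) (rule fock_as_sum)
  define T where "T u = ?P (R u)" for u
  have T: "T (?S cs) = ?P cs" for cs
    unfolding T_def by (rule wd) (simp only: R[symmetric])
  have "linear T"
  proof (rule linearI)
    fix u v and c :: real
    have "u + v = ?S (R u @ R v)"
      unfolding map_append sum_list_append using R[of u] R[of v] by metis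
    then have "T (u + v) = ?P (R u @ R v)"
      using T by metis
    then show "T (u + v) = T u + T v"
      by (simp add: T_def)
    have "c *\<^sub>R u = ?S (map (\<lambda>(d, xs). (c * d, xs)) (R u))"
      unfolding neg using R[of u] by metis
    then have "T (c *\<^sub>R u) = ?P (map (\<lambda>(d, xs). (c * d, xs)) (R u))"
      using T by metis
    then show "T (c *\<^sub>R u) = c *\<^sub>R T u"
      unfolding neg by (simp add: T_def)
  qed
  moreover have "T (tensor xs) = \<phi> xs" for xs
    using T[of "[(1, xs)]"] by simp
  ultimately show "\<exists>T. linear T \<and> (\<forall>xs. T (tensor xs) = \<phi> xs)" by blast
next
  fix S T :: "'h fock \<Rightarrow> 'b"
  assume S: "linear S \<and> (\<forall>xs. S (tensor xs) = \<phi> xs)"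
    and T: "linear T \<and> (\<forall>xs. T (tensor xs) = \<phi> xs)"
  show "S = T"
  proof
    fix u :: "'h fock"
    obtain cs where u: "u = (\<Sum>(c, xs)\<leftarrow>cs. c *\<^sub>R tensor xs)"
      using fock_as_sum by blast
    show "S u = T u"
      unfolding u using S T by (simp add: linear_sum_list_tensor)
  qed
qed

lemma linear_lin_ext: "multilinear \<phi> \<Longrightarrow> linear (lin_ext \<phi>)"
  and lin_ext_tensor: "multilinear \<phi> \<Longrightarrow> lin_ext \<phi> (tensor xs) = \<phi> xs"
  using theI'[OF lin_ext_exists, of \<phi>] unfolding lin_ext_def by blast+

definition degree_part :: "nat \<Rightarrow> 'h::real_vector fock \<Rightarrow> 'h fock" where
  "degree_part n = lin_ext (\<lambda>xs. if length xs = n then tensor xs else 0)"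

definition fock_inner :: "'h::real_inner fock \<Rightarrow> 'h fock \<Rightarrow> real" where
  "fock_inner u v =
     lin_ext (\<lambda>ys. lin_ext (\<lambda>xs. if length xs = length ys then \<Prod>i<length ys. xs ! i \<bullet> ys ! i else 0) u) v"

definition fock_norm :: "'h::real_inner fock \<Rightarrow> real" where
  "fock_norm u = sqrt (fock_inner u u)"

section \<open>The algebra of \<open>q\<close>-Gaussian fields and Wick products\<close>

definition creation :: "'h::real_inner \<Rightarrow> 'h fock \<Rightarrow> 'h fock" where
  "creation f = lin_ext (\<lambda>xs. tensor (f # xs))"

definition drop_nth :: "nat \<Rightarrow> 'a list \<Rightarrow> 'a list" where
  "drop_nth i xs = take i xs @ drop (Suc i) xs"


lemma drop_nth_update_same: "drop_nth i (xs[i := x]) = drop_nth i xs"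
  by (simp add: drop_nth_def)

lemma length_drop_nth: "i < length xs \<Longrightarrow> length (drop_nth i xs) = length xs - 1"
  by (simp add: drop_nth_def)

lemma drop_nth_update:
  assumes "k \<noteq> i" "i < length xs" "k < length xs"
  shows "drop_nth i (xs[k := x]) = (drop_nth i xs)[(if k < i then k else k - 1) := x]"
  using assms
  by (intro nth_equalityI)
     (auto simp: drop_nth_def nth_append nth_list_update min_def)

text \<open>List positions count from 0, so the exponents \<open>i - 1\<close> and \<open>i - 2\<close> of the usual formulas
  for \<open>annihilation\<close> and \<open>wick\<close> become \<open>i\<close>.\<close>

definition annihilation :: "real \<Rightarrow> 'h::real_inner \<Rightarrow> 'h fock \<Rightarrow> 'h fock" where
  "annihilation q f =
     lin_ext (\<lambda>xs. \<Sum>i<length xs. (q ^ i * (f \<bullet> xs ! i)) *\<^sub>R tensor (drop_nth i xs))"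

definition xi :: "real \<Rightarrow> 'h::real_inner \<Rightarrow> 'h fock \<Rightarrow> 'h fock" where
  "xi q f = (\<lambda>u. creation f u + annihilation q f u)"

definition multilinear_at :: "('h::real_vector list \<Rightarrow> 'b::real_vector) \<Rightarrow> 'h list \<Rightarrow> bool" where
  "multilinear_at \<phi> xs \<longleftrightarrow>
     (\<forall>i<length xs. \<forall>x y c.
        \<phi> (xs[i := x + y]) = \<phi> (xs[i := x]) + \<phi> (xs[i := y]) \<and>
        \<phi> (xs[i := c *\<^sub>R x]) = c *\<^sub>R \<phi> (xs[i := x]))"

lemma multilinear_iff_at: "multilinear \<phi> \<longleftrightarrow> (\<forall>xs. multilinear_at \<phi> xs)"
  unfolding multilinear_def multilinear_at_def by blast

lemma multilinear_at_contract:
  fixes f :: "'h::real_inner" and \<phi> :: "'h list \<Rightarrow> 'b::real_vector"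
  assumes "\<And>i. i < length xs \<Longrightarrow> multilinear_at \<phi> (drop_nth i xs)"
  shows "multilinear_at (\<lambda>xs. \<Sum>i<length xs. (q ^ i * (f \<bullet> xs ! i)) *\<^sub>R \<phi> (drop_nth i xs)) xs"
  unfolding multilinear_at_def
proof (intro allI impI conjI)
  fix k x y and c :: real
  assume k: "k < length xs"
  have upd: "\<phi> (drop_nth i (xs[k := x + y])) =
        \<phi> (drop_nth i (xs[k := x])) + \<phi> (drop_nth i (xs[k := y]))"
      "\<phi> (drop_nth i (xs[k := c *\<^sub>R x])) = c *\<^sub>R \<phi> (drop_nth i (xs[k := x]))"
    if "i < length xs" "i \<noteq> k" for i
  proof -
    have "(if k < i then k else k - 1) < length (drop_nth i xs)"
      using that k by (auto simp: length_drop_nth)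
    with assms[OF that(1)] show "\<phi> (drop_nth i (xs[k := x + y])) =
        \<phi> (drop_nth i (xs[k := x])) + \<phi> (drop_nth i (xs[k := y]))"
      "\<phi> (drop_nth i (xs[k := c *\<^sub>R x])) = c *\<^sub>R \<phi> (drop_nth i (xs[k := x]))"
      unfolding drop_nth_update[OF that(2)[symmetric] that(1) k] multilinear_at_def by blast+
  qed
  let ?t = "\<lambda>xs i. (q ^ i * (f \<bullet> xs ! i)) *\<^sub>R \<phi> (drop_nth i xs)"
  have "?t (xs[k := x + y]) i = ?t (xs[k := x]) i + ?t (xs[k := y]) i"
    and "?t (xs[k := c *\<^sub>R x]) i = c *\<^sub>R ?t (xs[k := x]) i" if "i < length xs" for i
    using upd[OF that] that
    by (cases "i = k"; simp add: drop_nth_update_same inner_add_right scaleR_add_left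
          scaleR_add_right distrib_left mult.left_commute mult.commute)+
  then show "(\<Sum>i<length (xs[k := x + y]). ?t (xs[k := x + y]) i) =
      (\<Sum>i<length (xs[k := x]). ?t (xs[k := x]) i) + (\<Sum>i<length (xs[k := y]). ?t (xs[k := y]) i)"
    and "(\<Sum>i<length (xs[k := c *\<^sub>R x]). ?t (xs[k := c *\<^sub>R x]) i) =
      c *\<^sub>R (\<Sum>i<length (xs[k := x]). ?t (xs[k := x]) i)"
    by (simp_all add: sum.distrib scaleR_sum_right)
qed

lemma multilinear_Cons: "multilinear \<phi> \<Longrightarrow> multilinear (\<lambda>xs. \<phi> (f # xs))"
  unfolding multilinear_def
  by (metis (no_types, lifting) Suc_less_eq length_Cons list_update_code(3))

lemma creation_tensor: "creation f (tensor xs) = tensor (f # xs)"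
  unfolding creation_def by (rule lin_ext_tensor) (rule multilinear_Cons[OF multilinear_tensor])

lemma annihilation_tensor:
  "annihilation q f (tensor xs) =
     (\<Sum>i<length xs. (q ^ i * (f \<bullet> xs ! i)) *\<^sub>R tensor (drop_nth i xs))"
  unfolding annihilation_def
  by (rule lin_ext_tensor)
     (use multilinear_tensor in \<open>auto simp: multilinear_iff_at intro!: multilinear_at_contract\<close>)

lemma prod_nth_split:
  fixes F :: "nat \<Rightarrow> real"
  shows "i < n \<Longrightarrow> (\<Prod>j<n. F j) = F i * (\<Prod>j\<in>{..<n} - {i}. F j)"
  by (rule prod.remove) auto

lemma multilinear_inner_prod:
  "multilinear (\<lambda>xs. if length xs = length ys then \<Prod>i<length ys. xs ! i \<bullet> (ys ! i :: 'h::real_inner) else (0 :: real))"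
  unfolding multilinear_def
  by (auto simp: prod_nth_split inner_add_left distrib_right cong: prod.cong_simp)

lemma fock_inner_tensor:
  "fock_inner (tensor xs) (tensor ys) =
     (if length xs = length ys then \<Prod>i<length ys. xs ! i \<bullet> ys ! i else 0)"
proof -
  have "(\<lambda>zs. lin_ext (\<lambda>xs. if length xs = length zs then \<Prod>i<length zs. xs ! i \<bullet> zs ! i else 0) (tensor xs)) =
      (\<lambda>zs. if length zs = length xs then \<Prod>i<length xs. zs ! i \<bullet> xs ! i else 0)"
    by (rule ext) (auto simp: lin_ext_tensor[OF multilinear_inner_prod] inner_commute)
  then show ?thesis
    unfolding fock_inner_def
    by (auto simp: lin_ext_tensor[OF multilinear_inner_prod] inner_commute)
qed

lemma degree_part_tensor: "degree_part n (tensor xs) = (if length xs = n then tensor xs else 0)"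
  unfolding degree_part_def
  by (rule lin_ext_tensor) (use multilinear_tensor in \<open>auto simp: multilinear_def\<close>)

text \<open>The algebra is taken as an algebra of operators on the algebraic Fock space, which is
  invariant under its generators and dense in the completion for the \<open>q\<close>-inner product.\<close>

inductive_set field_algebra :: "real \<Rightarrow> ('h::real_inner fock \<Rightarrow> 'h fock) set" for q where
  one: "id \<in> field_algebra q"
| field: "xi q f \<in> field_algebra q"
| add: "A \<in> field_algebra q \<Longrightarrow> B \<in> field_algebra q \<Longrightarrow> (\<lambda>u. A u + B u) \<in> field_algebra q"
| scale: "A \<in> field_algebra q \<Longrightarrow> (\<lambda>u. c *\<^sub>R A u) \<in> field_algebra q"
| mult: "A \<in> field_algebra q \<Longrightarrow> B \<in> field_algebra q \<Longrightarrow> A \<circ> B \<in> field_algebra q"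

function wick :: "real \<Rightarrow> 'h::real_inner list \<Rightarrow> 'h fock \<Rightarrow> 'h fock" where
  "wick q [] = id"
| "wick q (f # fs) = (\<lambda>u. xi q f (wick q fs u) -
     (\<Sum>i<length fs. (q ^ i * (f \<bullet> fs ! i)) *\<^sub>R wick q (drop_nth i fs) u))"
  by pat_completeness auto
termination
  by (relation "Wellfounded.measure (length \<circ> snd)") (auto simp: drop_nth_def)

text \<open>\<open>wick_op q F\<close> is the sum over \<open>k\<close> of the Wick products of the homogeneous parts of \<open>F\<close>.\<close>

definition wick_op :: "real \<Rightarrow> 'h::real_inner fock \<Rightarrow> 'h fock \<Rightarrow> 'h fock" where
  "wick_op q F = (\<lambda>u. lin_ext (\<lambda>xs. wick q xs u) F)"

lemma linear_creation: "linear (creation f)"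
  unfolding creation_def by (rule linear_lin_ext) (rule multilinear_Cons[OF multilinear_tensor])

lemma linear_annihilation: "linear (annihilation q f)"
  unfolding annihilation_def
  by (rule linear_lin_ext)
     (use multilinear_tensor in \<open>auto simp: multilinear_iff_at intro!: multilinear_at_contract\<close>)

lemma linear_xi: "linear (xi q f)"
  unfolding xi_def by (intro linear_compose_add linear_creation linear_annihilation)

lemma xi_add: "xi q (f + g) u = xi q f u + xi q g u"
  and xi_scaleR: "xi q (c *\<^sub>R f) u = c *\<^sub>R xi q f u"
proof -
  have ext: "S u = T u" if "linear S" "linear T" "\<And>xs. S (tensor xs) = T (tensor xs)"
    for S T :: "'a fock \<Rightarrow> 'a fock"
    using fock_as_sum[of u] that by (auto simp: linear_sum_list_tensor)
  have t: "tensor ((f + g) # xs) = tensor (f # xs) + tensor (g # xs)"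
      "tensor ((c *\<^sub>R f) # xs) = c *\<^sub>R tensor (f # xs)" for xs
    using multilinear_tensor[unfolded multilinear_def, rule_format, of 0 "f # xs"] by auto
  show "xi q (f + g) u = xi q f u + xi q g u"
    by (rule ext)
       (auto intro!: linear_compose_add linear_creation linear_annihilation simp: xi_def creation_tensor annihilation_tensor t
         inner_add_left distrib_left scaleR_add_left sum.distrib)
  show "xi q (c *\<^sub>R f) u = c *\<^sub>R xi q f u"
    by (rule ext)
       (auto intro!: linear_compose_scale_right linear_compose_add linear_creation
         linear_annihilation simp: xi_def creation_tensor
         annihilation_tensor t scaleR_add_right scaleR_sum_right mult.left_commute)
qed

lemma multilinear_wick: "multilinear (\<lambda>xs. wick q xs u)"
proof -
  have "multilinear_at (\<lambda>xs. wick q xs u) xs" for xs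
  proof (induction "length xs" arbitrary: xs rule: less_induct)
    case less
    show ?case
    proof (cases xs)
      case Nil
      then show ?thesis by (simp add: multilinear_at_def)
    next
      case (Cons f fs)
      have 1: "multilinear_at (\<lambda>xs. wick q xs u) fs"
        using less Cons by simp
      have 2: "multilinear_at (\<lambda>fs. \<Sum>i<length fs. (q ^ i * (f \<bullet> fs ! i)) *\<^sub>R wick q (drop_nth i fs) u) fs"
        by (rule multilinear_at_contract) (use less Cons in \<open>simp add: length_drop_nth\<close>)
      show ?thesis
        unfolding multilinear_at_def Cons
      proof (intro allI impI)
        fix i x y and c :: real
        assume i: "i < length (f # fs)"
        show "wick q ((f # fs)[i := x + y]) u = wick q ((f # fs)[i := x]) u + wick q ((f # fs)[i := y]) u \<and>
              wick q ((f # fs)[i := c *\<^sub>R x]) u = c *\<^sub>R wick q ((f # fs)[i := x]) u"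
        proof (cases i)
          case 0
          then show ?thesis
            by (simp add: xi_add xi_scaleR inner_add_left distrib_left scaleR_add_left sum.distrib
                scaleR_sum_right scaleR_diff_right mult.left_commute)
        next
          case (Suc j)
          then have j: "j < length fs" using i by simp
          have "wick q (fs[j := x + y]) u = wick q (fs[j := x]) u + wick q (fs[j := y]) u"
            "wick q (fs[j := c *\<^sub>R x]) u = c *\<^sub>R wick q (fs[j := x]) u"
            using 1 j unfolding multilinear_at_def by blast+
          moreover have
            "(\<Sum>i<length fs. (q ^ i * (f \<bullet> fs[j := x + y] ! i)) *\<^sub>R wick q (drop_nth i (fs[j := x + y])) u) =
             (\<Sum>i<length fs. (q ^ i * (f \<bullet> fs[j := x] ! i)) *\<^sub>R wick q (drop_nth i (fs[j := x])) u) +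
             (\<Sum>i<length fs. (q ^ i * (f \<bullet> fs[j := y] ! i)) *\<^sub>R wick q (drop_nth i (fs[j := y])) u)"
            "(\<Sum>i<length fs. (q ^ i * (f \<bullet> fs[j := c *\<^sub>R x] ! i)) *\<^sub>R wick q (drop_nth i (fs[j := c *\<^sub>R x])) u) =
             c *\<^sub>R (\<Sum>i<length fs. (q ^ i * (f \<bullet> fs[j := x] ! i)) *\<^sub>R wick q (drop_nth i (fs[j := x])) u)"
            using 2[unfolded multilinear_at_def, rule_format, OF j, of x y c] by simp_all
          ultimately show ?thesis
            by (simp add: Suc linear_add[OF linear_xi] linear_scale[OF linear_xi] scaleR_diff_right)
        qed
      qed
    qed
  qed
  then show ?thesis by (simp add: multilinear_iff_at)
qed

lemma wick_op_tensor: "wick_op q (tensor xs) = wick q xs"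
  unfolding wick_op_def by (simp add: lin_ext_tensor[OF multilinear_wick])

definition C_const :: "real \<Rightarrow> real" where
  "C_const q = (\<Prod>n. inverse (1 - \<bar>q\<bar> ^ Suc n))"

definition D_const :: "real \<Rightarrow> real" where
  "D_const q = inverse (1 - \<bar>q\<bar>)"

text \<open>On \<^const>\<open>field_algebra\<close> the coefficient \<open>F\<close> exists, and it is unique because
  \<open>wick_op q F\<close> maps the vacuum \<open>tensor []\<close> to \<open>F\<close>.\<close>

definition algebra_norm :: "real \<Rightarrow> ('h::real_inner fock \<Rightarrow> 'h fock) \<Rightarrow> real" where
  "algebra_norm q A =
     (let F = (THE F. wick_op q F = A)
      in \<Sum>k | degree_part k F \<noteq> 0.
           (real k + 1) * C_const q powr (3 / 2) * D_const q ^ k * fock_norm (degree_part k F))"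

section \<open>Normed and inner product spaces with explicit carriers, and completions\<close>

record 'a vspace =
  carr :: "'a set"
  vadd :: "'a \<Rightarrow> 'a \<Rightarrow> 'a"
  vscale :: "real \<Rightarrow> 'a \<Rightarrow> 'a"

record 'a nspace = "'a vspace" +
  nrm :: "'a \<Rightarrow> real"

record 'a ispace = "'a vspace" +
  inn :: "'a \<Rightarrow> 'a \<Rightarrow> real"

definition normed_of :: "'a ispace \<Rightarrow> 'a nspace" where
  "normed_of V = \<lparr>carr = carr V, vadd = vadd V, vscale = vscale V, nrm = (\<lambda>x. sqrt (inn V x x))\<rparr>"

definition ndist :: "'a nspace \<Rightarrow> 'a \<Rightarrow> 'a \<Rightarrow> real" where
  "ndist V x y = nrm V (vadd V x (vscale V (- 1) y))"

definition cauchy_in :: "'a nspace \<Rightarrow> (nat \<Rightarrow> 'a) set" where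
  "cauchy_in V = {x. range x \<subseteq> carr V \<and>
     (\<forall>e>0. \<exists>N. \<forall>m\<ge>N. \<forall>n\<ge>N. ndist V (x m) (x n) < e)}"

definition cauchy_class :: "'a nspace \<Rightarrow> (nat \<Rightarrow> 'a) \<Rightarrow> (nat \<Rightarrow> 'a) set" where
  "cauchy_class V x = {y \<in> cauchy_in V. (\<lambda>n. ndist V (x n) (y n)) \<longlonglongrightarrow> 0}"

definition const_class :: "'a nspace \<Rightarrow> 'a \<Rightarrow> (nat \<Rightarrow> 'a) set" where
  "const_class V v = cauchy_class V (\<lambda>_. v)"

definition representative :: "(nat \<Rightarrow> 'a) set \<Rightarrow> nat \<Rightarrow> 'a" where
  "representative X = (SOME x. x \<in> X)"

definition banach_completion :: "'a nspace \<Rightarrow> (nat \<Rightarrow> 'a) set nspace" where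
  "banach_completion V =
    \<lparr>carr = cauchy_class V ` cauchy_in V,
     vadd = (\<lambda>X Y. cauchy_class V (\<lambda>n. vadd V (representative X n) (representative Y n))),
     vscale = (\<lambda>c X. cauchy_class V (\<lambda>n. vscale V c (representative X n))),
     nrm = (\<lambda>X. lim (\<lambda>n. nrm V (representative X n)))\<rparr>"

definition hilbert_completion :: "'a ispace \<Rightarrow> (nat \<Rightarrow> 'a) set ispace" where
  "hilbert_completion V =
    (let W = banach_completion (normed_of V)
     in \<lparr>carr = carr W, vadd = vadd W, vscale = vscale W,
         inn = (\<lambda>X Y. lim (\<lambda>n. inn V (representative X n) (representative Y n)))\<rparr>)"

definition bounded_linear_on ::
    "'a nspace \<Rightarrow> 'b nspace \<Rightarrow> ('a \<Rightarrow> 'b) \<Rightarrow> bool" where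
  "bounded_linear_on V W T \<longleftrightarrow>
     (\<forall>x\<in>carr V. T x \<in> carr W) \<and>
     (\<forall>x\<in>carr V. \<forall>y\<in>carr V. T (vadd V x y) = vadd W (T x) (T y)) \<and>
     (\<forall>x\<in>carr V. \<forall>c. T (vscale V c x) = vscale W c (T x)) \<and>
     (\<exists>B. \<forall>x\<in>carr V. nrm W (T x) \<le> B * nrm V x)"

text \<open>As for \<^const>\<open>onorm\<close>, the quotient at \<open>x = 0\<close> is \<open>0\<close>.\<close>

definition op_norm :: "'a nspace \<Rightarrow> 'b nspace \<Rightarrow> ('a \<Rightarrow> 'b) \<Rightarrow> real" where
  "op_norm V W T = (SUP x\<in>carr V. nrm W (T x) / nrm V x)"

section \<open>Tensor products of finite families\<close>

definition tuples :: "('a, 'm) vspace_scheme list \<Rightarrow> 'a list set" where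
  "tuples Es = {xs. list_all2 (\<lambda>x E. x \<in> carr E) xs Es}"

definition mforms :: "('a, 'm) vspace_scheme list \<Rightarrow> ('a list \<Rightarrow> real) set" where
  "mforms Es = {A. \<forall>xs\<in>tuples Es. \<forall>i<length Es. \<forall>x\<in>carr (Es ! i). \<forall>y\<in>carr (Es ! i). \<forall>c.
     A (xs[i := vadd (Es ! i) x y]) = A (xs[i := x]) + A (xs[i := y]) \<and>
     A (xs[i := vscale (Es ! i) c x]) = c * A (xs[i := x])}"

text \<open>Again a tensor is a functional on multilinear forms.  For the empty family the forms are
  arbitrary scalars, so the tensor product is the scalar field.\<close>

definition tensor_sum ::
    "('a, 'm) vspace_scheme list \<Rightarrow> (real \<times> 'a list) list \<Rightarrow> ('a list \<Rightarrow> real) \<Rightarrow> real" where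
  "tensor_sum Es cs = (\<lambda>A. if A \<in> mforms Es then \<Sum>(c, xs)\<leftarrow>cs. c * A xs else 0)"

definition alg_tensor ::
    "('a, 'm) vspace_scheme list \<Rightarrow> (('a list \<Rightarrow> real) \<Rightarrow> real) vspace" where
  "alg_tensor Es =
    \<lparr>carr = {tensor_sum Es cs | cs. snd ` set cs \<subseteq> tuples Es},
     vadd = (\<lambda>u v A. u A + v A), vscale = (\<lambda>c u A. c * u A)\<rparr>"

definition alg_projective_tensor ::
    "'a nspace list \<Rightarrow> (('a list \<Rightarrow> real) \<Rightarrow> real) nspace" where
  "alg_projective_tensor Es =
    \<lparr>carr = carr (alg_tensor Es), vadd = vadd (alg_tensor Es), vscale = vscale (alg_tensor Es),
     nrm = (\<lambda>u. INF cs\<in>{cs. snd ` set cs \<subseteq> tuples Es \<and> tensor_sum Es cs = u}.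
              \<Sum>(c, xs)\<leftarrow>cs. \<bar>c\<bar> * (\<Prod>i<length Es. nrm (Es ! i) (xs ! i)))\<rparr>"

text \<open>The inner product is the bilinear extension of
  \<open>\<langle>x\<^sub>1 \<otimes> \<dots> \<otimes> x\<^sub>m, y\<^sub>1 \<otimes> \<dots> \<otimes> y\<^sub>m\<rangle> = \<langle>x\<^sub>1, y\<^sub>1\<rangle> \<cdots> \<langle>x\<^sub>m, y\<^sub>m\<rangle>\<close>: \<open>u\<close> and \<open>v\<close> are evaluated on this
  multilinear form in the \<open>x\<^sub>i\<close> and in the \<open>y\<^sub>i\<close>.\<close>

definition alg_hilbert_tensor ::
    "'a ispace list \<Rightarrow> (('a list \<Rightarrow> real) \<Rightarrow> real) ispace" where
  "alg_hilbert_tensor Es =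
    \<lparr>carr = carr (alg_tensor Es), vadd = vadd (alg_tensor Es), vscale = vscale (alg_tensor Es),
     inn = (\<lambda>u v. v (\<lambda>ys. u (\<lambda>xs. \<Prod>i<length Es. inn (Es ! i) (xs ! i) (ys ! i))))\<rparr>"

type_synonym 'a ctensor = "(nat \<Rightarrow> ('a list \<Rightarrow> real) \<Rightarrow> real) set"

definition projective_tensor :: "'a nspace list \<Rightarrow> 'a ctensor nspace" where
  "projective_tensor Es = banach_completion (alg_projective_tensor Es)"

definition projective_elem :: "'a nspace list \<Rightarrow> 'a list \<Rightarrow> 'a ctensor" where
  "projective_elem Es xs = const_class (alg_projective_tensor Es) (tensor_sum Es [(1, xs)])"

definition hilbert_tensor :: "'a ispace list \<Rightarrow> 'a ctensor ispace" where
  "hilbert_tensor Es = hilbert_completion (alg_hilbert_tensor Es)"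

definition hilbert_elem :: "'a ispace list \<Rightarrow> 'a list \<Rightarrow> 'a ctensor" where
  "hilbert_elem Es xs = const_class (normed_of (alg_hilbert_tensor Es)) (tensor_sum Es [(1, xs)])"

definition alg_power :: "nat \<Rightarrow> 'h::real_inner fock ispace" where
  "alg_power n =
    \<lparr>carr = {u. degree_part n u = u}, vadd = (+), vscale = (*\<^sub>R), inn = fock_inner\<rparr>"

definition hilbert_power :: "nat \<Rightarrow> (nat \<Rightarrow> 'h::real_inner fock) set ispace" where
  "hilbert_power n = hilbert_completion (alg_power n)"

definition power_elem :: "'h::real_inner list \<Rightarrow> (nat \<Rightarrow> 'h fock) set" where
  "power_elem xs = const_class (normed_of (alg_power (length xs))) (tensor xs)"

definition alg_A :: "real \<Rightarrow> ('h::real_inner fock \<Rightarrow> 'h fock) nspace" where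
  "alg_A q =
    \<lparr>carr = field_algebra q, vadd = (\<lambda>A B u. A u + B u), vscale = (\<lambda>c A u. c *\<^sub>R A u),
     nrm = algebra_norm q\<rparr>"

definition banach_A :: "real \<Rightarrow> (nat \<Rightarrow> 'h::real_inner fock \<Rightarrow> 'h fock) set nspace" where
  "banach_A q = banach_completion (alg_A q)"

section \<open>Contractions and partitioned sets\<close>

text \<open>A finite totally ordered set is represented by the list of its elements in increasing order
  (without repetitions), an \<open>m\<close>-partitioned set by the list of its \<open>m\<close> blocks; the underlying
  ordered set of the latter is \<^term>\<open>concat Is\<close>.\<close>

definition before :: "'i list \<Rightarrow> 'i \<Rightarrow> 'i \<Rightarrow> bool" where
  "before K x y \<longleftrightarrow> (\<exists>a b. a < b \<and> b < length K \<and> K ! a = x \<and> K ! b = y)"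

definition contractions :: "'i list \<Rightarrow> ('i \<times> 'i) set set" where
  "contractions K = {\<sigma>. (\<forall>(i, j)\<in>\<sigma>. before K i j) \<and>
     (\<forall>(i, j)\<in>\<sigma>. \<forall>(k, l)\<in>\<sigma>. (i, j) \<noteq> (k, l) \<longrightarrow> {i, j} \<inter> {k, l} = {})}"

definition unpaired :: "'i list \<Rightarrow> ('i \<times> 'i) set \<Rightarrow> 'i list" where
  "unpaired K \<sigma> = filter (\<lambda>i. i \<notin> Field \<sigma>) K"

definition crossings :: "'i list \<Rightarrow> ('i \<times> 'i) set \<Rightarrow> nat" where
  "crossings K \<sigma> =
     card {((i, j), (k, l)) | i j k l. (i, j) \<in> \<sigma> \<and> (k, l) \<in> \<sigma> \<and>
             before K i k \<and> before K k j \<and> before K j l}"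

definition spanned :: "'i list \<Rightarrow> ('i \<times> 'i) set \<Rightarrow> nat" where
  "spanned K \<sigma> =
     (\<Sum>(s, t)\<in>\<sigma>. card {u \<in> set (unpaired K \<sigma>). before K s u \<and> before K u t})"

definition crbar :: "'i list \<Rightarrow> ('i \<times> 'i) set \<Rightarrow> nat" where
  "crbar K \<sigma> = crossings K \<sigma> + spanned K \<sigma>"

definition wick_contraction ::
    "real \<Rightarrow> 'i list \<Rightarrow> ('i \<times> 'i) set \<Rightarrow> ('i \<Rightarrow> 'h::real_inner) \<Rightarrow> 'h fock \<Rightarrow> 'h fock" where
  "wick_contraction q K \<sigma> f = (\<lambda>u.
     (q ^ crbar K \<sigma> * (\<Prod>(s, t)\<in>\<sigma>. f s \<bullet> f t)) *\<^sub>R wick q (map f (unpaired K \<sigma>)) u)"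

definition partitioned :: "nat \<Rightarrow> 'i list list \<Rightarrow> bool" where
  "partitioned m Is \<longleftrightarrow> length Is = m \<and> distinct (concat Is)"

definition unpaired_blocks :: "'i list list \<Rightarrow> ('i \<times> 'i) set \<Rightarrow> 'i list list" where
  "unpaired_blocks Is \<sigma> = map (\<lambda>K. unpaired K \<sigma>) Is"

definition block_contractions :: "'i list list \<Rightarrow> ('i \<times> 'i) set set" where
  "block_contractions Is =
     {\<sigma> \<in> contractions (concat Is). \<forall>(i, j)\<in>\<sigma>. \<not> (\<exists>K\<in>set Is. i \<in> set K \<and> j \<in> set K)}"

text \<open>The disjoint union of the two index sets is their sum type, so the natural interleaving of
  families \<open>f\<close> and \<open>g\<close> is \<^term>\<open>case_sum f g\<close>.\<close>

definition interleave :: "'i list list \<Rightarrow> 'j list list \<Rightarrow> ('i + 'j) list list"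
    (infixr \<open>\<wr>\<close> 65) where
  "Is \<wr> Js = splice (map (map Inl) Is) (map (map Inr) Js)"

definition R_contractions ::
    "'i list list \<Rightarrow> 'j list list \<Rightarrow> (('i + 'j) \<times> ('i + 'j)) set set" where
  "R_contractions Is Js =
     {\<sigma> \<in> block_contractions (Is \<wr> Js). \<forall>(x, y)\<in>\<sigma>. \<not> (x \<in> range Inl \<and> y \<in> range Inl)}"

text \<open>The subtraction is harmless: the pairs of \<open>\<sigma>\<close> contribute to the minuend at least what they
  contribute to the subtrahend.\<close>

definition crbar2 ::
    "'i list list \<Rightarrow> 'j list list \<Rightarrow> ('i \<times> 'i) set \<Rightarrow> (('i + 'j) \<times> ('i + 'j)) set \<Rightarrow> nat" where
  "crbar2 Is Js \<pi> \<sigma> =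
     crbar (concat (Is \<wr> Js)) (map_prod Inl Inl ` \<pi> \<union> \<sigma>) -
     crbar (concat (unpaired_blocks Is \<pi> \<wr> Js)) \<sigma>"

definition xi_R ::
    "real \<Rightarrow> 'i list list \<Rightarrow> 'j list list \<Rightarrow> ('i \<times> 'i) set \<Rightarrow>
     ('i \<Rightarrow> 'h::real_inner) \<Rightarrow> ('j \<Rightarrow> 'h) \<Rightarrow> 'h fock \<Rightarrow> 'h fock" where
  "xi_R q Is Js \<pi> f g = (\<lambda>u. let L = unpaired_blocks Is \<pi> in
     \<Sum>\<sigma>\<in>R_contractions L Js.
       q ^ crbar2 Is Js \<pi> \<sigma> *\<^sub>R wick_contraction q (concat (L \<wr> Js)) \<sigma> (case_sum f g) u)"

type_synonym 'h power = "(nat \<Rightarrow> 'h fock) set"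

definition R_domain ::
    "'i list list \<Rightarrow> 'j list list \<Rightarrow> 'h::real_inner power ctensor ctensor nspace" where
  "R_domain Ls Js = projective_tensor
     [normed_of (hilbert_tensor (map (\<lambda>K. hilbert_power (length K)) Ls)),
      projective_tensor (map (\<lambda>K. normed_of (hilbert_power (length K))) Js)]"

text \<open>\<open>R_elem Ls Js f g\<close> is the elementary tensor \<open>f\<^bsub>\<otimes>L\<^esub> \<otimes> G\<^sub>1 \<otimes> \<dots> \<otimes> G\<^bsub>n-1\<^esub>\<close> with \<open>G\<^sub>j = g\<^bsub>\<otimes>J\<^sub>j\<^esub>\<close>.
  A linear map extends the multilinear extension of \<^const>\<open>xi_R\<close> precisely if it agrees with
  \<^const>\<open>xi_R\<close> at these tensors for all families \<open>f\<close> and \<open>g\<close>.\<close>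

definition R_elem ::
    "'i list list \<Rightarrow> 'j list list \<Rightarrow> ('i \<Rightarrow> 'h::real_inner) \<Rightarrow> ('j \<Rightarrow> 'h) \<Rightarrow>
     'h power ctensor ctensor" where
  "R_elem Ls Js f g = projective_elem
     [normed_of (hilbert_tensor (map (\<lambda>K. hilbert_power (length K)) Ls)),
      projective_tensor (map (\<lambda>K. normed_of (hilbert_power (length K))) Js)]
     [hilbert_elem (map (\<lambda>K. hilbert_power (length K)) Ls) (map (\<lambda>K. power_elem (map f K)) Ls),
      projective_elem (map (\<lambda>K. normed_of (hilbert_power (length K))) Js)
        (map (\<lambda>K. power_elem (map g K)) Js)]"

end

theory Submission
  imports Defs "HOL-Probability.Discrete_Topology"
begin

text \<open>Expanding \<open>\<xi>\<^sub>q\<^sup>R\<close> over the contractions \<open>\<sigma>\<close>, each summand is a tensor network in which no pair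
  joins a node to itself, so Cauchy--Schwarz, applied to one pair at a time, bounds its Hilbert norm
  by the product of the norms of the tensors entering it.  A contraction leaves
  \<open>k = |L| + |J| - 2 |\<sigma>|\<close> elements unpaired, so with \<open>r = |q|\<close> it remains to bound the sum of
  \<open>r ^ cr(\<sigma>) (1 - r) ^ (2 |\<sigma>|) (k + 1)\<close> over all contractions without pairs inside a block by the product
  of the \<open>|K| + 1\<close>.  Adding the blocks one at a time reduces this to
  \<open>\<Sum>p\<le>min a m. a + m + 1 - 2 p = (a + 1) (m + 1)\<close>, because the contractions with \<open>p\<close> pairs between two
  blocks of sizes \<open>a\<close> and \<open>m\<close> have total weight at most \<open>1\<close>.

  For the passage to the completions, the algebraic part of the target is embedded isometrically into
  a Banach space of bounded functions, by pairing with the elements of the algebraic Fock space whose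
  homogeneous parts have norm at most \<open>1\<close>.  The extension takes values in the closure of the image,
  which is the target space.\<close>

section \<open>Contractions of blocks\<close>

text \<open>The factor (1 - r) ^ (2 |\<sigma>|) comes from the target: degree k carries
  \<open>D_const q ^ k\<close>, and each pair lowers k by two against the exponent |L| + |J| of the
  bound. It pays for the choice of partners. Joining an element to the j-th unpaired element beyond
  its block (j counted from 0) costs r ^ (a + j), with a unpaired elements behind it in its own
  block, and one factor 1 - r sums this geometric series. The constant
  \<open>C_const q powr (3 / 2)\<close> is the same in all degrees and passes through, and \<pi>
  contributes a power of q of modulus at most 1.

  The two kinds of tensor norms reflect which pairs are allowed. None joins two elements of L, so
  all of L is a single node of the network, and the estimate holds for an arbitrary element of the
  Hilbert tensor product. Pairs between different blocks of J do occur, so these blocks are separate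
  nodes, and the product of their norms is what the projective norm asks for.

  All estimates concern algebraic tensors, which live over the span of finitely many vectors;
  completed spaces are reached by limits alone.\<close>

lemma before_Nil [simp]: "\<not> before [] a b"
  by (simp add: before_def)

lemma before_Cons: "before (x # K) a b \<longleftrightarrow> (a = x \<and> b \<in> set K) \<or> before K a b"
proof
  assume "before (x # K) a b"
  then obtain i j where ij: "i < j" "j < Suc (length K)" "(x # K) ! i = a" "(x # K) ! j = b"
    by (auto simp: before_def)
  then obtain j' where j': "j = Suc j'" by (cases j) auto
  show "(a = x \<and> b \<in> set K) \<or> before K a b"
  proof (cases i)
    case 0
    then show ?thesis using ij j' by auto
  next
    case (Suc i')
    then show ?thesis using ij j' unfolding before_def by (intro disjI2 exI[of _ i'] exI[of _ j']) auto
  qed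
next
  assume "(a = x \<and> b \<in> set K) \<or> before K a b"
  then show "before (x # K) a b"
  proof
    assume "a = x \<and> b \<in> set K"
    then obtain j where "j < length K" "K ! j = b" "a = x" by (auto simp: in_set_conv_nth)
    then show ?thesis unfolding before_def by (intro exI[of _ 0] exI[of _ "Suc j"]) auto
  next
    assume "before K a b"
    then obtain i j where "i < j" "j < length K" "K ! i = a" "K ! j = b" by (auto simp: before_def)
    then show ?thesis unfolding before_def by (intro exI[of _ "Suc i"] exI[of _ "Suc j"]) auto
  qed
qed

lemma before_in_set: "before K a b \<Longrightarrow> a \<in> set K \<and> b \<in> set K"
  by (induction K) (auto simp: before_Cons)

lemma before_irrefl: "distinct K \<Longrightarrow> \<not> before K a a"
  by (induction K) (auto simp: before_Cons)

lemma before_filter: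
  "distinct K \<Longrightarrow> before (filter P K) a b \<longleftrightarrow> P a \<and> P b \<and> before K a b"
  by (induction K) (auto simp: before_Cons dest: before_in_set)

lemma card_before_nth:
  assumes "distinct K" "i < length K"
  shows "card {u. before K u (K ! i)} = i"
proof -
  have "{u. before K u (K ! i)} = (!) K ` {..<i}"
    using assms by (auto simp: before_def nth_eq_iff_index_eq image_iff)
  moreover have "inj_on ((!) K) {..<i}"
    using assms by (auto simp: inj_on_def nth_eq_iff_index_eq)
  ultimately show ?thesis by (simp add: card_image)
qed

text \<open>Curried quantifiers replace the pair patterns of the definition, so that the three
  conditions can be instantiated separately.\<close>

lemma block_contractions_iff:
  "\<sigma> \<in> block_contractions Ks \<longleftrightarrow>
    (\<forall>i j. (i, j) \<in> \<sigma> \<longrightarrow> before (concat Ks) i j) \<and>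
    (\<forall>i j k l. (i, j) \<in> \<sigma> \<longrightarrow> (k, l) \<in> \<sigma> \<longrightarrow> (i, j) \<noteq> (k, l) \<longrightarrow> {i, j} \<inter> {k, l} = {}) \<and>
    (\<forall>i j K. (i, j) \<in> \<sigma> \<longrightarrow> K \<in> set Ks \<longrightarrow> \<not> (i \<in> set K \<and> j \<in> set K))"
  unfolding block_contractions_def contractions_def Ball_def split_paired_All mem_Collect_eq
    prod.case Bex_def by (simp only: conj_assoc simp_thms) meson

lemma contractions_Field: "\<sigma> \<in> contractions K \<Longrightarrow> Field \<sigma> \<subseteq> set K"
  by (fastforce simp: contractions_def Field_def dest: before_in_set)

lemma contractions_subset: "contractions K \<subseteq> Pow (set K \<times> set K)"
  by (fastforce simp: contractions_def dest: before_in_set)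

lemma finite_contractions [simp]: "finite (contractions K)"
  by (rule finite_subset[OF contractions_subset]) simp

lemma finite_contraction: "\<sigma> \<in> contractions K \<Longrightarrow> finite \<sigma>"
  using contractions_subset[of K] by (meson Pow_iff finite_SigmaI finite_set finite_subset subsetD)

lemma block_contractions_contractions: "\<sigma> \<in> block_contractions Ks \<Longrightarrow> \<sigma> \<in> contractions (concat Ks)"
  by (simp add: block_contractions_def)

lemma finite_block_contractions [simp]: "finite (block_contractions Ks)"
  by (simp add: block_contractions_def)

text \<open>An unpaired element to the left of all others lies inside no pair, so it takes part in
  no crossing and is not spanned.\<close>

lemma crbar_Cons_unpaired:
  assumes "\<sigma> \<in> contractions K" "distinct (x # K)"
  shows "crbar (x # K) \<sigma> = crbar K \<sigma>"
proof -
  have F: "i \<noteq> x" "j \<noteq> x" if "(i, j) \<in> \<sigma>" for i j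
    using that assms contractions_Field[OF assms(1)] by (auto simp: Field_def)
  have xF: "x \<notin> Field \<sigma>" using assms contractions_Field by fastforce
  have "crossings (x # K) \<sigma> = crossings K \<sigma>"
    unfolding crossings_def before_Cons
    by (intro arg_cong[where f = card] Collect_cong) (use F in blast)
  moreover have "spanned (x # K) \<sigma> = spanned K \<sigma>"
    unfolding spanned_def before_Cons
  proof (intro sum.cong refl, clarify, intro arg_cong[where f = card] Collect_cong)
    fix s t u assume "(s, t) \<in> \<sigma>"
    then show "(u \<in> set (unpaired (x # K) \<sigma>) \<and> (s = x \<and> u \<in> set K \<or> before K s u) \<and>
        (u = x \<and> t \<in> set K \<or> before K u t)) =
        (u \<in> set (unpaired K \<sigma>) \<and> before K s u \<and> before K u t)"
      using F assms(2) xF by (auto simp: unpaired_def dest: before_in_set)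
  qed
  ultimately show ?thesis by (simp add: crbar_def)
qed

text \<open>The pairs of \<open>\<sigma>\<close> spanning \<open>t\<close> are crossed by \<open>(x, t)\<close> instead, so the only change comes
  from the unpaired elements spanned by the new pair.\<close>

lemma crbar_Cons_insert:
  assumes \<sigma>: "\<sigma> \<in> contractions K" and d: "distinct (x # K)" and t: "t \<in> set K" "t \<notin> Field \<sigma>"
  shows "crbar (x # K) (insert (x, t) \<sigma>) =
    crbar K \<sigma> + card {u \<in> set (unpaired K \<sigma>). before K u t}"
proof -
  have F: "i \<noteq> x" "j \<noteq> x" "i \<noteq> t" "j \<noteq> t" "i \<in> set K" "j \<in> set K" if "(i, j) \<in> \<sigma>" for i j
    using that d t contractions_Field[OF \<sigma>] by (auto simp: Field_def)
  have fin: "finite \<sigma>" using \<sigma> by (rule finite_contraction)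
  have nx: "(x, t) \<notin> \<sigma>" using F by blast
  have xK: "\<not> before K a x" "\<not> before K x a" for a
    using d by (auto dest: before_in_set)
  let ?B = "{(k, l) \<in> \<sigma>. before K k t \<and> before K t l}"
  let ?C = "{((i, j), (k, l)) | i j k l. (i, j) \<in> \<sigma> \<and> (k, l) \<in> \<sigma> \<and>
             before K i k \<and> before K k j \<and> before K j l}"
  \<comment> \<open>As \<open>x\<close> precedes everything, the new pair can only be the left one
    of a crossing, and it crosses exactly the pairs of \<sigma> that span \<open>t\<close>; these
    form \<open>?B\<close>.\<close>
  have "{((i, j), (k, l)) | i j k l. (i, j) \<in> insert (x, t) \<sigma> \<and> (k, l) \<in> insert (x, t) \<sigma> \<and>
             before (x # K) i k \<and> before (x # K) k j \<and> before (x # K) j l} =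
        ?C \<union> Pair (x, t) ` ?B" (is "?A = _")
  proof (rule set_eqI)
    fix z :: "('a \<times> 'a) \<times> ('a \<times> 'a)"
    obtain i j k l where z: "z = ((i, j), (k, l))" by (metis surj_pair)
    have "z \<in> ?A \<longleftrightarrow> (i, j) \<in> insert (x, t) \<sigma> \<and> (k, l) \<in> insert (x, t) \<sigma> \<and>
             before (x # K) i k \<and> before (x # K) k j \<and> before (x # K) j l"
      using z by auto
    moreover have "z \<in> ?C \<union> Pair (x, t) ` ?B \<longleftrightarrow>
        (i, j) \<in> \<sigma> \<and> (k, l) \<in> \<sigma> \<and> before K i k \<and> before K k j \<and> before K j l \<or>
        (i, j) = (x, t) \<and> (k, l) \<in> \<sigma> \<and> before K k t \<and> before K t l"
      using z by auto
    moreover have "(i, j) \<in> insert (x, t) \<sigma> \<and> (k, l) \<in> insert (x, t) \<sigma> \<and>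
             before (x # K) i k \<and> before (x # K) k j \<and> before (x # K) j l \<longleftrightarrow>
        (i, j) \<in> \<sigma> \<and> (k, l) \<in> \<sigma> \<and> before K i k \<and> before K k j \<and> before K j l \<or>
        (i, j) = (x, t) \<and> (k, l) \<in> \<sigma> \<and> before K k t \<and> before K t l"
    proof (cases "(k, l) = (x, t)")
      case True
      have "\<not> before (x # K) i x" using d xK by (auto simp: before_Cons)
      then show ?thesis using True nx by auto
    next
      case kl: False
      show ?thesis
      proof (cases "(i, j) = (x, t)")
        case True
        then show ?thesis using kl nx F t d by (auto simp: before_Cons)
      next
        case False
        then show ?thesis using kl F by (auto simp: before_Cons)
      qed
    qed
    ultimately show "z \<in> ?A \<longleftrightarrow> z \<in> ?C \<union> Pair (x, t) ` ?B" by (simp only:)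
  qed
  moreover have "finite ?C"
    by (rule finite_subset[of _ "\<sigma> \<times> \<sigma>"]) (use fin in auto)
  moreover have "?C \<inter> Pair (x, t) ` ?B = {}" using nx by auto
  moreover have "finite ?B" by (rule finite_subset[OF _ fin]) auto
  ultimately have cr: "crossings (x # K) (insert (x, t) \<sigma>) = crossings K \<sigma> + card ?B"
    unfolding crossings_def by (simp add: card_Un_disjoint card_image inj_on_def)
  have U: "set (unpaired (x # K) (insert (x, t) \<sigma>)) = set (unpaired K \<sigma>) - {t}"
    using d by (auto simp: unpaired_def Field_def)
  have 1: "card {u \<in> set (unpaired (x # K) (insert (x, t) \<sigma>)). before (x # K) x u \<and> before (x # K) u t} =
      card {u \<in> set (unpaired K \<sigma>). before K u t}"
    unfolding U before_Cons using d t before_irrefl[of K t]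
    by (intro arg_cong[where f = card] Collect_cong) (auto simp: unpaired_def)
  have tu: "t \<in> set (unpaired K \<sigma>)" using t by (simp add: unpaired_def)
  \<comment> \<open>Now that \<open>t\<close> is paired, an old pair loses one spanned element
    exactly if it spans \<open>t\<close>. The loss stands on the left as a summand to avoid
    truncated subtraction; added up over \<sigma> it is \<open>card ?B\<close>.\<close>
  have 2: "card {u \<in> set (unpaired (x # K) (insert (x, t) \<sigma>)). before (x # K) a u \<and> before (x # K) u b} +
        of_bool (before K a t \<and> before K t b) =
      card {u \<in> set (unpaired K \<sigma>). before K a u \<and> before K u b}" if "(a, b) \<in> \<sigma>" for a b
  proof -
    let ?S = "{u \<in> set (unpaired K \<sigma>). before K a u \<and> before K u b}"
    have eq: "{u \<in> set (unpaired (x # K) (insert (x, t) \<sigma>)). before (x # K) a u \<and> before (x # K) u b} = ?S - {t}"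
      unfolding U before_Cons using F[OF that] d by (auto simp: unpaired_def)
    have S: "card (S - {t}) + of_bool (t \<in> S) = card S" if "finite S" for S
      using that card.remove[of S t] by (cases "t \<in> S") simp_all
    have mem: "t \<in> ?S \<longleftrightarrow> before K a t \<and> before K t b" using tu by simp
    show ?thesis unfolding eq mem[symmetric] by (rule S) simp
  qed
  let ?U' = "set (unpaired (x # K) (insert (x, t) \<sigma>))"
  let ?c' = "\<lambda>p. card {u \<in> ?U'. before (x # K) (fst p) u \<and> before (x # K) u (snd p)}"
  let ?c = "\<lambda>p. card {u \<in> set (unpaired K \<sigma>). before K (fst p) u \<and> before K u (snd p)}"
  let ?P = "\<lambda>p. before K (fst p) t \<and> before K t (snd p)"
  have "(\<Sum>p\<in>\<sigma>. of_bool (?P p)) = card {p \<in> \<sigma>. ?P p}"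
    by (simp only: card_eq_sum sum.inter_filter[OF fin] of_bool_def)
  also have "{p \<in> \<sigma>. ?P p} = ?B" by auto
  finally have B: "(\<Sum>p\<in>\<sigma>. of_bool (?P p)) = card ?B" .
  have "spanned (x # K) (insert (x, t) \<sigma>) = card {u \<in> set (unpaired K \<sigma>). before K u t} + (\<Sum>p\<in>\<sigma>. ?c' p)"
    unfolding spanned_def case_prod_beta sum.insert[OF fin nx] fst_conv snd_conv 1 ..
  moreover have "(\<Sum>p\<in>\<sigma>. ?c' p) + card ?B = spanned K \<sigma>"
    unfolding spanned_def case_prod_beta B[symmetric] sum.distrib[symmetric]
    by (rule sum.cong[OF refl], rule 2) simp
  ultimately show ?thesis using cr by (simp only: crbar_def)
qed

text \<open>Being leftmost, \<open>x\<close> can only be the first component of a pair, and its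
  partner lies outside its block; deleting that pair leaves a contraction of the remaining elements.
  An inclusion is enough for an upper bound of a sum of nonnegative terms.\<close>

lemma block_contractions_Cons_subset:
  assumes d: "distinct ((x # A) @ concat Ks)"
  shows "block_contractions ((x # A) # Ks) \<subseteq> block_contractions (A # Ks) \<union>
    (\<lambda>(\<sigma>, t). insert (x, t) \<sigma>) `
      (SIGMA \<sigma>:block_contractions (A # Ks). set (unpaired (concat Ks) \<sigma>))"
proof
  fix \<sigma> assume \<sigma>: "\<sigma> \<in> block_contractions ((x # A) # Ks)"
  let ?K = "A @ concat Ks"
  have bef: "before (x # ?K) i j" if "(i, j) \<in> \<sigma>" for i j
    using \<sigma>[unfolded block_contractions_iff, THEN conjunct1] that by simp
  have disj: "{i, j} \<inter> {k, l} = {}" if "(i, j) \<in> \<sigma>" "(k, l) \<in> \<sigma>" "(i, j) \<noteq> (k, l)" for i j k l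
    using \<sigma>[unfolded block_contractions_iff, THEN conjunct2, THEN conjunct1] that by blast
  have blk: "\<not> (i \<in> set B \<and> j \<in> set B)" if "(i, j) \<in> \<sigma>" "B \<in> set ((x # A) # Ks)" for i j B
    using \<sigma>[unfolded block_contractions_iff, THEN conjunct2, THEN conjunct2] that by blast
  have snd: "j \<noteq> x" if "(i, j) \<in> \<sigma>" for i j
    using bef[OF that] d by (auto simp: before_Cons dest: before_in_set)
  \<comment> \<open>Applied to \<sigma> itself if \<open>x\<close> is unpaired, and to \<sigma>
    without the pair of \<open>x\<close> otherwise.\<close>
  have sub: "\<rho> \<in> block_contractions (A # Ks)" if "\<rho> \<subseteq> \<sigma>" "\<And>i j. (i, j) \<in> \<rho> \<Longrightarrow> i \<noteq> x" for \<rho>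
  proof -
    have "before ?K i j" if "(i, j) \<in> \<rho>" for i j
      using bef[of i j] that \<open>\<rho> \<subseteq> \<sigma>\<close> \<open>\<And>i j. (i, j) \<in> \<rho> \<Longrightarrow> i \<noteq> x\<close> by (auto simp: before_Cons)
    moreover have "\<not> (i \<in> set B \<and> j \<in> set B)" if "(i, j) \<in> \<rho>" "B \<in> set (A # Ks)" for i j B
      using blk[of i j "x # A"] blk[of i j B] that \<open>\<rho> \<subseteq> \<sigma>\<close> by auto
    moreover have "{i, j} \<inter> {k, l} = {}" if "(i, j) \<in> \<rho>" "(k, l) \<in> \<rho>" "(i, j) \<noteq> (k, l)" for i j k l
      by (rule disj) (use that \<open>\<rho> \<subseteq> \<sigma>\<close> in auto)
    ultimately show ?thesis
      unfolding block_contractions_iff concat.simps by metis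
  qed
  show "\<sigma> \<in> block_contractions (A # Ks) \<union>
    (\<lambda>(\<sigma>, t). insert (x, t) \<sigma>) `
      (SIGMA \<sigma>:block_contractions (A # Ks). set (unpaired (concat Ks) \<sigma>))"
  proof (cases "\<exists>t. (x, t) \<in> \<sigma>")
    case False
    then show ?thesis using sub[of \<sigma>] by blast
  next
    case True
    then obtain t where t: "(x, t) \<in> \<sigma>" by blast
    let ?r = "\<sigma> - {(x, t)}"
    have "?r \<in> block_contractions (A # Ks)"
      by (rule sub) (use disj[OF t] in auto)
    moreover have "t \<in> set (unpaired (concat Ks) ?r)"
    proof -
      have "t \<in> set ?K" using bef[OF t] by (auto simp: before_Cons dest: before_in_set)
      moreover have "t \<notin> set A" using blk[OF t, of "x # A"] by auto
      moreover have "t \<notin> Field ?r" using disj[OF t] by (fastforce simp: Field_def)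
      ultimately show ?thesis by (auto simp: unpaired_def)
    qed
    moreover have "\<sigma> = insert (x, t) ?r" using t by blast
    ultimately show ?thesis by (intro UnI2 image_eqI[of _ _ "(?r, t)"]) auto
  qed
qed

text \<open>Evaluates the increase in \<open>crbar_Cons_insert\<close>: the new pair spans all
  unpaired elements of \<open>A\<close> and the first \<open>j\<close> of those in \<open>M\<close>.
  As \<open>j\<close> varies, the powers of r with these exponents form a geometric series.\<close>

lemma card_unpaired_before:
  assumes "distinct (A @ M)" "j < length (unpaired M \<sigma>)"
  shows "card {u \<in> set (unpaired (A @ M) \<sigma>). before (A @ M) u (unpaired M \<sigma> ! j)} =
    length (unpaired A \<sigma>) + j"
proof -
  let ?N = "unpaired (A @ M) \<sigma>"
  have N: "?N = unpaired A \<sigma> @ unpaired M \<sigma>" by (simp add: unpaired_def)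
  have nth: "unpaired M \<sigma> ! j = ?N ! (length (unpaired A \<sigma>) + j)" by (simp add: N)
  have "?N ! (length (unpaired A \<sigma>) + j) \<in> set ?N"
    using assms(2) by (intro nth_mem) (simp add: N)
  then have "{u \<in> set ?N. before (A @ M) u (unpaired M \<sigma> ! j)} = {u. before ?N u (?N ! (length (unpaired A \<sigma>) + j))}"
    unfolding nth unpaired_def before_filter[OF assms(1)] by (auto dest: before_in_set)
  moreover have "distinct ?N" using assms(1) unfolding unpaired_def by (rule distinct_filter)
  ultimately show ?thesis
    using card_before_nth[of ?N "length (unpaired A \<sigma>) + j"] assms(2) by (simp add: N)
qed

text \<open>The exponent counts the two elements removed by each pair: with r = \<bar>q\<bar>,
  \<open>D_const q ^ length K * (1 - r) ^ (2 * card \<sigma>)\<close> is the power of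
  \<open>D_const q\<close> that belongs to the degree of the contracted tensor.\<close>

definition contraction_weight :: "real \<Rightarrow> 'i list \<Rightarrow> ('i \<times> 'i) set \<Rightarrow> real" where
  "contraction_weight r K \<sigma> = r ^ crbar K \<sigma> * (1 - r) ^ (2 * card \<sigma>)"

lemma contraction_weight_nonneg: "0 \<le> r \<Longrightarrow> r \<le> 1 \<Longrightarrow> 0 \<le> contraction_weight r K \<sigma>"
  by (simp add: contraction_weight_def)

text \<open>One step of a recursion over the elements from left to right: \<open>x\<close> either
  stays unpaired or is joined to an unpaired element of a later block. The recursion only has to
  remember the numbers of unpaired elements inside and to the right of the block, so \<phi> is an
  arbitrary nonnegative function of these two.\<close>

lemma sum_contraction_weight_Cons:
  fixes \<phi> :: "nat \<Rightarrow> nat \<Rightarrow> real"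
  assumes r: "0 \<le> r" "r \<le> 1" and d: "distinct ((x # A) @ concat Ks)" and \<phi>: "\<And>a m. 0 \<le> \<phi> a m"
  shows "(\<Sum>\<sigma>\<in>block_contractions ((x # A) # Ks). contraction_weight r ((x # A) @ concat Ks) \<sigma> *
        \<phi> (length (unpaired (x # A) \<sigma>)) (length (unpaired (concat Ks) \<sigma>))) \<le>
    (\<Sum>\<sigma>\<in>block_contractions (A # Ks). contraction_weight r (A @ concat Ks) \<sigma> *
        (\<phi> (Suc (length (unpaired A \<sigma>))) (length (unpaired (concat Ks) \<sigma>)) +
         (1 - r)\<^sup>2 * (\<Sum>j<length (unpaired (concat Ks) \<sigma>). r ^ (length (unpaired A \<sigma>) + j)) *
           \<phi> (length (unpaired A \<sigma>)) (length (unpaired (concat Ks) \<sigma>) - 1)))"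
    (is "sum ?f ?L \<le> sum ?g ?B")
proof -
  let ?M = "concat Ks"
  let ?ins = "\<lambda>(\<sigma>, t). insert (x, t) \<sigma>"
  let ?S = "SIGMA \<sigma>:?B. set (unpaired ?M \<sigma>)"
  have f0: "0 \<le> ?f \<sigma>" for \<sigma> using r \<phi> contraction_weight_nonneg by (intro mult_nonneg_nonneg) auto
  have finS: "finite ?S" by auto
  have "sum ?f ?L \<le> sum ?f (?B \<union> ?ins ` ?S)"
    by (rule sum_mono2) (use f0 block_contractions_Cons_subset[OF d] finS in auto)
  also have "\<dots> \<le> sum ?f ?B + sum ?f (?ins ` ?S)"
    using f0 finS by (subst sum_Un) (auto intro: sum_nonneg)
  also have "sum ?f (?ins ` ?S) \<le> sum (?f \<circ> ?ins) ?S"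
    by (rule sum_image_le) (use f0 finS in auto)
  also have "sum (?f \<circ> ?ins) ?S = (\<Sum>\<sigma>\<in>?B. \<Sum>t\<in>set (unpaired ?M \<sigma>). ?f (insert (x, t) \<sigma>))"
    by (subst sum.Sigma) (auto intro!: sum.cong)
  also have "sum ?f ?B + \<dots> = (\<Sum>\<sigma>\<in>?B. ?f \<sigma> + (\<Sum>t\<in>set (unpaired ?M \<sigma>). ?f (insert (x, t) \<sigma>)))"
    by (simp add: sum.distrib)
  also have "\<dots> = sum ?g ?B"
  proof (rule sum.cong[OF refl])
    fix \<sigma> assume "\<sigma> \<in> ?B"
    then have \<sigma>: "\<sigma> \<in> contractions (A @ ?M)" using block_contractions_contractions by fastforce
    have dK: "distinct (x # A @ ?M)" using d by simp
    have F: "Field \<sigma> \<subseteq> set (A @ ?M)" using contractions_Field[OF \<sigma>] .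
    have xF: "x \<notin> Field \<sigma>" using F dK by auto
    have "?f \<sigma> = contraction_weight r (A @ ?M) \<sigma> * \<phi> (Suc (length (unpaired A \<sigma>))) (length (unpaired ?M \<sigma>))"
      using crbar_Cons_unpaired[OF \<sigma> dK] xF by (simp add: contraction_weight_def unpaired_def)
    moreover have "?f (insert (x, t) \<sigma>) = contraction_weight r (A @ ?M) \<sigma> * (1 - r)\<^sup>2 *
        r ^ card {u \<in> set (unpaired (A @ ?M) \<sigma>). before (A @ ?M) u t} *
        \<phi> (length (unpaired A \<sigma>)) (length (unpaired ?M \<sigma>) - 1)"
      if t: "t \<in> set (unpaired ?M \<sigma>)" for t
    proof -
      have t': "t \<in> set (A @ ?M)" "t \<notin> Field \<sigma>" "t \<in> set ?M" using t by (auto simp: unpaired_def)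
      have "unpaired (x # A) (insert (x, t) \<sigma>) = unpaired A \<sigma>"
        using dK t' by (auto simp: unpaired_def Field_def intro!: filter_cong)
      moreover have "unpaired ?M (insert (x, t) \<sigma>) = filter (\<lambda>y. y \<noteq> t) (unpaired ?M \<sigma>)"
        using dK by (auto simp: unpaired_def Field_def intro!: filter_cong)
      moreover have "filter (\<lambda>y. y \<noteq> t) (unpaired ?M \<sigma>) = remove1 t (unpaired ?M \<sigma>)"
        using dK by (subst distinct_remove1_removeAll) (auto simp: unpaired_def removeAll_filter_not_eq intro!: filter_cong)
      moreover have "length (remove1 t (unpaired ?M \<sigma>)) = length (unpaired ?M \<sigma>) - 1"
        using t by (simp add: length_remove1)
      moreover have "card (insert (x, t) \<sigma>) = Suc (card \<sigma>)"
        using finite_contraction[OF \<sigma>] xF by (subst card_insert_disjoint) (auto simp: Field_def)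
      ultimately show ?thesis
        using crbar_Cons_insert[OF \<sigma> dK t'(1,2)]
        by (simp add: contraction_weight_def power_add power2_eq_square)
    qed
    moreover have "(\<Sum>t\<in>set (unpaired ?M \<sigma>). r ^ card {u \<in> set (unpaired (A @ ?M) \<sigma>). before (A @ ?M) u t}) =
        (\<Sum>j<length (unpaired ?M \<sigma>). r ^ (length (unpaired A \<sigma>) + j))"
    proof -
      have "bij_betw ((!) (unpaired ?M \<sigma>)) {..<length (unpaired ?M \<sigma>)} (set (unpaired ?M \<sigma>))"
        by (rule bij_betw_nth) (use d in \<open>auto simp: unpaired_def\<close>)
      then have "(\<Sum>t\<in>set (unpaired ?M \<sigma>). r ^ card {u \<in> set (unpaired (A @ ?M) \<sigma>). before (A @ ?M) u t}) =
          (\<Sum>j<length (unpaired ?M \<sigma>).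
            r ^ card {u \<in> set (unpaired (A @ ?M) \<sigma>). before (A @ ?M) u (unpaired ?M \<sigma> ! j)})"
        by (rule sum.reindex_bij_betw[symmetric])
      also have "\<dots> = (\<Sum>j<length (unpaired ?M \<sigma>). r ^ (length (unpaired A \<sigma>) + j))"
        by (intro sum.cong refl arg_cong[where f = "(^) r"] card_unpaired_before) (use d in auto)
      finally show ?thesis .
    qed
    ultimately show "?f \<sigma> + (\<Sum>t\<in>set (unpaired ?M \<sigma>). ?f (insert (x, t) \<sigma>)) = ?g \<sigma>"
      by (simp add: sum_distrib_left[symmetric] sum_distrib_right[symmetric] distrib_left mult.assoc)
  qed
  finally show ?thesis by simp
qed

text \<open>Bounds the total weight of the contractions of a block of size \<open>a + c\<close>, of which \<open>a\<close> elements
  are known to stay unpaired, with \<open>m\<close> elements to its right; \<open>p\<close> is the number of pairs.\<close>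

definition block_bound :: "real \<Rightarrow> nat \<Rightarrow> nat \<Rightarrow> nat \<Rightarrow> real" where
  "block_bound r c a m = (\<Sum>p\<le>min c m. r ^ (a * p) * (real a + real c + real m + 1 - 2 * real p))"

lemma block_bound_nonneg: "0 \<le> r \<Longrightarrow> 0 \<le> block_bound r c a m"
  unfolding block_bound_def by (intro sum_nonneg mult_nonneg_nonneg) auto

text \<open>Without the powers of r the sum is an arithmetic progression. The identity is the
  Clebsch-Gordan count: c + m + 1 - 2 p are the dimensions of the summands in the product of two
  irreducible representations of dimensions c + 1 and m + 1.\<close>

lemma block_bound_zero: "block_bound r c 0 m = (real c + 1) * (real m + 1)"
proof -
  have "(\<Sum>p\<le>k. (s :: real) - 2 * real p) = (real k + 1) * (s - real k)" for k s
    by (induction k) (auto simp: algebra_simps)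
  then have "block_bound r c 0 m = (real (min c m) + 1) * (real c + real m + 1 - real (min c m))"
    by (simp add: block_bound_def)
  then show ?thesis by (cases "c \<le> m") (auto simp: min_def algebra_simps)
qed

text \<open>One factor 1 - r is used up by the geometric series and leaves \<open>r ^ a\<close>,
  which turns the term for p pairs into that for p + 1. The other one is balanced by the first
  summand, where \<open>r ^ (Suc a * p)\<close> is at most \<open>r * r ^ (a * p)\<close> for p at
  least 1: the coefficients add up to at most r + (1 - r) = 1.\<close>

lemma block_bound_step:
  assumes r: "0 \<le> r" "r \<le> 1"
  shows "block_bound r c (Suc a) m +
      (1 - r)\<^sup>2 * (\<Sum>j<m. r ^ (a + j)) * block_bound r c a (m - 1) \<le> block_bound r (Suc c) a m"
proof (cases m)
  case 0
  then show ?thesis by (simp add: block_bound_def)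
next
  case (Suc n)
  \<comment> \<open>The linear factor common to the three bounds. In the bound for
    \<open>m - 1\<close> it occurs at \<open>Suc p\<close>, because the pair of the new element is
    not counted there.\<close>
  let ?T = "\<lambda>p. real a + real c + real m + 2 - 2 * real p"
  have geo: "(1 - r) * (\<Sum>j<m. r ^ (a + j)) \<le> r ^ a"
  proof -
    have "(1 - r) * (\<Sum>j<m. r ^ (a + j)) = r ^ a * ((1 - r) * (\<Sum>j<m. r ^ j))"
      by (simp add: power_add sum_distrib_left mult.left_commute)
    also have "(1 - r) * (\<Sum>j<m. r ^ j) = 1 - r ^ m" by (simp add: one_diff_power_eq)
    also have "r ^ a * (1 - r ^ m) \<le> r ^ a" using r by (simp add: mult_left_le)
    finally show ?thesis .
  qed
  have "(1 - r)\<^sup>2 * (\<Sum>j<m. r ^ (a + j)) * block_bound r c a (m - 1) =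
      (1 - r) * (block_bound r c a n * ((1 - r) * (\<Sum>j<m. r ^ (a + j))))"
    by (simp add: Suc power2_eq_square)
  also have "\<dots> \<le> (1 - r) * (block_bound r c a n * r ^ a)"
    using r geo by (intro mult_left_mono block_bound_nonneg) auto
  also have "\<dots> = (\<Sum>p\<le>min c n. (1 - r) * (r ^ (a * Suc p) * ?T (Suc p)))"
    unfolding block_bound_def sum_distrib_left sum_distrib_right
    by (intro sum.cong refl) (simp add: Suc power_add algebra_simps)
  also have "\<dots> = (\<Sum>p\<in>{1..min (Suc c) m}. (1 - r) * (r ^ (a * p) * ?T p))"
    unfolding Suc min_Suc_Suc atMost_atLeast0 One_nat_def
    by (subst sum.shift_bounds_cl_Suc_ivl) simp
  finally have A: "(1 - r)\<^sup>2 * (\<Sum>j<m. r ^ (a + j)) * block_bound r c a (m - 1) \<le> \<dots>" .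
  \<comment> \<open>A summand that the longer range may add is nonnegative, because p is at most
    \<open>Suc c\<close> and at most \<open>m\<close>.\<close>
  have "block_bound r c (Suc a) m \<le> (\<Sum>p\<le>min (Suc c) m. r ^ (Suc a * p) * ?T p)"
    unfolding block_bound_def
    by (rule order.trans[OF sum_mono2[of "{..min (Suc c) m}"]])
       (use r in \<open>auto intro!: mult_nonneg_nonneg sum_mono mult_left_mono\<close>)
  also have "\<dots> = ?T 0 + (\<Sum>p\<in>{1..min (Suc c) m}. r ^ (Suc a * p) * ?T p)"
    unfolding atMost_atLeast0 by (subst sum.atLeast_Suc_atMost) auto
  finally have "block_bound r c (Suc a) m + (1 - r)\<^sup>2 * (\<Sum>j<m. r ^ (a + j)) * block_bound r c a (m - 1) \<le>
     ?T 0 + (\<Sum>p\<in>{1..min (Suc c) m}. r ^ (Suc a * p) * ?T p + (1 - r) * (r ^ (a * p) * ?T p))"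
    using A by (simp add: sum.distrib)
  also have "\<dots> \<le> ?T 0 + (\<Sum>p\<in>{1..min (Suc c) m}. r ^ (a * p) * ?T p)"
  proof (intro add_left_mono sum_mono)
    fix p assume p: "p \<in> {1..min (Suc c) m}"
    have "r ^ p \<le> r" using p r power_decreasing[of 1 p r] by simp
    moreover have "r ^ (Suc a * p) * ?T p + (1 - r) * (r ^ (a * p) * ?T p) =
        r ^ (a * p) * ?T p * (r ^ p + (1 - r))" by (simp add: power_add algebra_simps)
    moreover have "0 \<le> r ^ (a * p) * ?T p" using r p by auto
    ultimately show "r ^ (Suc a * p) * ?T p + (1 - r) * (r ^ (a * p) * ?T p) \<le> r ^ (a * p) * ?T p"
      by (simp add: mult_left_le)
  qed
  also have "\<dots> = block_bound r (Suc c) a m"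
    unfolding block_bound_def atMost_atLeast0
    by (subst (2) sum.atLeast_Suc_atMost) (auto simp: algebra_simps)
  finally show ?thesis .
qed

lemma block_contractions_Nil_Cons: "block_contractions ([] # Ks) = block_contractions Ks"
  by (simp add: block_contractions_def)

text \<open>Each element taken off the block on the left raises \<open>c\<close> by one, so the
  induction needs \<open>c\<close> arbitrary. Once the block is exhausted, only the number of its
  elements is left of it, and \<open>a\<close> is 0.\<close>

lemma sum_contraction_weight_block:
  assumes r: "0 \<le> r" "r \<le> 1" and d: "distinct (A @ concat Ks)"
  shows "(\<Sum>\<sigma>\<in>block_contractions (A # Ks). contraction_weight r (A @ concat Ks) \<sigma> *
        block_bound r c (length (unpaired A \<sigma>)) (length (unpaired (concat Ks) \<sigma>))) \<le>
    (\<Sum>\<sigma>\<in>block_contractions Ks. contraction_weight r (concat Ks) \<sigma> *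
        block_bound r (c + length A) 0 (length (unpaired (concat Ks) \<sigma>)))"
  using d
proof (induction A arbitrary: c)
  case Nil
  then show ?case by (simp add: block_contractions_Nil_Cons unpaired_def)
next
  case (Cons x A)
  let ?B = "block_contractions (A # Ks)" and ?w = "contraction_weight r (A @ concat Ks)"
  let ?a = "\<lambda>\<sigma>. length (unpaired A \<sigma>)" and ?m = "\<lambda>\<sigma>. length (unpaired (concat Ks) \<sigma>)"
  have "(\<Sum>\<sigma>\<in>block_contractions ((x # A) # Ks). contraction_weight r ((x # A) @ concat Ks) \<sigma> *
        block_bound r c (length (unpaired (x # A) \<sigma>)) (?m \<sigma>)) \<le>
      (\<Sum>\<sigma>\<in>?B. ?w \<sigma> * (block_bound r c (Suc (?a \<sigma>)) (?m \<sigma>) +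
         (1 - r)\<^sup>2 * (\<Sum>j<?m \<sigma>. r ^ (?a \<sigma> + j)) * block_bound r c (?a \<sigma>) (?m \<sigma> - 1)))"
    by (rule sum_contraction_weight_Cons[OF r Cons.prems block_bound_nonneg[OF r(1)]])
  also have "\<dots> \<le> (\<Sum>\<sigma>\<in>?B. ?w \<sigma> * block_bound r (Suc c) (?a \<sigma>) (?m \<sigma>))"
    by (intro sum_mono mult_left_mono block_bound_step r contraction_weight_nonneg)
  also have "\<dots> \<le> (\<Sum>\<sigma>\<in>block_contractions Ks. contraction_weight r (concat Ks) \<sigma> *
        block_bound r (Suc c + length A) 0 (?m \<sigma>))"
    by (rule Cons.IH) (use Cons.prems in simp)
  finally show ?case by simp
qed

text \<open>Exhausting the first block leaves \<open>block_bound\<close> with \<open>a = 0\<close>,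
  where it factorises: the size of the block plus one splits off, and the same sum for the remaining
  blocks is left.\<close>

theorem sum_contraction_weight:
  assumes r: "0 \<le> r" "r \<le> 1" and d: "distinct (concat Ks)"
  shows "(\<Sum>\<sigma>\<in>block_contractions Ks. contraction_weight r (concat Ks) \<sigma> *
      (real (length (unpaired (concat Ks) \<sigma>)) + 1)) \<le> (\<Prod>K\<leftarrow>Ks. real (length K) + 1)"
  using d
proof (induction Ks)
  case Nil
  have "block_contractions ([] :: 'a list list) = {{}}"
    by (auto simp: block_contractions_def contractions_def)
  then show ?case
    by (simp add: contraction_weight_def crbar_def crossings_def spanned_def unpaired_def)
next
  case (Cons A Ks)
  \<comment> \<open>For \<open>c = 0\<close> only \<open>p = 0\<close> occurs in
    \<open>block_bound\<close>, so the factor k + 1 of the norm is itself the starting value of the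
    recursion.\<close>
  have 1: "real (length (unpaired (concat (A # Ks)) \<sigma>)) + 1 =
    block_bound r 0 (length (unpaired A \<sigma>)) (length (unpaired (concat Ks) \<sigma>))" for \<sigma>
    by (simp add: block_bound_def unpaired_def)
  have "(\<Sum>\<sigma>\<in>block_contractions (A # Ks). contraction_weight r (concat (A # Ks)) \<sigma> *
      (real (length (unpaired (concat (A # Ks)) \<sigma>)) + 1)) \<le>
      (\<Sum>\<sigma>\<in>block_contractions Ks. contraction_weight r (concat Ks) \<sigma> *
        block_bound r (0 + length A) 0 (length (unpaired (concat Ks) \<sigma>)))"
    unfolding 1 using sum_contraction_weight_block[OF r, of A Ks 0] Cons.prems by simp
  also have "\<dots> = (real (length A) + 1) * (\<Sum>\<sigma>\<in>block_contractions Ks. contraction_weight r (concat Ks) \<sigma> *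
      (real (length (unpaired (concat Ks) \<sigma>)) + 1))"
    by (simp add: block_bound_zero sum_distrib_left mult.left_commute)
  also have "\<dots> \<le> (real (length A) + 1) * (\<Prod>K\<leftarrow>Ks. real (length K) + 1)"
    using Cons by (intro mult_left_mono) auto
  finally show ?case by simp
qed

section \<open>The algebraic Fock space\<close>

lemma fock_induct [case_names add scale tensor]:
  assumes "\<And>u v. P u \<Longrightarrow> P v \<Longrightarrow> P (u + v)" "\<And>c u. P u \<Longrightarrow> P (c *\<^sub>R u)" "\<And>xs. P (tensor xs)"
  shows "P (u :: 'h::real_vector fock)"
proof -
  obtain cs where u: "u = (\<Sum>(c, xs)\<leftarrow>cs. c *\<^sub>R tensor xs)" using fock_as_sum by blast
  have "P (\<Sum>(c, xs)\<leftarrow>cs. c *\<^sub>R tensor xs)"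
  proof (induction cs)
    case Nil
    then show ?case using assms(2)[OF assms(3)[of "[]"], of 0] by simp
  next
    case (Cons a cs)
    then show ?case using assms by (cases a) simp
  qed
  then show ?thesis using u by simp
qed

lemma fock_linear_eqI:
  assumes "linear S" "linear T" "\<And>xs. S (tensor xs) = T (tensor xs)"
  shows "S u = T u"
  by (induction u rule: fock_induct) (use assms in \<open>auto simp: linear_add linear_scale\<close>)

lemma multilinear_plus: "multilinear f \<Longrightarrow> multilinear g \<Longrightarrow> multilinear (\<lambda>xs. f xs + g xs)"
  unfolding multilinear_def by (auto simp: scaleR_add_right)

lemma multilinear_scale: "multilinear f \<Longrightarrow> multilinear (\<lambda>xs. c *\<^sub>R f xs)"
  unfolding multilinear_def by (auto simp: scaleR_add_right mult.commute)

lemma multilinear_linear: "multilinear f \<Longrightarrow> linear g \<Longrightarrow> multilinear (\<lambda>xs. g (f xs))"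
  unfolding multilinear_def by (auto simp: linear_add linear_scale)

lemma multilinear_lin_ext:
  assumes "\<And>ys. multilinear (\<lambda>xs. F xs ys)" "\<And>xs. multilinear (F xs)"
  shows "multilinear (\<lambda>ys. lin_ext (\<lambda>xs. F xs ys) u)"
  by (induction u rule: fock_induct)
     (use assms in \<open>auto simp: linear_add[OF linear_lin_ext] linear_scale[OF linear_lin_ext]
        lin_ext_tensor intro: multilinear_plus multilinear_scale\<close>)

abbreviation tensor_inner :: "'h::real_inner list \<Rightarrow> 'h list \<Rightarrow> real" where
  "tensor_inner xs ys \<equiv> if length xs = length ys then \<Prod>i<length ys. xs ! i \<bullet> ys ! i else 0"

lemma multilinear_tensor_inner_left: "multilinear (\<lambda>xs. tensor_inner xs ys)"
  by (rule multilinear_inner_prod)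

lemma multilinear_tensor_inner_right: "multilinear (\<lambda>ys. tensor_inner xs ys)"
proof -
  have "tensor_inner xs = (\<lambda>ys. tensor_inner ys xs)" by (auto simp: inner_commute)
  then show ?thesis using multilinear_inner_prod[of xs] by simp
qed

lemma linear_fock_inner_right: "linear (fock_inner u)"
  unfolding fock_inner_def
  by (intro linear_lin_ext multilinear_lin_ext multilinear_tensor_inner_left multilinear_tensor_inner_right)

lemma fock_inner_tensor_right: "fock_inner u (tensor ys) = lin_ext (\<lambda>xs. tensor_inner xs ys) u"
  unfolding fock_inner_def
  by (intro lin_ext_tensor multilinear_lin_ext multilinear_tensor_inner_left multilinear_tensor_inner_right)

lemma linear_fock_inner_left: "linear (\<lambda>u. fock_inner u v)"
proof (induction v rule: fock_induct)
  case (tensor xs)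
  then show ?case unfolding fock_inner_tensor_right by (rule linear_lin_ext[OF multilinear_tensor_inner_left])
next
  case (scale c v)
  from linear_compose_scale_right[OF this, of c] show ?case
    by (simp add: linear_scale[OF linear_fock_inner_right])
qed (simp add: linear_add[OF linear_fock_inner_right] linear_compose_add)

lemmas fock_inner_add_left = linear_add[OF linear_fock_inner_left]
  and fock_inner_add_right = linear_add[OF linear_fock_inner_right]
  and fock_inner_scale_left = linear_scale[OF linear_fock_inner_left]
  and fock_inner_scale_right = linear_scale[OF linear_fock_inner_right]
  and fock_inner_sum_left = linear_sum[OF linear_fock_inner_left]
  and fock_inner_sum_right = linear_sum[OF linear_fock_inner_right]
  and fock_inner_zero_left = linear_0[OF linear_fock_inner_left]
  and fock_inner_zero_right = linear_0[OF linear_fock_inner_right]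

lemma fock_inner_commute: "fock_inner u v = fock_inner v u"
proof (rule fock_linear_eqI[OF linear_fock_inner_left linear_fock_inner_right])
  fix xs
  show "fock_inner (tensor xs) v = fock_inner v (tensor xs)"
    by (rule fock_linear_eqI[OF linear_fock_inner_right linear_fock_inner_left])
       (auto simp: fock_inner_tensor inner_commute)
qed

lemma multilinear_degree_part: "multilinear (\<lambda>xs :: 'h::real_vector list. if length xs = n then tensor xs else 0)"
  using multilinear_tensor unfolding multilinear_def by auto

lemma linear_degree_part: "linear (degree_part n)"
  unfolding degree_part_def by (rule linear_lin_ext[OF multilinear_degree_part])

lemma degree_part_degree_part: "degree_part m (degree_part n u) = (if m = n then degree_part n u else 0)"
  by (induction u rule: fock_induct)
     (auto simp: degree_part_tensor linear_add[OF linear_degree_part] linear_scale[OF linear_degree_part]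
        linear_0[OF linear_degree_part])

text \<open>Tensors of different degrees are orthogonal, so a homogeneous factor sees only its own
  degree of the other one.\<close>

lemma fock_inner_degree_part: "fock_inner (degree_part n u) v = fock_inner (degree_part n u) (degree_part n v)"
proof (rule fock_linear_eqI[of "\<lambda>u. fock_inner (degree_part n u) v"
        "\<lambda>u. fock_inner (degree_part n u) (degree_part n v)"])
  fix xs :: "'a list"
  show "fock_inner (degree_part n (tensor xs)) v = fock_inner (degree_part n (tensor xs)) (degree_part n v)"
    by (rule fock_linear_eqI[OF linear_fock_inner_right linear_compose[OF linear_degree_part linear_fock_inner_right, unfolded comp_def]])
       (auto simp: degree_part_tensor fock_inner_tensor fock_inner_zero_left fock_inner_zero_right)
qed (use linear_compose[OF linear_degree_part linear_fock_inner_left] in \<open>simp_all add: comp_def\<close>)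

lemma homogeneous_add: "degree_part n u = u \<Longrightarrow> degree_part n v = v \<Longrightarrow> degree_part n (u + v) = u + v"
  and homogeneous_scale: "degree_part n u = u \<Longrightarrow> degree_part n (c *\<^sub>R u) = c *\<^sub>R u"
  by (auto simp: linear_add[OF linear_degree_part] linear_scale[OF linear_degree_part])

section \<open>Orthonormal coordinates\<close>

text \<open>Finiteness is included so that all coordinate sums are finite; by
  \<open>fock_over_exists\<close> finite systems suffice for algebraic tensors.\<close>

definition orthonormal :: "'h::real_inner set \<Rightarrow> bool" where
  "orthonormal B \<longleftrightarrow> finite B \<and> (\<forall>b\<in>B. \<forall>b'\<in>B. b \<bullet> b' = of_bool (b = b'))"

lemma orthonormal_exists:
  assumes "finite (X :: 'h::real_inner set)"
  shows "\<exists>B. orthonormal B \<and> X \<subseteq> span B"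
proof -
  obtain C where C: "finite C" "span C = span X" "pairwise orthogonal C"
    using basis_orthogonal[OF assms] by blast
  \<comment> \<open>The orthogonal set may contain 0, which cannot be normalised and contributes
    nothing to the span.\<close>
  let ?B = "(\<lambda>x. x /\<^sub>R norm x) ` (C - {0})"
  have "orthonormal ?B"
    unfolding orthonormal_def
  proof (intro conjI ballI)
    fix b b' assume "b \<in> ?B" "b' \<in> ?B"
    then obtain c c' where c: "c \<in> C" "c \<noteq> 0" "b = c /\<^sub>R norm c" "c' \<in> C" "c' \<noteq> 0" "b' = c' /\<^sub>R norm c'"
      by blast
    show "b \<bullet> b' = of_bool (b = b')"
    proof (cases "c = c'")
      case True
      then show ?thesis using c by (simp add: dot_square_norm power2_eq_square)
    next
      case False
      then have 0: "c \<bullet> c' = 0" using C c by (simp add: pairwise_def orthogonal_def)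
      then have "b \<bullet> b' = 0" using c(3,6) by simp
      moreover have "b \<bullet> b \<noteq> 0" using c by simp
      ultimately show ?thesis by (cases "b = b'") auto
    qed
  qed (use C in simp)
  moreover have "c \<in> span ?B" if "c \<in> C" for c
  proof (cases "c = 0")
    case False
    then have "norm c *\<^sub>R (c /\<^sub>R norm c) \<in> span ?B" using that by (intro span_scale span_base) auto
    then show ?thesis using False by simp
  qed (simp add: span_zero)
  then have "span C \<subseteq> span ?B" by (intro span_minimal) auto
  ultimately show ?thesis using C span_superset[of X] by blast
qed

lemma orthonormal_expand:
  assumes B: "orthonormal B" and x: "x \<in> span B"
  shows "x = (\<Sum>b\<in>B. (x \<bullet> b) *\<^sub>R b)"
proof (rule linear_eq_on_span[OF linear_ident _ _ x])
  show "linear (\<lambda>x. \<Sum>b\<in>B. (x \<bullet> b) *\<^sub>R b)"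
    by (rule linearI) (simp_all add: inner_add_left scaleR_add_left sum.distrib scaleR_sum_right)
  fix x assume x: "x \<in> B"
  have "(\<Sum>b\<in>B. (x \<bullet> b) *\<^sub>R b) = (\<Sum>b\<in>B. if b = x then x else 0)"
    using B x by (intro sum.cong) (auto simp: orthonormal_def)
  then show "x = (\<Sum>b\<in>B. (x \<bullet> b) *\<^sub>R b)" using B x by (simp add: orthonormal_def)
qed

text \<open>Multi-indices: for an orthonormal set \<open>B\<close>, the tensors of these words are
  the standard orthonormal basis of the n-th tensor power of the span of \<open>B\<close>.\<close>

definition words :: "'a set \<Rightarrow> nat \<Rightarrow> 'a list set" where
  "words B n = {a. set a \<subseteq> B \<and> length a = n}"

lemma finite_words: "finite B \<Longrightarrow> finite (words B n)"
  unfolding words_def by (rule finite_lists_length_eq)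

lemma words_Suc: "words B (Suc n) = (\<lambda>(b, a). b # a) ` (B \<times> words B n)"
  by (auto simp: words_def length_Suc_conv image_iff)

lemma fock_inner_tensor_Cons:
  "fock_inner (tensor (x # xs)) (tensor (y # ys)) = (x \<bullet> y) * fock_inner (tensor xs) (tensor ys)"
  by (simp add: fock_inner_tensor prod.lessThan_Suc_shift del: prod.lessThan_Suc)

lemma tensor_expand:
  assumes B: "orthonormal B" and "set xs \<subseteq> span B"
  shows "tensor xs = (\<Sum>a\<in>words B (length xs). fock_inner (tensor xs) (tensor a) *\<^sub>R tensor a)"
  using assms(2)
proof (induction xs)
  case Nil
  have "words B 0 = {[]}" by (auto simp: words_def)
  then show ?case by (simp add: fock_inner_tensor)
next
  case (Cons x xs)
  have lin1: "linear (\<lambda>x. tensor (x # a))" for a :: "'a list"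
    using multilinear_tensor[unfolded multilinear_def, rule_format, of 0 "0 # a"] by (intro linearI) auto
  have "tensor (x # xs) = creation x (\<Sum>a\<in>words B (length xs). fock_inner (tensor xs) (tensor a) *\<^sub>R tensor a)"
    using Cons by (simp add: creation_tensor)
  also have "\<dots> = (\<Sum>a\<in>words B (length xs). fock_inner (tensor xs) (tensor a) *\<^sub>R tensor (x # a))"
    by (simp add: linear_sum[OF linear_creation] linear_scale[OF linear_creation] creation_tensor)
  also have "\<dots> = (\<Sum>a\<in>words B (length xs). fock_inner (tensor xs) (tensor a) *\<^sub>R
      (\<Sum>b\<in>B. (x \<bullet> b) *\<^sub>R tensor (b # a)))"
  proof -
    have "tensor (x # a) = (\<Sum>b\<in>B. (x \<bullet> b) *\<^sub>R tensor (b # a))" for a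
      using arg_cong[OF orthonormal_expand[OF B, of x], of "\<lambda>x. tensor (x # a)"] Cons.prems
      by (simp add: linear_sum[OF lin1] linear_scale[OF lin1])
    then show ?thesis by (intro sum.cong refl arg_cong[where f = "scaleR _"])
  qed
  also have "\<dots> = (\<Sum>(b, a)\<in>B \<times> words B (length xs).
      fock_inner (tensor (x # xs)) (tensor (b # a)) *\<^sub>R tensor (b # a))"
    by (subst sum.cartesian_product[symmetric], subst sum.swap)
       (simp add: scaleR_sum_right fock_inner_tensor_Cons mult.commute)
  also have "\<dots> = (\<Sum>a\<in>words B (length (x # xs)). fock_inner (tensor (x # xs)) (tensor a) *\<^sub>R tensor a)"
    by (simp only: words_Suc length_Cons, subst sum.reindex) (auto simp: inj_on_def case_prod_beta)
  finally show ?case .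
qed

definition fock_over :: "'h::real_vector set \<Rightarrow> 'h fock set" where
  "fock_over B = span (tensor ` {xs. set xs \<subseteq> span B})"

lemma fock_expand:
  assumes B: "orthonormal B" and u: "u \<in> fock_over B" "degree_part n u = u"
  shows "u = (\<Sum>a\<in>words B n. fock_inner u (tensor a) *\<^sub>R tensor a)"
proof -
  have "degree_part n u = (\<Sum>a\<in>words B n. fock_inner u (tensor a) *\<^sub>R tensor a)"
  proof (rule linear_eq_on_span[OF linear_degree_part _ _ u(1)[unfolded fock_over_def]])
    show "linear (\<lambda>u. \<Sum>a\<in>words B n. fock_inner u (tensor a) *\<^sub>R tensor a)"
      by (rule linearI) (simp_all add: fock_inner_add_left fock_inner_scale_left scaleR_add_left
          sum.distrib scaleR_sum_right)
    fix v assume "v \<in> tensor ` {xs. set xs \<subseteq> span B}"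
    then obtain xs where xs: "v = tensor xs" "set xs \<subseteq> span B" by auto
    show "degree_part n v = (\<Sum>a\<in>words B n. fock_inner v (tensor a) *\<^sub>R tensor a)"
    proof (cases "length xs = n")
      case True
      then show ?thesis using tensor_expand[OF B xs(2)] xs(1) by (simp add: degree_part_tensor)
    next
      case False
      then have "(\<Sum>a\<in>words B n. fock_inner v (tensor a) *\<^sub>R tensor a) = 0"
        by (intro sum.neutral) (auto simp: xs fock_inner_tensor words_def)
      then show ?thesis using False by (simp add: xs degree_part_tensor)
    qed
  qed
  then show ?thesis using u by simp
qed

text \<open>An algebraic tensor is a finite combination of elementary tensors and involves only
  finitely many vectors; orthonormalising all of them together gives \<open>B\<close>. This takes
  the place of an orthonormal basis of the whole space.\<close>

lemma fock_over_exists: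
  assumes "finite (F :: 'h::real_inner fock set)"
  shows "\<exists>B. orthonormal B \<and> F \<subseteq> fock_over B"
proof -
  have "\<exists>X. finite X \<and> u \<in> span (tensor ` {xs. set xs \<subseteq> X})" for u :: "'h fock"
  proof -
    obtain cs where u: "u = (\<Sum>(c, xs)\<leftarrow>cs. c *\<^sub>R tensor xs)" using fock_as_sum by blast
    have "(\<Sum>(c, xs)\<leftarrow>ds. c *\<^sub>R tensor xs) \<in> span (tensor ` {xs. set xs \<subseteq> (\<Union>(c, xs)\<in>set cs. set xs)})"
      if "set ds \<subseteq> set cs" for ds
      using that
    proof (induction ds)
      case (Cons d ds)
      obtain c xs where d: "d = (c, xs)" by force
      then have "tensor xs \<in> tensor ` {xs. set xs \<subseteq> (\<Union>(c, xs)\<in>set cs. set xs)}"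
        using Cons.prems by fastforce
      then show ?case using Cons d by (auto intro: span_add span_scale span_base)
    qed (simp add: span_zero)
    then have "u \<in> span (tensor ` {xs. set xs \<subseteq> (\<Union>(c, xs)\<in>set cs. set xs)})" unfolding u by blast
    moreover have "finite (\<Union>(c, xs)\<in>set cs. set xs)" by auto
    ultimately show ?thesis by blast
  qed
  then obtain X where X: "\<And>u. finite (X u) \<and> u \<in> span (tensor ` {xs. set xs \<subseteq> X (u :: 'h fock)})" by metis
  obtain B where B: "orthonormal B" "(\<Union>u\<in>F. X u) \<subseteq> span B"
    using orthonormal_exists[of "\<Union>u\<in>F. X u"] X assms by auto
  have "u \<in> fock_over B" if "u \<in> F" for u
  proof -
    have "span (tensor ` {xs. set xs \<subseteq> X u}) \<subseteq> fock_over B"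
      unfolding fock_over_def by (rule span_mono) (use B that in auto)
    then show ?thesis using X by blast
  qed
  then show ?thesis using B by blast
qed

lemma parseval:
  assumes "orthonormal B" "u \<in> fock_over B" "degree_part n u = u"
  shows "fock_inner u v = (\<Sum>a\<in>words B n. fock_inner u (tensor a) * fock_inner v (tensor a))"
  by (subst fock_expand[OF assms])
     (simp add: fock_inner_sum_left fock_inner_scale_left fock_inner_commute[of "tensor _" v])

text \<open>The definition by bilinear extension says nothing about the sign; in coordinates the
  expression is a sum of squares.\<close>

lemma fock_inner_nonneg:
  assumes "degree_part n u = u"
  shows "0 \<le> fock_inner u u"
proof -
  obtain B where "orthonormal B" "u \<in> fock_over B" using fock_over_exists[of "{u}"] by auto
  from parseval[OF this assms, of u] show ?thesis by (simp add: sum_nonneg)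
qed

section \<open>The tensor algebra product\<close>

text \<open>The product of the tensor algebra, that is concatenation of words, and not the
  composition of operators in \<open>field_algebra\<close>. It merges the separate arguments of the
  map into one tensor.\<close>

definition fock_mult :: "'h::real_vector fock \<Rightarrow> 'h fock \<Rightarrow> 'h fock" where
  "fock_mult u v = lin_ext (\<lambda>xs. lin_ext (\<lambda>ys. tensor (xs @ ys)) v) u"

lemma multilinear_append_right: "multilinear (\<lambda>ys :: 'h::real_vector list. tensor (xs @ ys))"
  unfolding multilinear_def
proof (intro allI impI)
  fix ys :: "'h list" and i x y and c :: real assume "i < length ys"
  then have "(xs @ ys)[length xs + i := z] = xs @ ys[i := z]" for z by (simp add: list_update_append)
  then show "tensor (xs @ ys[i := x + y]) = tensor (xs @ ys[i := x]) + tensor (xs @ ys[i := y]) \<and>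
      tensor (xs @ ys[i := c *\<^sub>R x]) = c *\<^sub>R tensor (xs @ ys[i := x])"
    using multilinear_tensor[unfolded multilinear_def, rule_format, of "length xs + i" "xs @ ys"] \<open>i < length ys\<close>
    by simp
qed

lemma multilinear_append_left: "multilinear (\<lambda>xs :: 'h::real_vector list. tensor (xs @ ys))"
  unfolding multilinear_def
proof (intro allI impI)
  fix xs :: "'h list" and i x y and c :: real assume "i < length xs"
  then have "(xs @ ys)[i := z] = xs[i := z] @ ys" for z by (simp add: list_update_append)
  then show "tensor (xs[i := x + y] @ ys) = tensor (xs[i := x] @ ys) + tensor (xs[i := y] @ ys) \<and>
      tensor (xs[i := c *\<^sub>R x] @ ys) = c *\<^sub>R tensor (xs[i := x] @ ys)"
    using multilinear_tensor[unfolded multilinear_def, rule_format, of "i" "xs @ ys"] \<open>i < length xs\<close>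
    by simp
qed

lemma linear_fock_mult_left: "linear (\<lambda>u. fock_mult u v)"
  unfolding fock_mult_def
  by (rule linear_lin_ext) (rule multilinear_lin_ext[OF multilinear_append_right multilinear_append_left])

lemma fock_mult_tensor_left: "fock_mult (tensor xs) v = lin_ext (\<lambda>ys. tensor (xs @ ys)) v"
  unfolding fock_mult_def
  by (rule lin_ext_tensor) (rule multilinear_lin_ext[OF multilinear_append_right multilinear_append_left])

lemma fock_mult_tensor: "fock_mult (tensor xs) (tensor ys) = tensor (xs @ ys)"
  by (simp add: fock_mult_tensor_left lin_ext_tensor[OF multilinear_append_right])

lemma linear_fock_mult_right: "linear (fock_mult u)"
proof (induction u rule: fock_induct)
  case (add u v)
  have "fock_mult (u + v) = (\<lambda>w. fock_mult u w + fock_mult v w)"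
    by (rule ext) (rule linear_add[OF linear_fock_mult_left])
  then show ?case using add linear_compose_add by metis
next
  case (scale c u)
  have "fock_mult (c *\<^sub>R u) = (\<lambda>w. c *\<^sub>R fock_mult u w)"
    by (rule ext) (rule linear_scale[OF linear_fock_mult_left])
  then show ?case using scale linear_compose_scale_right by metis
next
  case (tensor xs)
  have "fock_mult (tensor xs) = lin_ext (\<lambda>ys. tensor (xs @ ys))" by (rule ext) (rule fock_mult_tensor_left)
  then show ?case using linear_lin_ext[OF multilinear_append_right] by metis
qed

lemma degree_part_fock_mult:
  assumes u: "degree_part m u = u" and v: "degree_part n v = v"
  shows "degree_part (m + n) (fock_mult u v) = fock_mult u v"
proof -
  \<comment> \<open>Homogeneity of a sum says nothing about its summands, so the induction is
    carried out for the projections, which are linear in \<open>u\<close> and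
    \<open>v\<close>.\<close>
  have "degree_part (m + n) (fock_mult (degree_part m u) (degree_part n v)) = fock_mult (degree_part m u) (degree_part n v)"
  proof (induction u rule: fock_induct)
    case (tensor xs)
    show ?case
      by (induction v rule: fock_induct)
         (auto simp: linear_add[OF linear_degree_part] linear_scale[OF linear_degree_part] degree_part_tensor
           linear_add[OF linear_fock_mult_right] linear_scale[OF linear_fock_mult_right] fock_mult_tensor
           linear_0[OF linear_fock_mult_left] linear_0[OF linear_degree_part] linear_0[OF linear_fock_mult_right])
  qed (simp_all add: linear_add[OF linear_degree_part] linear_scale[OF linear_degree_part]
      linear_add[OF linear_fock_mult_left] linear_scale[OF linear_fock_mult_left])
  then show ?thesis using u v by simp
qed

lemma fock_inner_tensor_append:
  assumes "length xs = length xs'"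
  shows "fock_inner (tensor (xs @ ys)) (tensor (xs' @ ys')) =
    fock_inner (tensor xs) (tensor xs') * fock_inner (tensor ys) (tensor ys')"
  using assms
proof (induction xs xs' rule: list_induct2)
  case Nil
  then show ?case by (simp add: fock_inner_tensor[of "[]" "[]"])
qed (simp add: fock_inner_tensor_Cons)

text \<open>The common degree of \<open>u\<close> and \<open>u'\<close> fixes the place at which
  words are cut. For different degrees the left-hand side can be nonzero while the right-hand side
  vanishes.\<close>

lemma fock_inner_mult:
  assumes "degree_part n u = u" "degree_part n u' = u'"
  shows "fock_inner (fock_mult u v) (fock_mult u' v') = fock_inner u u' * fock_inner v v'"
proof -
  let ?d = "degree_part n"
  have "fock_inner (fock_mult (?d u) v) (fock_mult (?d u') v') = fock_inner (?d u) (?d u') * fock_inner v v'"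
  proof (induction u rule: fock_induct)
    case (tensor xs)
    show ?case
    proof (induction u' rule: fock_induct)
      case (tensor xs')
      show ?case
      proof (induction v rule: fock_induct)
        case (tensor ys)
        show ?case
          by (induction v' rule: fock_induct)
             (auto simp: degree_part_tensor fock_mult_tensor linear_add[OF linear_fock_mult_right] linear_scale[OF linear_fock_mult_right]
                linear_0[OF linear_fock_mult_left] fock_inner_zero_left fock_inner_zero_right fock_inner_add_right
                fock_inner_scale_right fock_inner_tensor_append distrib_left)
      qed (simp_all add: linear_add[OF linear_fock_mult_right] linear_scale[OF linear_fock_mult_right] fock_inner_add_left
          fock_inner_scale_left algebra_simps)
    qed (simp_all add: linear_add[OF linear_fock_mult_left] linear_scale[OF linear_fock_mult_left] fock_inner_add_right
          fock_inner_scale_right algebra_simps linear_add[OF linear_degree_part] linear_scale[OF linear_degree_part])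
  qed (simp_all add: linear_add[OF linear_fock_mult_left] linear_scale[OF linear_fock_mult_left] fock_inner_add_left
          fock_inner_scale_left algebra_simps linear_add[OF linear_degree_part] linear_scale[OF linear_degree_part])
  then show ?thesis using assms by simp
qed

definition fock_prod :: "'h::real_vector fock list \<Rightarrow> 'h fock" where
  "fock_prod us = foldr fock_mult us (tensor [])"

lemma fock_prod_Nil [simp]: "fock_prod [] = tensor []"
  and fock_prod_Cons [simp]: "fock_prod (u # us) = fock_mult u (fock_prod us)"
  by (simp_all add: fock_prod_def)

lemma fock_prod_tensor: "fock_prod (map tensor xss) = tensor (concat xss)"
  by (induction xss) (simp_all add: fock_mult_tensor)

lemma multilinear_fock_prod: "multilinear fock_prod"
proof -
  have "fock_prod (us[i := x + y]) = fock_prod (us[i := x]) + fock_prod (us[i := y]) \<and>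
      fock_prod (us[i := c *\<^sub>R x]) = c *\<^sub>R fock_prod (us[i := x])" if "i < length us"
    for us i and x y :: "'a fock" and c
    using that
  proof (induction us arbitrary: i)
    case (Cons u us)
    then show ?case
      by (cases i) (simp_all add: linear_add[OF linear_fock_mult_left] linear_scale[OF linear_fock_mult_left]
        linear_add[OF linear_fock_mult_right] linear_scale[OF linear_fock_mult_right])
  qed simp
  then show ?thesis unfolding multilinear_def by blast
qed

definition homogeneous_list :: "nat list \<Rightarrow> 'h::real_vector fock list \<Rightarrow> bool" where
  "homogeneous_list ns us \<longleftrightarrow> list_all2 (\<lambda>n u. degree_part n u = u) ns us"

lemma homogeneous_list_simps [simp]:
  "homogeneous_list [] us \<longleftrightarrow> us = []"
  "homogeneous_list ns [] \<longleftrightarrow> ns = []"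
  "homogeneous_list (n # ns) (u # us) \<longleftrightarrow> degree_part n u = u \<and> homogeneous_list ns us"
  by (auto simp: homogeneous_list_def)

lemma degree_part_fock_prod:
  "homogeneous_list ns us \<Longrightarrow> degree_part (sum_list ns) (fock_prod us) = fock_prod us"
  unfolding homogeneous_list_def
  by (induction rule: list_all2_induct) (auto simp: degree_part_tensor degree_part_fock_mult)

lemma fock_inner_prod:
  assumes "homogeneous_list ns us" "homogeneous_list ns vs"
  shows "fock_inner (fock_prod us) (fock_prod vs) = (\<Prod>(u, v)\<leftarrow>zip us vs. fock_inner u v)"
  using assms
proof (induction ns arbitrary: us vs)
  case Nil
  then show ?case by (simp add: fock_inner_tensor)
next
  case (Cons n ns)
  then obtain u us' v vs' where "us = u # us'" "vs = v # vs'"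
    by (metis list.distinct(1) list.exhaust homogeneous_list_simps(2))
  then show ?case using Cons by (simp add: fock_inner_mult[of n])
qed

lemma fock_over_prod:
  "set us \<subseteq> fock_over B \<Longrightarrow> fock_prod us \<in> fock_over B"
proof (induction us)
  case Nil
  then show ?case by (auto simp: fock_over_def intro!: span_base)
next
  case (Cons u us)
  have "fock_mult u v \<in> fock_over B" if u: "u \<in> fock_over B" and v: "v \<in> fock_over B" for u v :: "'a fock"
    using u unfolding fock_over_def
  proof (induction rule: span_induct)
    case base
    show ?case
      by (auto simp: subspace_def linear_0[OF linear_fock_mult_left] linear_add[OF linear_fock_mult_left]
        linear_scale[OF linear_fock_mult_left] span_zero span_add span_scale)
  next
    case (step u)
    then obtain xs where xs: "u = tensor xs" "set xs \<subseteq> span B" by auto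
    show ?case
      using v unfolding fock_over_def
    proof (induction rule: span_induct)
      case base
      show ?case
        by (auto simp: subspace_def linear_0[OF linear_fock_mult_right] linear_add[OF linear_fock_mult_right]
          linear_scale[OF linear_fock_mult_right] span_zero span_add span_scale)
    next
      case (step v)
      then show ?case using xs by (auto simp: fock_mult_tensor intro!: span_base)
    qed
  qed
  then show ?case using Cons by simp
qed

section \<open>Tensor networks\<close>

lemma sum_PiE_insert:
  fixes g :: "('e \<Rightarrow> 'b) \<Rightarrow> real"
  assumes "e \<notin> E"
  shows "(\<Sum>\<alpha>\<in>PiE (insert e E) (\<lambda>_. B). g \<alpha>) = (\<Sum>\<alpha>\<in>PiE E (\<lambda>_. B). \<Sum>x\<in>B. g (\<alpha>(e := x)))"
proof -
  have "(\<Sum>\<alpha>\<in>PiE (insert e E) (\<lambda>_. B). g \<alpha>) = (\<Sum>(x, \<alpha>)\<in>B \<times> PiE E (\<lambda>_. B). g (\<alpha>(e := x)))"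
    unfolding PiE_insert_eq by (subst sum.reindex[OF inj_combinator[OF assms]]) (simp add: case_prod_beta)
  also have "\<dots> = (\<Sum>\<alpha>\<in>PiE E (\<lambda>_. B). \<Sum>x\<in>B. g (\<alpha>(e := x)))"
    by (subst sum.cartesian_product[symmetric]) (rule sum.swap)
  finally show ?thesis .
qed

text \<open>The indices are summed one at a time, by Cauchy--Schwarz for the two nodes that share them.\<close>

lemma tensor_network_bound:
  fixes f :: "'v \<Rightarrow> ('e \<Rightarrow> 'b) \<Rightarrow> real"
  assumes "finite E" "finite V"
    and "\<And>v. v \<in> V \<Longrightarrow> S v \<subseteq> E"
    and "\<And>e. e \<in> E \<Longrightarrow> card {v \<in> V. e \<in> S v} = 2"
    and "\<And>v \<alpha> \<beta>. v \<in> V \<Longrightarrow> (\<And>e. e \<in> S v \<Longrightarrow> \<alpha> e = \<beta> e) \<Longrightarrow> f v \<alpha> = f v \<beta>"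
    and "\<And>v \<alpha>. 0 \<le> f v \<alpha>"
  shows "(\<Sum>\<alpha>\<in>PiE E (\<lambda>_. B). \<Prod>v\<in>V. f v \<alpha>) \<le> (\<Prod>v\<in>V. sqrt (\<Sum>\<alpha>\<in>PiE (S v) (\<lambda>_. B). (f v \<alpha>)\<^sup>2))"
  using assms(1,3-)
proof (induction E arbitrary: S f rule: finite_induct)
  case empty
  then have "S v = {}" if "v \<in> V" for v using that by blast
  then show ?case using empty.prems(4) by (simp cong: prod.cong_simp)
next
  case (insert e E)
  \<comment> \<open>The index \<open>e\<close> is summed out: the two nodes that carry it are
    replaced by their l2 norms in this variable, and the other nodes do not depend on it.\<close>
  define f' where "f' v \<alpha> = (if e \<in> S v then sqrt (\<Sum>x\<in>B. (f v (\<alpha>(e := x)))\<^sup>2) else f v \<alpha>)" for v \<alpha>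
  define S' where "S' v = S v - {e}" for v
  obtain u w where uw: "{v \<in> V. e \<in> S v} = {u, w}" "u \<noteq> w"
    using insert.prems(2)[of e] by (auto simp: card_2_iff)
  then have uwV: "u \<in> V" "w \<in> V" "e \<in> S u" "e \<in> S w" by blast+
  have split: "(\<Prod>v\<in>V. h v) = h u * h w * (\<Prod>v\<in>V - {u, w}. h v)" for h :: "'v \<Rightarrow> real"
    using prod.remove[OF \<open>finite V\<close> uwV(1), of h] prod.remove[of "V - {u}" w h] \<open>finite V\<close> uwV uw(2)
    by (simp add: Diff_insert2[symmetric] mult.assoc)
  have off: "e \<notin> S v" if "v \<in> V - {u, w}" for v using uw(1) that by blast
  have step: "(\<Sum>x\<in>B. \<Prod>v\<in>V. f v (\<alpha>(e := x))) \<le> (\<Prod>v\<in>V. f' v \<alpha>)" for \<alpha>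
  proof -
    have "(\<Prod>v\<in>V. f v (\<alpha>(e := x))) = f u (\<alpha>(e := x)) * f w (\<alpha>(e := x)) * (\<Prod>v\<in>V - {u, w}. f v \<alpha>)" for x
    proof -
      have "f v (\<alpha>(e := x)) = f v \<alpha>" if "v \<in> V - {u, w}" for v
        by (rule insert.prems(3)) (use off[OF that] that in auto)
      then show ?thesis unfolding split by simp
    qed
    then have "(\<Sum>x\<in>B. \<Prod>v\<in>V. f v (\<alpha>(e := x))) =
        (\<Sum>x\<in>B. \<bar>f u (\<alpha>(e := x))\<bar> * \<bar>f w (\<alpha>(e := x))\<bar>) * (\<Prod>v\<in>V - {u, w}. f v \<alpha>)"
      using insert.prems(4) by (simp add: sum_distrib_right)
    also have "\<dots> \<le> (f' u \<alpha> * f' w \<alpha>) * (\<Prod>v\<in>V - {u, w}. f v \<alpha>)"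
      using L2_set_mult_ineq[where f = "\<lambda>x. f u (\<alpha>(e := x))" and g = "\<lambda>x. f w (\<alpha>(e := x))" and A = B] uwV
        insert.prems(4)
      by (intro mult_right_mono prod_nonneg) (auto simp: f'_def L2_set_def)
    also have "(\<Prod>v\<in>V - {u, w}. f v \<alpha>) = (\<Prod>v\<in>V - {u, w}. f' v \<alpha>)"
      by (rule prod.cong) (use off in \<open>auto simp: f'_def\<close>)
    finally show ?thesis unfolding split[of "\<lambda>v. f' v \<alpha>"] .
  qed
  have "(\<Sum>\<alpha>\<in>PiE (insert e E) (\<lambda>_. B). \<Prod>v\<in>V. f v \<alpha>) \<le> (\<Sum>\<alpha>\<in>PiE E (\<lambda>_. B). \<Prod>v\<in>V. f' v \<alpha>)"
    unfolding sum_PiE_insert[OF insert.hyps(2)] by (intro sum_mono step)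
  also have "\<dots> \<le> (\<Prod>v\<in>V. sqrt (\<Sum>\<alpha>\<in>PiE (S' v) (\<lambda>_. B). (f' v \<alpha>)\<^sup>2))"
  proof (rule insert.IH)
    show "S' v \<subseteq> E" if "v \<in> V" for v using insert.prems(1)[OF that] by (auto simp: S'_def)
    show "card {v \<in> V. a \<in> S' v} = 2" if "a \<in> E" for a
    proof -
      have "{v \<in> V. a \<in> S' v} = {v \<in> V. a \<in> S v}" using that insert.hyps(2) by (auto simp: S'_def)
      then show ?thesis using insert.prems(2)[of a] that by simp
    qed
    show "f' v \<alpha> = f' v \<beta>" if "v \<in> V" "\<And>a. a \<in> S' v \<Longrightarrow> \<alpha> a = \<beta> a" for v \<alpha> \<beta>
    proof (cases "e \<in> S v")
      case True
      have "f v (\<alpha>(e := x)) = f v (\<beta>(e := x))" for x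
        by (rule insert.prems(3)[OF that(1)]) (use that(2) in \<open>auto simp: S'_def\<close>)
      then show ?thesis using True by (simp add: f'_def)
    next
      case False
      have "f v \<alpha> = f v \<beta>"
        by (rule insert.prems(3)[OF that(1)]) (use that(2) False in \<open>auto simp: S'_def\<close>)
      then show ?thesis using False by (simp add: f'_def)
    qed
    show "0 \<le> f' v \<alpha>" for v \<alpha> using insert.prems(4) by (auto simp: f'_def intro!: sum_nonneg)
  qed
  also have "\<dots> = (\<Prod>v\<in>V. sqrt (\<Sum>\<alpha>\<in>PiE (S v) (\<lambda>_. B). (f v \<alpha>)\<^sup>2))"
  proof (intro prod.cong refl arg_cong[where f = sqrt])
    fix v assume "v \<in> V"
    show "(\<Sum>\<alpha>\<in>PiE (S' v) (\<lambda>_. B). (f' v \<alpha>)\<^sup>2) = (\<Sum>\<alpha>\<in>PiE (S v) (\<lambda>_. B). (f v \<alpha>)\<^sup>2)"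
    proof (cases "e \<in> S v")
      case True
      then have "S v = insert e (S' v)" by (auto simp: S'_def)
      then have "(\<Sum>\<alpha>\<in>PiE (S v) (\<lambda>_. B). (f v \<alpha>)\<^sup>2) =
          (\<Sum>\<alpha>\<in>PiE (S' v) (\<lambda>_. B). \<Sum>x\<in>B. (f v (\<alpha>(e := x)))\<^sup>2)"
        using sum_PiE_insert[of e "S' v" "\<lambda>\<alpha>. (f v \<alpha>)\<^sup>2" B] by (simp add: S'_def)
      then show ?thesis using True by (simp add: f'_def sum_nonneg)
    next
      case False
      then show ?thesis by (simp add: f'_def S'_def)
    qed
  qed
  finally show ?case .
qed

section \<open>Contractions of tensors\<close>

definition lookup :: "'i list \<Rightarrow> 'a list \<Rightarrow> 'i \<Rightarrow> 'a" where
  "lookup Q zs x = the (map_of (zip Q zs) x)"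

lemma lookup_map: "x \<in> set Q \<Longrightarrow> lookup Q (map f Q) x = f x"
  by (simp add: lookup_def map_of_zip_map)

lemma map_lookup: "distinct Q \<Longrightarrow> length zs = length Q \<Longrightarrow> map (lookup Q zs) Q = zs"
  by (rule nth_equalityI) (auto simp: lookup_def map_of_zip_nth)

text \<open>Two orders of one index set are involved: \<open>zs\<close> is listed in the order of
  \<open>Q\<close>, the result in the order of \<open>U\<close>. In the application \<open>Q\<close>
  lists all of L before J, while \<open>U\<close> is a sublist of the interleaving. The value 0 at
  other lengths makes this a form on all lists.\<close>

definition contract :: "'i list \<Rightarrow> ('i \<times> 'i) set \<Rightarrow> 'i list \<Rightarrow> 'h::real_inner list \<Rightarrow> 'h fock" where
  "contract Q \<sigma> U zs = (if length zs = length Q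
     then (\<Prod>(s, t)\<in>\<sigma>. lookup Q zs s \<bullet> lookup Q zs t) *\<^sub>R tensor (map (lookup Q zs) U) else 0)"

lemma contract_map:
  assumes "Field \<sigma> \<subseteq> set Q" "set U \<subseteq> set Q"
  shows "contract Q \<sigma> U (map f Q) = (\<Prod>(s, t)\<in>\<sigma>. f s \<bullet> f t) *\<^sub>R tensor (map f U)"
proof -
  have "lookup Q (map f Q) s = f s" "lookup Q (map f Q) t = f t" if "(s, t) \<in> \<sigma>" for s t
    using that assms(1) by (auto simp: Field_def intro!: lookup_map)
  then have "(\<Prod>(s, t)\<in>\<sigma>. lookup Q (map f Q) s \<bullet> lookup Q (map f Q) t) = (\<Prod>(s, t)\<in>\<sigma>. f s \<bullet> f t)"
    by (intro prod.cong) auto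
  moreover have "map (lookup Q (map f Q)) U = map f U"
    using assms(2) by (auto intro!: lookup_map)
  ultimately show ?thesis by (simp only: contract_def length_map if_True refl)
qed

lemma contractions_iff:
  "\<sigma> \<in> contractions K \<longleftrightarrow>
    (\<forall>i j. (i, j) \<in> \<sigma> \<longrightarrow> before K i j) \<and>
    (\<forall>i j k l. (i, j) \<in> \<sigma> \<longrightarrow> (k, l) \<in> \<sigma> \<longrightarrow> (i, j) \<noteq> (k, l) \<longrightarrow> {i, j} \<inter> {k, l} = {})"
  unfolding contractions_def Ball_def split_paired_All mem_Collect_eq prod.case by iprover

lemma contractions_disjoint:
  assumes "\<sigma> \<in> contractions K" "(i, j) \<in> \<sigma>" "(k, l) \<in> \<sigma>" "(i, j) \<noteq> (k, l)"
  shows "{i, j} \<inter> {k, l} = {}"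
  using assms(1)[unfolded contractions_iff, THEN conjunct2] assms(2-4) by blast

lemma contractions_irrefl:
  assumes "\<sigma> \<in> contractions K" "distinct K" "(i, j) \<in> \<sigma>"
  shows "i \<noteq> j"
  using assms(1)[unfolded contractions_iff, THEN conjunct1] assms(2,3) before_irrefl[OF assms(2)] by blast

lemma map_fun_upd_distinct:
  assumes "distinct U" "j < length U"
  shows "map (f(U ! j := x)) U = (map f U)[j := x]"
  using assms by (intro nth_equalityI) (auto simp: nth_list_update nth_eq_iff_index_eq)

text \<open>Pairs are disjoint, so every entry occurs in just one place, either in one inner product
  or in one factor of the resulting tensor.\<close>

lemma multilinear_contract:
  assumes Q: "distinct Q" and K: "distinct K" "set K = set Q" and \<sigma>: "\<sigma> \<in> contractions K"
  shows "multilinear (contract Q \<sigma> (unpaired K \<sigma>) :: 'h::real_inner list \<Rightarrow> _)"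
  unfolding multilinear_def
proof (intro allI impI)
  fix zs :: "'h list" and i x y and c :: real assume i: "i < length zs"
  let ?U = "unpaired K \<sigma>"
  have FQ: "Field \<sigma> \<subseteq> set Q" using contractions_Field[OF \<sigma>] K by simp
  have UQ: "set ?U \<subseteq> set Q" using K by (auto simp: unpaired_def)
  show "contract Q \<sigma> ?U (zs[i := x + y]) = contract Q \<sigma> ?U (zs[i := x]) + contract Q \<sigma> ?U (zs[i := y]) \<and>
        contract Q \<sigma> ?U (zs[i := c *\<^sub>R x]) = c *\<^sub>R contract Q \<sigma> ?U (zs[i := x])"
  proof (cases "length zs = length Q")
    case True
    define f where "f = lookup Q zs"
    define p where "p = Q ! i"
    have p: "p \<in> set Q" using i True by (simp add: p_def)
    have eq: "contract Q \<sigma> ?U (zs[i := v]) =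
        (\<Prod>(s, t)\<in>\<sigma>. (f(p := v)) s \<bullet> (f(p := v)) t) *\<^sub>R tensor (map (f(p := v)) ?U)" for v
    proof -
      have "zs[i := v] = map (f(p := v)) Q"
        using map_fun_upd_distinct[OF Q, of i f v] map_lookup[OF Q True] i True by (simp add: f_def p_def)
      then show ?thesis using contract_map[OF FQ UQ, of "f(p := v)"] by (simp only:)
    qed
    show ?thesis
    proof (cases "p \<in> Field \<sigma>")
      case True
      then obtain a b where ab: "(a, b) \<in> \<sigma>" "p = a \<or> p = b" by (auto simp: Field_def)
      \<comment> \<open>An element paired with itself would make the dependence on its entry
        quadratic.\<close>
      have neq: "a \<noteq> b" using contractions_irrefl[OF \<sigma> K(1) ab(1)] .
      have U: "map (f(p := v)) ?U = map f ?U" for v using True by (auto simp: unpaired_def)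
      define y0 where "y0 = (if p = a then f b else f a)"
      define R where "R = (\<Prod>(s, t)\<in>\<sigma> - {(a, b)}. f s \<bullet> f t)"
      have "(\<Prod>(s, t)\<in>\<sigma>. (f(p := v)) s \<bullet> (f(p := v)) t) =
          ((f(p := v)) a \<bullet> (f(p := v)) b) * (\<Prod>(s, t)\<in>\<sigma> - {(a, b)}. (f(p := v)) s \<bullet> (f(p := v)) t)" for v
        using prod.remove[OF finite_contraction[OF \<sigma>] ab(1), of "\<lambda>(s, t). (f(p := v)) s \<bullet> (f(p := v)) t"]
        by (simp only: prod.case)
      moreover have "(f(p := v)) a \<bullet> (f(p := v)) b = v \<bullet> y0" for v
        using ab(2) neq by (auto simp: y0_def inner_commute)
      moreover have "(\<Prod>(s, t)\<in>\<sigma> - {(a, b)}. (f(p := v)) s \<bullet> (f(p := v)) t) =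
          R" for v
        unfolding R_def
      proof (rule prod.cong[OF refl])
        fix z assume "z \<in> \<sigma> - {(a, b)}"
        moreover obtain s t where z: "z = (s, t)" by force
        ultimately have "{s, t} \<inter> {a, b} = {}" using contractions_disjoint[OF \<sigma> _ ab(1)] by blast
        then have "s \<noteq> p" "t \<noteq> p" using ab(2) by auto
        then show "(case z of (s, t) \<Rightarrow> (f(p := v)) s \<bullet> (f(p := v)) t) = (case z of (s, t) \<Rightarrow> f s \<bullet> f t)"
          by (simp add: z)
      qed
      ultimately have "contract Q \<sigma> ?U (zs[i := v]) = ((v \<bullet> y0) * R) *\<^sub>R tensor (map f ?U)" for v
        unfolding eq U by (simp only:)
      then show ?thesis
        by (simp add: inner_add_left distrib_right scaleR_add_left mult.assoc)
    next
      case False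
      then have "p \<in> set ?U" using p K by (simp add: unpaired_def)
      then obtain j where j: "j < length ?U" "p = ?U ! j" by (metis in_set_conv_nth)
      have U: "map (f(p := v)) ?U = (map f ?U)[j := v]" for v
        unfolding j(2) by (rule map_fun_upd_distinct) (use K j in \<open>auto simp: unpaired_def\<close>)
      have "(\<Prod>(s, t)\<in>\<sigma>. (f(p := v)) s \<bullet> (f(p := v)) t) = (\<Prod>(s, t)\<in>\<sigma>. f s \<bullet> f t)" for v
        by (rule prod.cong) (use False in \<open>auto simp: Field_def\<close>)
      then show ?thesis
        unfolding eq U using multilinear_tensor[unfolded multilinear_def, rule_format, of j "map f ?U"] j(1)
        by (simp add: scaleR_add_right mult.commute)
    qed
  qed (simp add: contract_def)
qed

lemma degree_part_contract:
  fixes u :: "'h::real_inner fock"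
  assumes "multilinear (contract Q \<sigma> U :: 'h list \<Rightarrow> _)"
  shows "degree_part (length U) (lin_ext (contract Q \<sigma> U) u) = lin_ext (contract Q \<sigma> U) u"
proof -
  have d: "degree_part (length U) (contract Q \<sigma> U xs) = contract Q \<sigma> U xs" for xs :: "'h list"
    by (simp add: contract_def degree_part_tensor linear_scale[OF linear_degree_part] linear_0[OF linear_degree_part])
  show ?thesis
    by (induction u rule: fock_induct)
     (simp_all add: d linear_add[OF linear_degree_part] linear_scale[OF linear_degree_part] lin_ext_tensor[OF assms]
       linear_add[OF linear_lin_ext[OF assms]] linear_scale[OF linear_lin_ext[OF assms]])
qed

text \<open>Translates between assignments of basis vectors to indices, the language of
  \<open>tensor_network_bound\<close>, and words, the language of \<open>parseval\<close>.\<close>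

lemma sum_words_reindex:
  fixes h :: "'a list \<Rightarrow> real"
  assumes "distinct K"
  shows "(\<Sum>\<alpha>\<in>PiE (set K) (\<lambda>_. B). h (map \<alpha> K)) = (\<Sum>a\<in>words B (length K). h a)"
proof (rule sum.reindex_bij_witness[where i = "\<lambda>a. restrict (lookup K a) (set K)" and j = "\<lambda>\<alpha>. map \<alpha> K"])
  fix a assume "a \<in> words B (length K)"
  then have a: "set a \<subseteq> B" "length a = length K" by (auto simp: words_def)
  have "map (restrict (lookup K a) (set K)) K = map (lookup K a) K"
    by (rule map_cong) auto
  then show "map (restrict (lookup K a) (set K)) K = a"
    unfolding map_lookup[OF assms a(2)] .
  have "lookup K a x \<in> B" if "x \<in> set K" for x
  proof -
    have "lookup K a x \<in> set (map (lookup K a) K)" using that by simp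
    then show ?thesis unfolding map_lookup[OF assms a(2)] using a(1) by blast
  qed
  then show "restrict (lookup K a) (set K) \<in> PiE (set K) (\<lambda>_. B)" by (rule restrict_PiE_iff[THEN iffD2, OF ballI])
next
  fix \<alpha> assume \<alpha>: "\<alpha> \<in> PiE (set K) (\<lambda>_. B)"
  show "restrict (lookup K (map \<alpha> K)) (set K) = \<alpha>"
  proof
    fix x show "restrict (lookup K (map \<alpha> K)) (set K) x = \<alpha> x"
      using lookup_map[of x K \<alpha>] PiE_arb[OF \<alpha>, of x] by (cases "x \<in> set K") simp_all
  qed
  show "map \<alpha> K \<in> words B (length K)" using PiE_mem[OF \<alpha>] unfolding words_def by auto
qed simp

lemma fock_norm_nonneg: "degree_part n u = u \<Longrightarrow> 0 \<le> fock_norm u"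
  by (simp add: fock_norm_def fock_inner_nonneg)

lemma fock_norm_parseval:
  assumes "orthonormal B" "u \<in> fock_over B" "degree_part n u = u"
  shows "fock_norm u = sqrt (\<Sum>a\<in>words B n. \<bar>fock_inner u (tensor a)\<bar>\<^sup>2)"
  using parseval[OF assms, of u] by (simp add: fock_norm_def power2_eq_square)

text \<open>The coordinates of a product tensor factorise along the blocks; each factor becomes one
  node of the network.\<close>

lemma fock_inner_prod_concat:
  assumes "homogeneous_list (map length Bs) us"
  shows "fock_inner (fock_prod us) (tensor (map g (concat Bs))) =
    (\<Prod>j<length Bs. fock_inner (us ! j) (tensor (map g (Bs ! j))))"
proof -
  have len: "length us = length Bs" using assms by (auto simp: homogeneous_list_def dest: list_all2_lengthD)
  have "tensor (map g (concat Bs)) = fock_prod (map (\<lambda>B. tensor (map g B)) Bs)"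
    using fock_prod_tensor[of "map (map g) Bs"] by (simp add: map_concat comp_def)
  moreover have "homogeneous_list (map length Bs) (map (\<lambda>B. tensor (map g B)) Bs)"
    by (simp add: homogeneous_list_def list_all2_map1 list_all2_map2 degree_part_tensor list_all2_same)
  ultimately have "fock_inner (fock_prod us) (tensor (map g (concat Bs))) =
      (\<Prod>(u, v)\<leftarrow>zip us (map (\<lambda>B. tensor (map g B)) Bs). fock_inner u v)"
    using fock_inner_prod[OF assms] by simp
  also have "\<dots> = (\<Prod>j<length Bs. fock_inner (us ! j) (tensor (map g (Bs ! j))))"
    by (simp add: prod.list_conv_set_nth len atLeast0LessThan)
  finally show ?thesis .
qed

lemma distinct_concat_block_unique:
  assumes "distinct (concat Bs)" "x \<in> set (Bs ! i)" "x \<in> set (Bs ! j)" "i < length Bs" "j < length Bs"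
  shows "i = j"
  using assms
proof (induction Bs arbitrary: i j)
  case (Cons A Bs)
  show ?case
  proof (cases i; cases j)
    fix i' j' assume "i = Suc i'" "j = Suc j'"
    then show "i = j" using Cons.IH[of i' j'] Cons.prems by simp
  next
    fix i' assume ij: "i = Suc i'" "j = 0"
    then have "set (Bs ! i') \<subseteq> set (concat Bs)" using Cons.prems nth_mem[of i' Bs] by auto
    then show "i = j" using Cons.prems ij by auto
  next
    fix j' assume ij: "i = 0" "j = Suc j'"
    then have "set (Bs ! j') \<subseteq> set (concat Bs)" using Cons.prems nth_mem[of j' Bs] by auto
    then show "i = j" using Cons.prems ij by auto
  qed simp
qed simp

text \<open>Pairing the contracted tensor \<open>Y\<close> with itself closes the network: its nodes
  are the blocks and one copy of \<open>Y\<close>, and its edges are the pairs of \<sigma>, each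
  between two different blocks, and the unpaired elements, each between its block and
  \<open>Y\<close>. The network bound then reads |Y|^2 \<le> (product of the norms) |Y|.\<close>

lemma fock_norm_contract_le:
  fixes us :: "'h::real_inner fock list"
  assumes d: "distinct (concat Bs)" and K: "distinct K" "set K = set (concat Bs)"
    and \<sigma>: "\<sigma> \<in> contractions K"
    and blk: "\<And>i j A. (i, j) \<in> \<sigma> \<Longrightarrow> A \<in> set Bs \<Longrightarrow> \<not> (i \<in> set A \<and> j \<in> set A)"
    and us: "homogeneous_list (map length Bs) us"
  shows "fock_norm (lin_ext (contract (concat Bs) \<sigma> (unpaired K \<sigma>)) (fock_prod us)) \<le> (\<Prod>u\<leftarrow>us. fock_norm u)"
proof -
  let ?Q = "concat Bs" and ?m = "length Bs"
  let ?U = "unpaired K \<sigma>"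
  let ?c = "contract ?Q \<sigma> ?U :: 'h list \<Rightarrow> _"
  have ml: "multilinear ?c" by (rule multilinear_contract[OF d K \<sigma>])
  have FQ: "Field \<sigma> \<subseteq> set ?Q" using contractions_Field[OF \<sigma>] K by simp
  have FQ12: "s \<in> set ?Q" "t \<in> set ?Q" if "(s, t) \<in> \<sigma>" for s t
    using FQ that unfolding Field_def by blast+
  have UQ: "set ?U \<subseteq> set ?Q" and Uset: "set ?U = set ?Q - Field \<sigma>" and Ud: "distinct ?U"
    using K by (auto simp: unpaired_def)
  have len: "length us = ?m" using us by (auto simp: homogeneous_list_def dest: list_all2_lengthD)
  have deg: "degree_part (length (Bs ! j)) (us ! j) = us ! j" if "j < ?m" for j
    using us that by (auto simp: homogeneous_list_def list_all2_conv_all_nth)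
  define X where "X = fock_prod us"
  define Y where "Y = lin_ext ?c X"
  have degX: "degree_part (length ?Q) X = X"
    using degree_part_fock_prod[OF us] by (simp add: X_def length_concat comp_def)
  have degY: "degree_part (length ?U) Y = Y"
    unfolding Y_def by (rule degree_part_contract[OF ml])
  obtain B where B: "orthonormal B" and over: "insert Y (set us) \<subseteq> fock_over B"
    using fock_over_exists[of "insert Y (set us)"] by auto
  have finB: "finite B" using B by (simp add: orthonormal_def)
  have X: "X = (\<Sum>w\<in>words B (length ?Q). fock_inner X (tensor w) *\<^sub>R tensor w)"
    by (rule fock_expand[OF B _ degX]) (use over fock_over_prod in \<open>auto simp: X_def\<close>)
  \<comment> \<open>Sends the second element of a pair to the first and fixes everything else. Every
    pair and every unpaired element thus has one representative, and \<open>E\<close> is the set of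
    edges.\<close>
  define r where "r x = (if x \<in> snd ` \<sigma> then (SOME s. (s, x) \<in> \<sigma>) else x)" for x
  define E where "E = r ` set ?Q"
  have uniq: "s = s'" if "(s, t) \<in> \<sigma>" "(s', t) \<in> \<sigma>" for s s' t
    using contractions_disjoint[OF \<sigma> that] by auto
  have uniq': "t = t'" if "(s, t) \<in> \<sigma>" "(s, t') \<in> \<sigma>" for s t t'
    using contractions_disjoint[OF \<sigma> that] by auto
  have not_both: "s \<notin> snd ` \<sigma>" if "(s, t) \<in> \<sigma>" for s t
  proof
    assume "s \<in> snd ` \<sigma>"
    then obtain a where a: "(a, s) \<in> \<sigma>" by auto
    moreover have "a \<noteq> s" "s \<noteq> t" using contractions_irrefl[OF \<sigma> K(1)] a that by blast+
    ultimately show False using contractions_disjoint[OF \<sigma> a that] by auto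
  qed
  have r2: "r t = s" if "(s, t) \<in> \<sigma>" for s t
      proof -
    have "t \<in> snd ` \<sigma>" using that by force
    moreover have "(SOME s. (s, t) \<in> \<sigma>) = s" using someI[of "\<lambda>s. (s, t) \<in> \<sigma>", OF that] uniq[OF _ that] by blast
    ultimately show ?thesis by (simp add: r_def)
  qed
  have r1: "r s = s" if "(s, t) \<in> \<sigma>" for s t using not_both[OF that] by (simp add: r_def)
  have rU: "r u = u" if "u \<in> set ?U" for u
  proof -
    have "u \<notin> snd ` \<sigma>" using that Uset by (force simp: Field_def)
    then show ?thesis by (simp add: r_def)
  qed
  have r_cases: "r x = x \<or> (r x, x) \<in> \<sigma>" for x
  proof (cases "x \<in> snd ` \<sigma>")
    case True
    then obtain a where "(a, x) \<in> \<sigma>" by auto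
    then show ?thesis using r2 by simp
  qed (simp add: r_def)
  have rQ: "r x \<in> set ?Q" if "x \<in> set ?Q" for x
    using r_cases[of x] that FQ by (auto simp: Field_def)
  have rr: "r e = e" if e: "e \<in> E" for e
  proof -
    obtain x where "e = r x" using e unfolding E_def by blast
    then show ?thesis using r_cases[of x] r1[of "r x" x] by auto
  qed
  have EQ: "E \<subseteq> set ?Q" using rQ by (auto simp: E_def)
  have finE: "finite E" by (simp add: E_def)
  \<comment> \<open>An assignment of basis vectors to the edges, read as a word over all positions;
    its letters agree at the two ends of every pair.\<close>
  let ?h = "\<lambda>\<alpha>. map (\<lambda>x. \<alpha> (r x)) ?Q"
  let ?I = "PiE E (\<lambda>_. B)"
  have inj_h: "inj_on ?h ?I"
  proof (rule inj_onI)
    fix \<alpha> \<beta> assume \<alpha>: "\<alpha> \<in> ?I" and \<beta>: "\<beta> \<in> ?I" and "?h \<alpha> = ?h \<beta>"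
    then have "\<alpha> (r x) = \<beta> (r x)" if "x \<in> set ?Q" for x using that by (auto simp: map_eq_conv)
    then have "\<alpha> e = \<beta> e" if "e \<in> E" for e using that by (auto simp: E_def)
    then show "\<alpha> = \<beta>" using \<alpha> \<beta> by (intro PiE_ext) auto
  qed
  have h_words: "?h ` ?I \<subseteq> words B (length ?Q)"
  proof -
    have "\<alpha> (r x) \<in> B" if "\<alpha> \<in> ?I" "x \<in> set ?Q" for \<alpha> x
      using PiE_mem[OF that(1), of "r x"] that(2) by (simp only: E_def imageI)
    then show ?thesis unfolding words_def by (intro image_subsetI CollectI conjI subsetI) (auto simp only: set_map length_map)
  qed
  have c_h: "?c (?h \<alpha>) = tensor (map \<alpha> ?U)" if \<alpha>: "\<alpha> \<in> ?I" for \<alpha>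
  proof -
    have "(\<Prod>(s, t)\<in>\<sigma>. \<alpha> (r s) \<bullet> \<alpha> (r t)) = 1"
    proof (rule prod.neutral, clarify)
      fix s t assume st: "(s, t) \<in> \<sigma>"
      have "s \<in> set ?Q" using FQ st unfolding Field_def by blast
      then have "r s \<in> E" by (simp only: E_def imageI)
      then have "\<alpha> (r s) \<in> B" using \<alpha> by auto
      then show "\<alpha> (r s) \<bullet> \<alpha> (r t) = 1" using B r1[OF st] r2[OF st] by (simp add: orthonormal_def)
    qed
    moreover have "map (\<lambda>x. \<alpha> (r x)) ?U = map \<alpha> ?U" using rU by simp
    ultimately show ?thesis using contract_map[OF FQ UQ, of "\<lambda>x. \<alpha> (r x)"] by (simp only: scaleR_one)
  qed
  \<comment> \<open>By orthogonality, the contraction kills every word with different basis vectors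
    at the two ends of some pair.\<close>
  have c_0: "?c w = 0" if w: "w \<in> words B (length ?Q) - ?h ` ?I" for w
  proof -
    define g where "g = lookup ?Q w"
    have lw: "length w = length ?Q" and wB: "set w \<subseteq> B" using w by (auto simp: words_def)
    have gw: "map g ?Q = w" unfolding g_def by (rule map_lookup[OF d lw])
    have gB: "g x \<in> B" if "x \<in> set ?Q" for x
    proof -
      have "g x \<in> set (map g ?Q)" unfolding set_map using that by (rule imageI)
      then show ?thesis unfolding gw using wB by blast
    qed
    have "\<exists>s t. (s, t) \<in> \<sigma> \<and> g s \<noteq> g t"
    proof (rule ccontr)
      assume "\<not> ?thesis"
      then have "g (r x) = g x" for x using r_cases[of x] by metis
      moreover have "restrict g E (r x) = g (r x)" if "x \<in> set ?Q" for x using that by (simp add: E_def)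
      ultimately have "?h (restrict g E) = map g ?Q" by (auto cong: map_cong)
      moreover have "restrict g E \<in> ?I" using gB EQ by (intro restrict_PiE_iff[THEN iffD2] ballI) blast
      ultimately have "w \<in> ?h ` ?I" using gw by (metis image_eqI)
      then show False using w by blast
    qed
    then obtain s t where st: "(s, t) \<in> \<sigma>" "g s \<noteq> g t" by blast
    have "g s \<in> B" "g t \<in> B" using gB FQ12[OF st(1)] by blast+
    then have "g s \<bullet> g t = 0" using st(2) B by (simp add: orthonormal_def)
    then have "(\<Prod>(s, t)\<in>\<sigma>. g s \<bullet> g t) = 0"
      using finite_contraction[OF \<sigma>] st(1) by (intro prod_zero bexI[of _ "(s, t)"]) simp_all
    then show ?thesis using contract_map[OF FQ UQ, of g] gw by simp
  qed
  \<comment> \<open>The number \<open>?m\<close> denotes the node \<open>Y\<close>, smaller numbers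
    denote the blocks. Absolute values are taken because the network bound is about nonnegative
    functions.\<close>
  define f where "f v \<alpha> = (if v < ?m then \<bar>fock_inner (us ! v) (tensor (map (\<lambda>x. \<alpha> (r x)) (Bs ! v)))\<bar>
      else \<bar>fock_inner Y (tensor (map \<alpha> ?U))\<bar>)" for v \<alpha>
  define S where "S v = (if v < ?m then r ` set (Bs ! v) else set ?U)" for v
  have "Y = (\<Sum>w\<in>words B (length ?Q). fock_inner X (tensor w) *\<^sub>R ?c w)"
    unfolding Y_def
    by (subst X) (simp add: linear_sum[OF linear_lin_ext[OF ml]] linear_scale[OF linear_lin_ext[OF ml]] lin_ext_tensor[OF ml])
  also have "\<dots> = (\<Sum>w\<in>?h ` ?I. fock_inner X (tensor w) *\<^sub>R ?c w)"
    by (rule sum.mono_neutral_right[OF finite_words[OF finB] h_words]) (use c_0 in auto)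
  also have "\<dots> = (\<Sum>\<alpha>\<in>?I. fock_inner X (tensor (?h \<alpha>)) *\<^sub>R tensor (map \<alpha> ?U))"
    unfolding sum.reindex[OF inj_h] by (rule sum.cong) (simp_all add: c_h)
  finally have "fock_inner Y Y = fock_inner Y (\<Sum>\<alpha>\<in>?I. fock_inner X (tensor (?h \<alpha>)) *\<^sub>R tensor (map \<alpha> ?U))"
    by (rule arg_cong)
  also have "\<dots> = (\<Sum>\<alpha>\<in>?I. fock_inner X (tensor (?h \<alpha>)) * fock_inner Y (tensor (map \<alpha> ?U)))"
    by (simp only: fock_inner_sum_right fock_inner_scale_right real_scaleR_def)
  also have "\<dots> \<le> (\<Sum>\<alpha>\<in>?I. \<Prod>v\<in>{..?m}. f v \<alpha>)"
  proof (rule sum_mono)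
    fix \<alpha>
    have "(\<Prod>v\<in>{..?m}. f v \<alpha>) = (\<Prod>v<?m. f v \<alpha>) * f ?m \<alpha>"
      by (simp add: lessThan_Suc_atMost[symmetric])
    also have "\<dots> = \<bar>fock_inner X (tensor (?h \<alpha>)) * fock_inner Y (tensor (map \<alpha> ?U))\<bar>"
      unfolding X_def fock_inner_prod_concat[OF us] by (simp add: f_def abs_mult abs_prod)
    finally show "fock_inner X (tensor (?h \<alpha>)) * fock_inner Y (tensor (map \<alpha> ?U)) \<le> (\<Prod>v\<in>{..?m}. f v \<alpha>)"
      by simp
  qed
  also have "\<dots> \<le> (\<Prod>v\<in>{..?m}. sqrt (\<Sum>\<alpha>\<in>PiE (S v) (\<lambda>_. B). (f v \<alpha>)\<^sup>2))"
  proof (rule tensor_network_bound[OF finE])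
    show "S v \<subseteq> E" if "v \<in> {..?m}" for v
    proof (cases "v < ?m")
      case True
      have "set (Bs ! v) \<subseteq> set ?Q" using nth_mem[OF True] by auto
      then show ?thesis using True unfolding S_def E_def by (simp only: if_True image_mono)
    next
      case False
      have "u \<in> E" if "u \<in> set ?U" for u
        using rU[OF that] UQ that unfolding E_def by (metis image_eqI subsetD)
      then show ?thesis using False by (auto simp: S_def)
    qed
    \<comment> \<open>An unpaired element belongs to its block and to \<open>Y\<close>; a pair meets
      two blocks, which are different by \<open>blk\<close>.\<close>
    show "card {v \<in> {..?m}. e \<in> S v} = 2" if e: "e \<in> E" for e
    proof -
      have block: "\<exists>j<?m. x \<in> set (Bs ! j)" if x: "x \<in> set ?Q" for x
      proof -
        obtain A where "A \<in> set Bs" "x \<in> set A" using x by auto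
        then show ?thesis by (metis in_set_conv_nth)
      qed
      have block_unique: "i = j" if "x \<in> set (Bs ! i)" "x \<in> set (Bs ! j)" "i < ?m" "j < ?m" for x i j
        by (rule distinct_concat_block_unique[OF d that])
      obtain j where j: "j < ?m" "e \<in> set (Bs ! j)" using block EQ e by blast
      have mem: "e \<in> S v \<longleftrightarrow> (\<exists>x\<in>set (Bs ! v). r x = e)" if "v < ?m" for v using that by (auto simp: S_def)
      show ?thesis
      proof (cases "e \<in> set ?U")
        case True
        have only: "x = e" if "r x = e" for x
        proof -
          have "e \<notin> Field \<sigma>" using True Uset by blast
          then have "(e, x) \<notin> \<sigma>" unfolding Field_def by blast
          then show ?thesis using r_cases[of x] that by metis
        qed
        have "{v \<in> {..?m}. e \<in> S v} = {j, ?m}"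
        proof (rule set_eqI)
          fix v show "v \<in> {v \<in> {..?m}. e \<in> S v} \<longleftrightarrow> v \<in> {j, ?m}"
          proof (cases "v < ?m")
            case True
            then show ?thesis using mem[OF True] only j rr[OF e] block_unique[of e v j] by auto
          next
            case False
            then show ?thesis using \<open>e \<in> set ?U\<close> j by (auto simp: S_def)
          qed
        qed
        then show ?thesis using j by simp
      next
        case False
        then have "e \<in> Field \<sigma>" using Uset EQ e by blast
        moreover have "e \<notin> snd ` \<sigma>"
        proof
          assume "e \<in> snd ` \<sigma>"
          then obtain s where s: "(s, e) \<in> \<sigma>" by auto
          then show False using r2[OF s] rr[OF e] contractions_irrefl[OF \<sigma> K(1) s] by simp
        qed
        ultimately obtain t where t: "(e, t) \<in> \<sigma>" unfolding Field_def by force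
        obtain k where k: "k < ?m" "t \<in> set (Bs ! k)" using block[OF FQ12(2)[OF t]] by blast
        have "j \<noteq> k" using blk[OF t, of "Bs ! j"] j k by auto
        have only: "x = e \<or> x = t" if "r x = e" for x using r_cases[of x] that uniq'[OF t] by metis
        have "{v \<in> {..?m}. e \<in> S v} = {j, k}"
        proof (rule set_eqI)
          fix v show "v \<in> {v \<in> {..?m}. e \<in> S v} \<longleftrightarrow> v \<in> {j, k}"
          proof (cases "v < ?m")
            case True
            then show ?thesis
              using mem[OF True] only j k rr[OF e] r2[OF t] block_unique[of e v j] block_unique[of t v k] by auto
          next
            case False': False
            then show ?thesis using \<open>e \<notin> set ?U\<close> j k by (auto simp: S_def)
          qed
        qed
        then show ?thesis using \<open>j \<noteq> k\<close> by simp
      qed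
    qed
    show "f v \<alpha> = f v \<beta>" if "v \<in> {..?m}" "\<And>e. e \<in> S v \<Longrightarrow> \<alpha> e = \<beta> e" for v \<alpha> \<beta>
    proof (cases "v < ?m")
      case True
      then have "map (\<lambda>x. \<alpha> (r x)) (Bs ! v) = map (\<lambda>x. \<beta> (r x)) (Bs ! v)"
        using that(2) by (auto simp: S_def)
      then show ?thesis using True by (simp only: f_def if_True)
    next
      case False
      then have "map \<alpha> ?U = map \<beta> ?U" using that(2) by (auto simp: S_def)
      then show ?thesis using False by (simp only: f_def if_False)
    qed
  qed (simp_all add: f_def)
  also have "\<dots> = (\<Prod>v<?m. sqrt (\<Sum>\<alpha>\<in>PiE (S v) (\<lambda>_. B). (f v \<alpha>)\<^sup>2)) *
      sqrt (\<Sum>\<alpha>\<in>PiE (S ?m) (\<lambda>_. B). (f ?m \<alpha>)\<^sup>2)"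
    by (simp add: lessThan_Suc_atMost[symmetric])
  also have "sqrt (\<Sum>\<alpha>\<in>PiE (S ?m) (\<lambda>_. B). (f ?m \<alpha>)\<^sup>2) = fock_norm Y"
    using sum_words_reindex[OF Ud, where h = "\<lambda>a. \<bar>fock_inner Y (tensor a)\<bar>\<^sup>2" and B = B] over
    by (simp add: fock_norm_parseval[OF B _ degY] S_def f_def)
  also have "(\<Prod>v<?m. sqrt (\<Sum>\<alpha>\<in>PiE (S v) (\<lambda>_. B). (f v \<alpha>)\<^sup>2)) = (\<Prod>v<?m. fock_norm (us ! v))"
  proof (rule prod.cong[OF refl])
    fix v assume "v \<in> {..<?m}"
    then have v: "v < ?m" by simp
    \<comment> \<open>No pair lies inside a block, so its positions belong to different edges, and
      the l2 norm of the node is the full Fock norm of its tensor.\<close>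
    have inj: "inj_on r (set (Bs ! v))"
    proof (rule inj_onI)
      fix x y assume xy: "x \<in> set (Bs ! v)" "y \<in> set (Bs ! v)" "r x = r y"
      have "\<not> (a \<in> set (Bs ! v) \<and> b \<in> set (Bs ! v))" if "(a, b) \<in> \<sigma>" for a b
        using blk[OF that nth_mem[OF v]] .
      then show "x = y" using r_cases[of x] r_cases[of y] xy uniq' by metis
    qed
    have "distinct (Bs ! v)" using d v by (simp add: distinct_concat_iff)
    then have dist: "distinct (map r (Bs ! v))" using inj by (simp add: distinct_map)
    have "(\<Sum>\<alpha>\<in>PiE (S v) (\<lambda>_. B). (f v \<alpha>)\<^sup>2) =
        (\<Sum>a\<in>words B (length (Bs ! v)). \<bar>fock_inner (us ! v) (tensor a)\<bar>\<^sup>2)"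
      using sum_words_reindex[OF dist, where h = "\<lambda>a. \<bar>fock_inner (us ! v) (tensor a)\<bar>\<^sup>2" and B = B] v
      by (simp add: S_def f_def comp_def)
    moreover have "us ! v \<in> fock_over B" using over nth_mem[of v us] v len by auto
    ultimately show "sqrt (\<Sum>\<alpha>\<in>PiE (S v) (\<lambda>_. B). (f v \<alpha>)\<^sup>2) = fock_norm (us ! v)"
      using fock_norm_parseval[OF B _ deg[OF v]] by simp
  qed
  also have "\<dots> = (\<Prod>u\<leftarrow>us. fock_norm u)"
    by (simp add: prod.list_conv_set_nth len atLeast0LessThan)
  finally have "(fock_norm Y)\<^sup>2 \<le> (\<Prod>u\<leftarrow>us. fock_norm u) * fock_norm Y"
    using fock_inner_nonneg[OF degY] by (simp add: fock_norm_def)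
  moreover have "0 \<le> (\<Prod>u\<leftarrow>us. fock_norm u)"
  proof (rule prod_list_nonneg)
    fix x assume "x \<in> set (map fock_norm us)"
    then obtain v where "v < ?m" "x = fock_norm (us ! v)" by (auto simp: in_set_conv_nth len)
    then show "0 \<le> x" using fock_norm_nonneg[OF deg] by simp
  qed
  \<comment> \<open>One factor \<open>fock_norm Y\<close> is cancelled; if it is 0, the product on
    the right is still nonnegative.\<close>
  ultimately have "fock_norm Y \<le> (\<Prod>u\<leftarrow>us. fock_norm u)"
    using fock_norm_nonneg[OF degY] by (cases "fock_norm Y = 0") (simp_all add: power2_eq_square)
  then show ?thesis by (simp add: Y_def X_def)
qed

section \<open>Seminormed spaces with explicit carriers and their completions\<close>

text \<open>Definiteness is not demanded, since elements at distance 0 get the same class in the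
  completion. The axioms are the properties of the distance from which completions are built;
  \<open>seminormedI\<close> derives them from an ordinary seminorm.\<close>

locale seminormed =
  fixes V :: "'a nspace"
  assumes vadd_closed: "x \<in> carr V \<Longrightarrow> y \<in> carr V \<Longrightarrow> vadd V x y \<in> carr V"
    and vscale_closed: "x \<in> carr V \<Longrightarrow> vscale V c x \<in> carr V"
    and nrm_nonneg: "x \<in> carr V \<Longrightarrow> 0 \<le> nrm V x"
    and ndist_self: "x \<in> carr V \<Longrightarrow> ndist V x x = 0"
    and ndist_commute: "x \<in> carr V \<Longrightarrow> y \<in> carr V \<Longrightarrow> ndist V x y = ndist V y x"
    and ndist_triangle: "x \<in> carr V \<Longrightarrow> y \<in> carr V \<Longrightarrow> z \<in> carr V \<Longrightarrow> ndist V x z \<le> ndist V x y + ndist V y z"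
    and ndist_vadd: "x \<in> carr V \<Longrightarrow> y \<in> carr V \<Longrightarrow> x' \<in> carr V \<Longrightarrow> y' \<in> carr V \<Longrightarrow>
      ndist V (vadd V x y) (vadd V x' y') \<le> ndist V x x' + ndist V y y'"
    and ndist_vscale: "x \<in> carr V \<Longrightarrow> y \<in> carr V \<Longrightarrow> ndist V (vscale V c x) (vscale V c y) = \<bar>c\<bar> * ndist V x y"
    and nrm_le: "x \<in> carr V \<Longrightarrow> y \<in> carr V \<Longrightarrow> nrm V x \<le> nrm V y + ndist V x y"

text \<open>The map \<open>ev\<close> embeds the carrier linearly into functions with values in a vector space, so
  that the vector space axioms need not be assumed.\<close>

lemma seminormedI:
  fixes V :: "'a nspace" and ev :: "'a \<Rightarrow> 'k \<Rightarrow> 'v::real_vector"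
  assumes add: "\<And>x y. x \<in> carr V \<Longrightarrow> y \<in> carr V \<Longrightarrow> vadd V x y \<in> carr V"
    and scale: "\<And>x c. x \<in> carr V \<Longrightarrow> vscale V c x \<in> carr V"
    and ev_add: "\<And>x y k. x \<in> carr V \<Longrightarrow> y \<in> carr V \<Longrightarrow> ev (vadd V x y) k = ev x k + ev y k"
    and ev_scale: "\<And>x c k. x \<in> carr V \<Longrightarrow> ev (vscale V c x) k = c *\<^sub>R ev x k"
    and ev_inj: "\<And>x y. x \<in> carr V \<Longrightarrow> y \<in> carr V \<Longrightarrow> (\<And>k. ev x k = ev y k) \<Longrightarrow> x = y"
    and nrm_add: "\<And>x y. x \<in> carr V \<Longrightarrow> y \<in> carr V \<Longrightarrow> nrm V (vadd V x y) \<le> nrm V x + nrm V y"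
    and nrm_scale: "\<And>x c. x \<in> carr V \<Longrightarrow> nrm V (vscale V c x) = \<bar>c\<bar> * nrm V x"
  shows "seminormed V"
proof -
  let ?sub = "\<lambda>x y. vadd V x (vscale V (- 1) y)"
  note c = add scale
  note e = ev_add ev_scale
  have self: "?sub x x = vscale V 0 x" if "x \<in> carr V" for x
    by (rule ev_inj) (simp_all add: c e that)
  have self0: "ndist V x x = 0" if "x \<in> carr V" for x
    unfolding ndist_def self[OF that] using nrm_scale[OF that, of 0] by simp
  show ?thesis
  proof
    fix x y z x' y' :: 'a and k :: real
    assume x: "x \<in> carr V"
    show "0 \<le> nrm V x"
      using nrm_add[OF x scale[OF x, of "- 1"]] nrm_scale[OF x, of "- 1"] self0[OF x] by (simp add: ndist_def)
    show "ndist V x x = 0" by (rule self0[OF x])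
    assume y: "y \<in> carr V"
    have "?sub x y = vscale V (- 1) (?sub y x)" by (rule ev_inj) (simp_all add: c e x y)
    then show "ndist V x y = ndist V y x"
      unfolding ndist_def using nrm_scale[of "?sub y x" "- 1"] x y c by simp
    have "?sub (vscale V k x) (vscale V k y) = vscale V k (?sub x y)"
      by (rule ev_inj) (simp_all add: c e x y algebra_simps)
    then show "ndist V (vscale V k x) (vscale V k y) = \<bar>k\<bar> * ndist V x y"
      unfolding ndist_def using nrm_scale[of "?sub x y" k] x y c by simp
    have "x = vadd V y (?sub x y)" by (rule ev_inj) (simp_all add: c e x y)
    then show "nrm V x \<le> nrm V y + ndist V x y"
      unfolding ndist_def using nrm_add[of y "?sub x y"] x y c by simp
    show "ndist V x z \<le> ndist V x y + ndist V y z" if z: "z \<in> carr V"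
    proof -
      have "?sub x z = vadd V (?sub x y) (?sub y z)" by (rule ev_inj) (simp_all add: c e x y z)
      then show ?thesis unfolding ndist_def using nrm_add[of "?sub x y" "?sub y z"] x y z c by simp
    qed
    assume x': "x' \<in> carr V" and y': "y' \<in> carr V"
    have "?sub (vadd V x y) (vadd V x' y') = vadd V (?sub x x') (?sub y y')"
      by (rule ev_inj) (simp_all add: c e x y x' y' algebra_simps)
    then show "ndist V (vadd V x y) (vadd V x' y') \<le> ndist V x x' + ndist V y y'"
      unfolding ndist_def using nrm_add[of "?sub x x'" "?sub y y'"] x y x' y' c by simp
  qed (use c in auto)
qed

lemma tendsto_zero_squeeze:
  fixes f g :: "'a \<Rightarrow> real"
  assumes "(g \<longlongrightarrow> 0) F" "\<And>x. 0 \<le> f x" "\<And>x. f x \<le> g x"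
  shows "(f \<longlongrightarrow> 0) F"
  by (rule tendsto_sandwich[OF _ _ tendsto_const assms(1)]) (simp_all add: assms)

section \<open>Cauchy sequences and the operations of the completion\<close>

context seminormed
begin

abbreviation "null_dist x y \<equiv> (\<lambda>n. ndist V (x n) (y n)) \<longlonglongrightarrow> 0"

lemma ndist_nonneg: "x \<in> carr V \<Longrightarrow> y \<in> carr V \<Longrightarrow> 0 \<le> ndist V x y"
  using vadd_closed vscale_closed nrm_nonneg by (simp add: ndist_def)

lemma cauchy_in_carr: "x \<in> cauchy_in V \<Longrightarrow> x n \<in> carr V"
  by (auto simp: cauchy_in_def)

text \<open>As a limit along a product filter, the Cauchy property of sums and multiples follows
  from the rules for limits.\<close>

lemma cauchy_in_iff:
  "x \<in> cauchy_in V \<longleftrightarrow> (\<forall>n. x n \<in> carr V) \<and>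
    ((\<lambda>p. ndist V (x (fst p)) (x (snd p))) \<longlongrightarrow> 0) (sequentially \<times>\<^sub>F sequentially)"
proof (cases "\<forall>n. x n \<in> carr V")
  case True
  then have "(\<forall>e>0. \<exists>N. \<forall>m\<ge>N. \<forall>n\<ge>N. ndist V (x m) (x n) < e) \<longleftrightarrow>
      ((\<lambda>p. ndist V (x (fst p)) (x (snd p))) \<longlongrightarrow> 0) (sequentially \<times>\<^sub>F sequentially)"
    unfolding tendsto_iff eventually_prod_sequentially fst_conv snd_conv
    using ndist_nonneg by (simp add: dist_real_def) blast
  then show ?thesis using True by (auto simp: cauchy_in_def)
qed (auto simp: cauchy_in_def)

lemma null_dist_self: "x \<in> cauchy_in V \<Longrightarrow> null_dist x x"
  using ndist_self[OF cauchy_in_carr] by simp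

lemma null_dist_commute:
  assumes "\<And>n. x n \<in> carr V" "\<And>n. y n \<in> carr V" "null_dist x y"
  shows "null_dist y x"
  using assms(3) ndist_commute[OF assms(1,2)] by simp

lemma null_dist_trans:
  assumes "\<And>n. x n \<in> carr V" "\<And>n. y n \<in> carr V" "\<And>n. z n \<in> carr V" "null_dist x y" "null_dist y z"
  shows "null_dist x z"
proof (rule tendsto_sandwich[OF _ _ tendsto_const])
  show "\<forall>\<^sub>F n in sequentially. 0 \<le> ndist V (x n) (z n)" using ndist_nonneg assms(1,3) by simp
  show "\<forall>\<^sub>F n in sequentially. ndist V (x n) (z n) \<le> ndist V (x n) (y n) + ndist V (y n) (z n)"
    using ndist_triangle assms(1-3) by simp
  show "(\<lambda>n. ndist V (x n) (y n) + ndist V (y n) (z n)) \<longlonglongrightarrow> 0"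
    using tendsto_add[OF assms(4,5)] by simp
qed

lemma cauchy_class_eq_iff:
  assumes x: "x \<in> cauchy_in V" and y: "y \<in> cauchy_in V"
  shows "cauchy_class V x = cauchy_class V y \<longleftrightarrow> null_dist x y"
proof
  assume "cauchy_class V x = cauchy_class V y"
  moreover have "y \<in> cauchy_class V y" using y null_dist_self by (simp add: cauchy_class_def)
  ultimately show "null_dist x y" by (auto simp: cauchy_class_def)
next
  assume n: "null_dist x y"
  note c = cauchy_in_carr
  have n': "null_dist y x" by (rule null_dist_commute[OF c[OF x] c[OF y] n])
  have "null_dist x z \<longleftrightarrow> null_dist y z" if z: "z \<in> cauchy_in V" for z
    using null_dist_trans[of y x z] null_dist_trans[of x y z] n n' c[OF x] c[OF y] c[OF z] by blast
  then show "cauchy_class V x = cauchy_class V y" by (auto simp: cauchy_class_def)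
qed

text \<open>The operations of the completion are defined on chosen representatives; this is what
  allows any other sequence of the class to be used instead.\<close>

lemma representative_class:
  assumes x: "x \<in> cauchy_in V"
  shows "representative (cauchy_class V x) \<in> cauchy_in V"
    and "null_dist x (representative (cauchy_class V x))"
proof -
  have "x \<in> cauchy_class V x" using x null_dist_self by (simp add: cauchy_class_def)
  then have "representative (cauchy_class V x) \<in> cauchy_class V x"
    unfolding representative_def by (rule someI[of "\<lambda>y. y \<in> cauchy_class V x"])
  then show "representative (cauchy_class V x) \<in> cauchy_in V"
    and "null_dist x (representative (cauchy_class V x))"
    by (auto simp: cauchy_class_def)
qed

lemma carr_completion: "carr (banach_completion V) = cauchy_class V ` cauchy_in V"
  by (simp add: banach_completion_def)

lemma representative_cauchy: "X \<in> carr (banach_completion V) \<Longrightarrow> representative X \<in> cauchy_in V"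
  by (auto simp: carr_completion intro: representative_class)

lemma representative_carr: "X \<in> carr (banach_completion V) \<Longrightarrow> representative X n \<in> carr V"
  using representative_cauchy cauchy_in_carr by blast

lemma class_representative:
  assumes "X \<in> carr (banach_completion V)"
  shows "cauchy_class V (representative X) = X"
proof -
  obtain x where x: "x \<in> cauchy_in V" "X = cauchy_class V x" using assms by (auto simp: carr_completion)
  then have "cauchy_class V x = cauchy_class V (representative X)"
    using cauchy_class_eq_iff[OF x(1)] representative_class[OF x(1)] by simp
  then show ?thesis using x by simp
qed

lemma const_cauchy: "v \<in> carr V \<Longrightarrow> (\<lambda>_. v) \<in> cauchy_in V"
  using ndist_self by (auto simp: cauchy_in_def)

lemma vadd_cauchy:
  assumes x: "x \<in> cauchy_in V" and y: "y \<in> cauchy_in V"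
  shows "(\<lambda>n. vadd V (x n) (y n)) \<in> cauchy_in V"
proof -
  note c = cauchy_in_carr[OF x] cauchy_in_carr[OF y]
  have "((\<lambda>p. ndist V (x (fst p)) (x (snd p)) + ndist V (y (fst p)) (y (snd p))) \<longlongrightarrow> 0 + 0) (sequentially \<times>\<^sub>F sequentially)"
    using x y unfolding cauchy_in_iff by (intro tendsto_add) auto
  then have "((\<lambda>p. ndist V (vadd V (x (fst p)) (y (fst p))) (vadd V (x (snd p)) (y (snd p)))) \<longlongrightarrow> 0) (sequentially \<times>\<^sub>F sequentially)"
    unfolding add_0 by (rule tendsto_zero_squeeze) (intro ndist_nonneg vadd_closed ndist_vadd c)+
  then show ?thesis using c vadd_closed by (simp add: cauchy_in_iff)
qed

lemma vscale_cauchy: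
  assumes x: "x \<in> cauchy_in V"
  shows "(\<lambda>n. vscale V k (x n)) \<in> cauchy_in V"
proof -
  note c = cauchy_in_carr[OF x]
  have "((\<lambda>p. \<bar>k\<bar> * ndist V (x (fst p)) (x (snd p))) \<longlongrightarrow> \<bar>k\<bar> * 0) (sequentially \<times>\<^sub>F sequentially)"
    using x unfolding cauchy_in_iff by (intro tendsto_mult_left) auto
  then show ?thesis using c vscale_closed by (simp add: cauchy_in_iff ndist_vscale)
qed

lemma vadd_class:
  assumes x: "x \<in> cauchy_in V" and y: "y \<in> cauchy_in V"
  shows "vadd (banach_completion V) (cauchy_class V x) (cauchy_class V y) = cauchy_class V (\<lambda>n. vadd V (x n) (y n))"
proof -
  let ?x = "representative (cauchy_class V x)" and ?y = "representative (cauchy_class V y)"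
  have x': "?x \<in> cauchy_in V" "null_dist x ?x" and y': "?y \<in> cauchy_in V" "null_dist y ?y"
    using representative_class x y by auto
  note c = cauchy_in_carr[OF x] cauchy_in_carr[OF y] cauchy_in_carr[OF x'(1)] cauchy_in_carr[OF y'(1)]
  have "null_dist (\<lambda>n. vadd V (x n) (y n)) (\<lambda>n. vadd V (?x n) (?y n))"
    by (rule tendsto_sandwich[OF _ _ tendsto_const tendsto_add_zero[OF x'(2) y'(2)]])
       (use c ndist_nonneg vadd_closed ndist_vadd in auto)
  then show ?thesis
    using cauchy_class_eq_iff[OF vadd_cauchy[OF x y] vadd_cauchy[OF x'(1) y'(1)]] by (simp add: banach_completion_def)
qed

lemma vscale_class:
  assumes x: "x \<in> cauchy_in V"
  shows "vscale (banach_completion V) k (cauchy_class V x) = cauchy_class V (\<lambda>n. vscale V k (x n))"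
proof -
  let ?x = "representative (cauchy_class V x)"
  have x': "?x \<in> cauchy_in V" "null_dist x ?x" using representative_class x by auto
  note c = cauchy_in_carr[OF x] cauchy_in_carr[OF x'(1)]
  have "null_dist (\<lambda>n. vscale V k (x n)) (\<lambda>n. vscale V k (?x n))"
    using tendsto_mult_right_zero[OF x'(2), of "\<bar>k\<bar>"] c by (simp add: ndist_vscale)
  then show ?thesis
    using cauchy_class_eq_iff[OF vscale_cauchy[OF x, of k] vscale_cauchy[OF x'(1), of k]] by (simp add: banach_completion_def)
qed

lemma completion_closed:
  assumes "X \<in> carr (banach_completion V)"
  shows "Y \<in> carr (banach_completion V) \<Longrightarrow> vadd (banach_completion V) X Y \<in> carr (banach_completion V)"
    and "vscale (banach_completion V) k X \<in> carr (banach_completion V)"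
  using assms by (auto simp: carr_completion vadd_class vscale_class vadd_cauchy vscale_cauchy)

lemma nrm_diff: "x \<in> carr V \<Longrightarrow> y \<in> carr V \<Longrightarrow> \<bar>nrm V x - nrm V y\<bar> \<le> ndist V x y"
  using nrm_le[of x y] nrm_le[of y x] ndist_commute[of x y] by simp

lemma nrm_null_dist:
  assumes "\<And>n. x n \<in> carr V" "\<And>n. y n \<in> carr V" "null_dist x y"
  shows "(\<lambda>n. nrm V (x n) - nrm V (y n)) \<longlonglongrightarrow> 0"
  by (rule tendsto_rabs_zero_cancel, rule tendsto_sandwich[OF _ _ tendsto_const assms(3)])
     (use nrm_diff assms(1,2) in auto)

lemma nrm_class:
  assumes x: "x \<in> cauchy_in V"
  shows "(\<lambda>n. nrm V (x n)) \<longlonglongrightarrow> nrm (banach_completion V) (cauchy_class V x)"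
proof -
  let ?x = "representative (cauchy_class V x)"
  have x': "?x \<in> cauchy_in V" "null_dist x ?x" using representative_class x by auto
  have "Cauchy (\<lambda>n. nrm V (?x n))"
  proof (rule metric_CauchyI)
    fix e :: real assume "0 < e"
    then obtain N where "\<forall>m\<ge>N. \<forall>n\<ge>N. ndist V (?x m) (?x n) < e" using x'(1) by (auto simp: cauchy_in_def)
    then show "\<exists>N. \<forall>m\<ge>N. \<forall>n\<ge>N. dist (nrm V (?x m)) (nrm V (?x n)) < e"
      using nrm_diff[OF cauchy_in_carr[OF x'(1)] cauchy_in_carr[OF x'(1)]]
      unfolding dist_real_def by (meson le_less_trans)
  qed
  then have "(\<lambda>n. nrm V (?x n)) \<longlonglongrightarrow> nrm (banach_completion V) (cauchy_class V x)"
    by (simp add: banach_completion_def Cauchy_convergent_iff convergent_LIMSEQ_iff)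
  from tendsto_add[OF nrm_null_dist[OF cauchy_in_carr[OF x] cauchy_in_carr[OF x'(1)] x'(2)] this]
  show ?thesis by simp
qed

lemma nrm_completion_nonneg: "X \<in> carr (banach_completion V) \<Longrightarrow> 0 \<le> nrm (banach_completion V) X"
  unfolding carr_completion by (erule imageE) (simp add: LIMSEQ_le_const[OF nrm_class] nrm_nonneg[OF cauchy_in_carr])

lemma const_class_carr: "v \<in> carr V \<Longrightarrow> const_class V v \<in> carr (banach_completion V)"
  by (simp add: const_class_def carr_completion const_cauchy)

end

section \<open>Bounded linear and multilinear maps\<close>

text \<open>The domain has an explicit carrier, but the values lie in a normed type, so that limits
  and closed sets of the target are topological notions of that type.\<close>

definition blin :: "'a nspace \<Rightarrow> ('a \<Rightarrow> 'b::real_normed_vector) \<Rightarrow> real \<Rightarrow> bool" where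
  "blin V T B \<longleftrightarrow>
    (\<forall>x\<in>carr V. \<forall>y\<in>carr V. T (vadd V x y) = T x + T y) \<and>
    (\<forall>x\<in>carr V. \<forall>c. T (vscale V c x) = c *\<^sub>R T x) \<and>
    (\<forall>x\<in>carr V. norm (T x) \<le> B * nrm V x)"

definition cext :: "('a \<Rightarrow> 'b::banach) \<Rightarrow> (nat \<Rightarrow> 'a) set \<Rightarrow> 'b" where
  "cext T X = lim (\<lambda>k. T (representative X k))"

definition mult_on :: "('a, 'm) vspace_scheme list \<Rightarrow> ('a list \<Rightarrow> 'b::real_vector) \<Rightarrow> bool" where
  "mult_on Es \<Phi> \<longleftrightarrow> (\<forall>xs\<in>tuples Es. \<forall>i<length Es. \<forall>x\<in>carr (Es ! i). \<forall>y\<in>carr (Es ! i). \<forall>c.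
     \<Phi> (xs[i := vadd (Es ! i) x y]) = \<Phi> (xs[i := x]) + \<Phi> (xs[i := y]) \<and>
     \<Phi> (xs[i := vscale (Es ! i) c x]) = c *\<^sub>R \<Phi> (xs[i := x]))"

definition mbounded :: "'a nspace list \<Rightarrow> ('a list \<Rightarrow> 'b::real_normed_vector) \<Rightarrow> real \<Rightarrow> bool" where
  "mbounded Es \<Phi> B \<longleftrightarrow> (\<forall>xs\<in>tuples Es. norm (\<Phi> xs) \<le> B * (\<Prod>i<length Es. nrm (Es ! i) (xs ! i)))"

text \<open>Extension by continuity in all entries at once, along the diagonal: a single index
  \<open>k\<close> is used for the representatives of all entries.\<close>

definition mext :: "('a list \<Rightarrow> 'b::banach) \<Rightarrow> (nat \<Rightarrow> 'a) set list \<Rightarrow> 'b" where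
  "mext \<Phi> Xs = lim (\<lambda>k. \<Phi> (map (\<lambda>X. representative X k) Xs))"

lemma tuples_iff: "xs \<in> tuples Es \<longleftrightarrow> length xs = length Es \<and> (\<forall>i<length Es. xs ! i \<in> carr (Es ! i))"
  by (auto simp: tuples_def list_all2_conv_all_nth)

lemma tuples_update: "xs \<in> tuples Es \<Longrightarrow> x \<in> carr (Es ! i) \<Longrightarrow> xs[i := x] \<in> tuples Es"
  by (cases "i < length xs") (auto simp: tuples_iff nth_list_update)

text \<open>Replacing the entries of \<open>us\<close> by those of \<open>vs\<close> one at a time.\<close>

lemma mult_on_dist:
  fixes \<Phi> :: "'a list \<Rightarrow> 'b::real_normed_vector"
  assumes Es: "\<And>E. E \<in> set Es \<Longrightarrow> seminormed E" and m: "mult_on Es \<Phi>" "mbounded Es \<Phi> B" "0 \<le> B"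
    and us: "us \<in> tuples Es" and vs: "vs \<in> tuples Es" and M: "1 \<le> M"
    and uM: "\<And>i. i < length Es \<Longrightarrow> nrm (Es ! i) (us ! i) \<le> M"
    and vM: "\<And>i. i < length Es \<Longrightarrow> nrm (Es ! i) (vs ! i) \<le> M"
  shows "norm (\<Phi> us - \<Phi> vs) \<le> (\<Sum>p<length Es. B * M ^ length Es * ndist (Es ! p) (us ! p) (vs ! p))"
proof -
  let ?n = "length Es"
  let ?h = "\<lambda>p. take p vs @ drop p us"
  have len: "length us = ?n" "length vs = ?n" using us vs by (auto simp: tuples_iff)
  have nthh: "?h p ! i = (if i < p then vs ! i else us ! i)" if "i < ?n" "p \<le> ?n" for i p
    using that len by (auto simp: nth_append)
  have h: "?h p \<in> tuples Es" if "p \<le> ?n" for p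
    using us vs that len unfolding tuples_iff by (auto simp: nth_append)
  have step: "norm (\<Phi> (?h p) - \<Phi> (?h (Suc p))) \<le> B * M ^ ?n * ndist (Es ! p) (us ! p) (vs ! p)" if p: "p < ?n" for p
  proof -
    interpret E: seminormed "Es ! p" using Es p by simp
    let ?E = "Es ! p" and ?w = "vadd (Es ! p) (us ! p) (vscale (Es ! p) (- 1) (vs ! p))"
    have c: "us ! p \<in> carr ?E" "vs ! p \<in> carr ?E" using us vs p by (auto simp: tuples_iff)
    have w: "?w \<in> carr ?E" using c by (intro E.vadd_closed E.vscale_closed)
    have "?h (Suc p) = (?h p)[p := vs ! p]" "?h p = (?h p)[p := us ! p]"
      using p len by (auto intro!: nth_equalityI simp: nth_list_update nth_append)
    then have "\<Phi> (?h p) - \<Phi> (?h (Suc p)) = \<Phi> ((?h p)[p := us ! p]) - \<Phi> ((?h p)[p := vs ! p])" by metis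
    also have "\<dots> = \<Phi> ((?h p)[p := us ! p]) + \<Phi> ((?h p)[p := vscale ?E (- 1) (vs ! p)])"
      using m(1)[unfolded mult_on_def, rule_format, OF h p c(2) c(2), of p "- 1"] p by simp
    also have "\<dots> = \<Phi> ((?h p)[p := ?w])"
      using m(1)[unfolded mult_on_def, rule_format, OF h p c(1) E.vscale_closed[OF c(2), of "- 1"], of p] p by simp
    finally have "norm (\<Phi> (?h p) - \<Phi> (?h (Suc p))) \<le> B * (\<Prod>i<?n. nrm (Es ! i) ((?h p)[p := ?w] ! i))"
      using m(2)[unfolded mbounded_def, rule_format, OF tuples_update[OF h w]] p by simp
    also have "(\<Prod>i<?n. nrm (Es ! i) ((?h p)[p := ?w] ! i)) = nrm ?E ?w * (\<Prod>i\<in>{..<?n} - {p}. nrm (Es ! i) (?h p ! i))"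
      using p len by (subst prod.remove[of _ p]) (auto intro!: prod.cong)
    finally have 1: "norm (\<Phi> (?h p) - \<Phi> (?h (Suc p))) \<le>
        B * (nrm ?E ?w * (\<Prod>i\<in>{..<?n} - {p}. nrm (Es ! i) (?h p ! i)))" .
    have "(\<Prod>i\<in>{..<?n} - {p}. nrm (Es ! i) (?h p ! i)) \<le> (\<Prod>i\<in>{..<?n} - {p}. M)"
    proof (intro prod_mono conjI)
      fix i assume i: "i \<in> {..<?n} - {p}"
      interpret Ei: seminormed "Es ! i" using Es i by simp
      show "0 \<le> nrm (Es ! i) (?h p ! i)" using h[of p] i p by (intro Ei.nrm_nonneg) (auto simp: tuples_iff)
      show "nrm (Es ! i) (?h p ! i) \<le> M" using nthh[of i p] i p uM vM by simp
    qed
    also have "\<dots> \<le> M ^ ?n"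
      using power_increasing[OF _ M, of "card ({..<?n} - {p})" ?n] p by simp
    finally have "B * (nrm ?E ?w * (\<Prod>i\<in>{..<?n} - {p}. nrm (Es ! i) (?h p ! i))) \<le> B * (nrm ?E ?w * M ^ ?n)"
      by (intro mult_left_mono E.nrm_nonneg w m(3))
    with 1 show ?thesis by (simp add: ndist_def mult_ac)
  qed
  have "\<Phi> us - \<Phi> vs = (\<Sum>p<?n. \<Phi> (?h p) - \<Phi> (?h (Suc p)))"
    using sum_lessThan_telescope'[of "\<lambda>p. \<Phi> (?h p)" ?n] len by simp
  also have "norm \<dots> \<le> (\<Sum>p<?n. B * M ^ ?n * ndist (Es ! p) (us ! p) (vs ! p))"
    by (rule order.trans[OF norm_sum sum_mono]) (use step in auto)
  finally show ?thesis .
qed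

lemma mult_on_tendsto_zero:
  fixes \<Phi> :: "'a list \<Rightarrow> 'b::real_normed_vector"
  assumes Es: "\<And>E. E \<in> set Es \<Longrightarrow> seminormed E" and m: "mult_on Es \<Phi>" "mbounded Es \<Phi> B" "0 \<le> B"
    and t: "\<And>i. us i \<in> tuples Es" "\<And>i. vs i \<in> tuples Es" and M: "1 \<le> M"
    and b: "\<And>i p. p < length Es \<Longrightarrow> nrm (Es ! p) (us i ! p) \<le> M"
      "\<And>i p. p < length Es \<Longrightarrow> nrm (Es ! p) (vs i ! p) \<le> M"
    and d: "\<And>p. p < length Es \<Longrightarrow> ((\<lambda>i. ndist (Es ! p) (us i ! p) (vs i ! p)) \<longlongrightarrow> 0) F"
  shows "((\<lambda>i. \<Phi> (us i) - \<Phi> (vs i)) \<longlongrightarrow> 0) F"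
proof (rule Lim_null_comparison)
  show "\<forall>\<^sub>F i in F. norm (\<Phi> (us i) - \<Phi> (vs i)) \<le>
      (\<Sum>p<length Es. B * M ^ length Es * ndist (Es ! p) (us i ! p) (vs i ! p))"
    using mult_on_dist[OF Es m t M b] by (intro always_eventually) blast
  show "((\<lambda>i. \<Sum>p<length Es. B * M ^ length Es * ndist (Es ! p) (us i ! p) (vs i ! p)) \<longlongrightarrow> 0) F"
    by (rule tendsto_null_sum) (rule tendsto_mult_right_zero, use d in simp)
qed

abbreviation at_index :: "(nat \<Rightarrow> 'a) list \<Rightarrow> nat \<Rightarrow> 'a list" where
  "at_index ss k \<equiv> map (\<lambda>s. s k) ss"

definition cauchy_tuple :: "'a nspace list \<Rightarrow> (nat \<Rightarrow> 'a) list \<Rightarrow> bool" where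
  "cauchy_tuple Es ss \<longleftrightarrow> length ss = length Es \<and> (\<forall>i<length Es. ss ! i \<in> cauchy_in (Es ! i))"

lemma cauchy_tuple_at:
  assumes "\<And>E. E \<in> set Es \<Longrightarrow> seminormed E" "cauchy_tuple Es ss"
  shows "at_index ss k \<in> tuples Es"
  unfolding tuples_iff
proof (intro conjI allI impI)
  show "length (at_index ss k) = length Es" using assms(2) by (simp add: cauchy_tuple_def)
  fix i assume i: "i < length Es"
  interpret E: seminormed "Es ! i" using assms(1) i by simp
  show "at_index ss k ! i \<in> carr (Es ! i)"
    using E.cauchy_in_carr[of "ss ! i" k] assms(2) i by (simp add: cauchy_tuple_def)
qed

lemma cauchy_tuple_bounded:
  assumes Es: "\<And>E. E \<in> set Es \<Longrightarrow> seminormed E" and ss: "cauchy_tuple Es ss"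
  shows "\<exists>M\<ge>1. \<forall>k. \<forall>p<length Es. nrm (Es ! p) (at_index ss k ! p) \<le> M"
proof -
  have "\<exists>M. \<forall>k. nrm (Es ! p) (at_index ss k ! p) \<le> M" if p: "p < length Es" for p
  proof -
    interpret E: seminormed "Es ! p" using Es p by simp
    have s: "ss ! p \<in> cauchy_in (Es ! p)" using ss p by (simp add: cauchy_tuple_def)
    have "Bseq (\<lambda>k. nrm (Es ! p) ((ss ! p) k))"
      using E.nrm_class[OF s] by (intro convergent_imp_Bseq) (auto simp: convergent_def)
    then obtain M where "\<And>k. norm (nrm (Es ! p) ((ss ! p) k)) \<le> M" by (auto simp: Bseq_def)
    then have "nrm (Es ! p) (at_index ss k ! p) \<le> M" for k
      using ss p by (auto simp: cauchy_tuple_def abs_le_iff)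
    then show ?thesis by blast
  qed
  then obtain M where M: "\<And>p k. p < length Es \<Longrightarrow> nrm (Es ! p) (at_index ss k ! p) \<le> M p" by metis
  \<comment> \<open>A common bound that also makes sense for the empty list and is at least 1, as
    \<open>mult_on_dist\<close> requires.\<close>
  have "M p \<le> 1 + (\<Sum>p<length Es. \<bar>M p\<bar>)" if p: "p < length Es" for p
    using member_le_sum[of p "{..<length Es}" "\<lambda>p. \<bar>M p\<bar>"] p by simp
  then have "\<forall>k. \<forall>p<length Es. nrm (Es ! p) (at_index ss k ! p) \<le> 1 + (\<Sum>p<length Es. \<bar>M p\<bar>)"
    using M order.trans by blast
  moreover have "1 \<le> 1 + (\<Sum>p<length Es. \<bar>M p\<bar>)" by (simp add: sum_nonneg)
  ultimately show ?thesis by blast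
qed

text \<open>The filter and the two reindexings are left open to serve two purposes: with
  \<open>fst\<close> and \<open>snd\<close> on a product filter this is the Cauchy property, with
  the identity on \<open>sequentially\<close> it is independence of the representing
  sequences.\<close>

lemma mult_on_null:
  fixes \<Phi> :: "'a list \<Rightarrow> 'b::real_normed_vector"
  assumes Es: "\<And>E. E \<in> set Es \<Longrightarrow> seminormed E" and m: "mult_on Es \<Phi>" "mbounded Es \<Phi> B" "0 \<le> B"
    and ss: "cauchy_tuple Es ss" and tt: "cauchy_tuple Es tt"
    and d: "\<And>p. p < length Es \<Longrightarrow> ((\<lambda>i. ndist (Es ! p) ((ss ! p) (f i)) ((tt ! p) (g i))) \<longlongrightarrow> 0) F"
  shows "((\<lambda>i. \<Phi> (at_index ss (f i)) - \<Phi> (at_index tt (g i))) \<longlongrightarrow> 0) F"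
proof -
  obtain M M' where "1 \<le> M" "1 \<le> M'"
    and MM: "\<And>k p. p < length Es \<Longrightarrow> nrm (Es ! p) (at_index ss k ! p) \<le> M"
      "\<And>k p. p < length Es \<Longrightarrow> nrm (Es ! p) (at_index tt k ! p) \<le> M'"
    using cauchy_tuple_bounded[OF Es ss] cauchy_tuple_bounded[OF Es tt] by blast
  show ?thesis
  proof (rule mult_on_tendsto_zero[OF Es m, where M = "max M M'"])
    show "nrm (Es ! p) (at_index ss (f i) ! p) \<le> max M M'" "nrm (Es ! p) (at_index tt (g i) ! p) \<le> max M M'"
      if "p < length Es" for i p using MM(1)[OF that, of "f i"] MM(2)[OF that, of "g i"] by auto
    show "((\<lambda>i. ndist (Es ! p) (at_index ss (f i) ! p) (at_index tt (g i) ! p)) \<longlongrightarrow> 0) F"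
      if "p < length Es" for p using d[OF that] ss tt that by (simp add: cauchy_tuple_def)
  qed (use cauchy_tuple_at[OF Es] ss tt \<open>1 \<le> M\<close> in auto)
qed

lemma mult_on_Cauchy:
  fixes \<Phi> :: "'a list \<Rightarrow> 'b::real_normed_vector"
  assumes Es: "\<And>E. E \<in> set Es \<Longrightarrow> seminormed E" and m: "mult_on Es \<Phi>" "mbounded Es \<Phi> B" "0 \<le> B"
    and ss: "cauchy_tuple Es ss"
  shows "Cauchy (\<lambda>k. \<Phi> (at_index ss k))"
proof (rule metric_CauchyI)
  fix e :: real assume e: "0 < e"
  have "((\<lambda>i. \<Phi> (at_index ss (fst i)) - \<Phi> (at_index ss (snd i))) \<longlongrightarrow> 0) (sequentially \<times>\<^sub>F sequentially)"
  proof (rule mult_on_null[OF Es m ss ss])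
    fix p assume p: "p < length Es"
    interpret E: seminormed "Es ! p" using Es p by simp
    show "((\<lambda>i. ndist (Es ! p) ((ss ! p) (fst i)) ((ss ! p) (snd i))) \<longlongrightarrow> 0) (sequentially \<times>\<^sub>F sequentially)"
    proof -
      have "ss ! p \<in> cauchy_in (Es ! p)" using ss p by (simp add: cauchy_tuple_def)
      then show ?thesis unfolding E.cauchy_in_iff by blast
    qed
  qed
  from tendstoD[OF this e] show "\<exists>N. \<forall>m\<ge>N. \<forall>n\<ge>N. dist (\<Phi> (at_index ss m)) (\<Phi> (at_index ss n)) < e"
    unfolding eventually_prod_sequentially by (auto simp: dist_norm)
qed

text \<open>The values along two representing tuples differ by a null sequence, so later limits can
  be taken along whichever representatives are convenient.\<close>

lemma mext_tendsto:
  fixes \<Phi> :: "'a list \<Rightarrow> 'b::banach"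
  assumes Es: "\<And>E. E \<in> set Es \<Longrightarrow> seminormed E" and m: "mult_on Es \<Phi>" "mbounded Es \<Phi> B" "0 \<le> B"
    and ss: "cauchy_tuple Es ss" and Xs: "length Xs = length Es"
      "\<And>i. i < length Es \<Longrightarrow> Xs ! i = cauchy_class (Es ! i) (ss ! i)"
  shows "(\<lambda>k. \<Phi> (at_index ss k)) \<longlonglongrightarrow> mext \<Phi> Xs"
proof -
  let ?r = "map representative Xs"
  have r: "?r ! i \<in> cauchy_in (Es ! i)" "(\<lambda>k. ndist (Es ! i) ((ss ! i) k) ((?r ! i) k)) \<longlonglongrightarrow> 0" if i: "i < length Es" for i
  proof -
    interpret E: seminormed "Es ! i" using Es i by simp
    have "ss ! i \<in> cauchy_in (Es ! i)" using ss i by (simp add: cauchy_tuple_def)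
    from E.representative_class[OF this] show "?r ! i \<in> cauchy_in (Es ! i)" "(\<lambda>k. ndist (Es ! i) ((ss ! i) k) ((?r ! i) k)) \<longlonglongrightarrow> 0"
      using i Xs by simp_all
  qed
  have rc: "cauchy_tuple Es ?r" using r Xs by (simp add: cauchy_tuple_def)
  have "(\<lambda>k. \<Phi> (at_index ?r k)) \<longlonglongrightarrow> mext \<Phi> Xs"
    using mult_on_Cauchy[OF Es m rc] by (simp add: mext_def comp_def Cauchy_convergent_iff convergent_LIMSEQ_iff)
  moreover have "(\<lambda>k. \<Phi> (at_index ss k) - \<Phi> (at_index ?r k)) \<longlonglongrightarrow> 0"
    using mult_on_null[OF Es m ss rc, of "\<lambda>k. k" "\<lambda>k. k"] r(2) by blast
  ultimately show ?thesis using tendsto_add by fastforce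
qed

lemma tuples_completion:
  assumes Es: "\<And>E. E \<in> set Es \<Longrightarrow> seminormed E" and Xs: "Xs \<in> tuples (map banach_completion Es)"
  shows "cauchy_tuple Es (map representative Xs)" "length Xs = length Es"
    and "\<And>i. i < length Es \<Longrightarrow> Xs ! i = cauchy_class (Es ! i) (map representative Xs ! i)"
proof -
  show len: "length Xs = length Es" using Xs by (simp add: tuples_iff)
  have X: "map representative Xs ! i \<in> cauchy_in (Es ! i)" "Xs ! i = cauchy_class (Es ! i) (map representative Xs ! i)"
    if i: "i < length Es" for i
  proof -
    interpret E: seminormed "Es ! i" using Es i by simp
    have "Xs ! i \<in> carr (banach_completion (Es ! i))" using Xs i by (simp add: tuples_iff)
    from E.representative_cauchy[OF this] E.class_representative[OF this]
    show "map representative Xs ! i \<in> cauchy_in (Es ! i)" "Xs ! i = cauchy_class (Es ! i) (map representative Xs ! i)"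
      using i len by simp_all
  qed
  show "cauchy_tuple Es (map representative Xs)" using X(1) len by (simp add: cauchy_tuple_def)
  show "\<And>i. i < length Es \<Longrightarrow> Xs ! i = cauchy_class (Es ! i) (map representative Xs ! i)" by (rule X(2))
qed

lemma cauchy_tuple_update:
  "cauchy_tuple Es ss \<Longrightarrow> s \<in> cauchy_in (Es ! i) \<Longrightarrow> cauchy_tuple Es (ss[i := s])"
  by (cases "i < length ss") (auto simp: cauchy_tuple_def nth_list_update)

lemma mext_mult_on:
  fixes \<Phi> :: "'a list \<Rightarrow> 'b::banach"
  assumes Es: "\<And>E. E \<in> set Es \<Longrightarrow> seminormed E" and m: "mult_on Es \<Phi>" "mbounded Es \<Phi> B" "0 \<le> B"
  shows "mult_on (map banach_completion Es) (mext \<Phi>)"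
  unfolding mult_on_def length_map
proof (intro ballI allI impI)
  fix Xs i X Y and c :: real
  assume Xs: "Xs \<in> tuples (map banach_completion Es)" and i: "i < length Es"
    and X: "X \<in> carr (map banach_completion Es ! i)" and Y: "Y \<in> carr (map banach_completion Es ! i)"
  interpret E: seminormed "Es ! i" using Es i by simp
  have X': "X \<in> carr (banach_completion (Es ! i))" and Y': "Y \<in> carr (banach_completion (Es ! i))"
    using X Y i by simp_all
  let ?r = "map representative Xs"
  note t = tuples_completion[OF Es Xs]
  have at: "at_index (?r[i := s]) k = (at_index ?r k)[i := s k]" for s k by (simp add: map_update)
  have lim: "(\<lambda>k. \<Phi> ((at_index ?r k)[i := s k])) \<longlonglongrightarrow> mext \<Phi> (Xs[i := Z])"
    if s: "s \<in> cauchy_in (Es ! i)" "Z = cauchy_class (Es ! i) s" for s Z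
    using mext_tendsto[OF Es m cauchy_tuple_update[OF t(1) s(1)], of "Xs[i := Z]"] t s i
    unfolding at by (auto simp: nth_list_update)
  note rX = E.representative_cauchy[OF X'] E.class_representative[OF X', symmetric]
  note rY = E.representative_cauchy[OF Y'] E.class_representative[OF Y', symmetric]
  note mu = m(1)[unfolded mult_on_def, rule_format, OF cauchy_tuple_at[OF Es t(1)] i
      E.cauchy_in_carr[OF rX(1)] E.cauchy_in_carr[OF rY(1)]]
  show "mext \<Phi> (Xs[i := vadd (map banach_completion Es ! i) X Y]) = mext \<Phi> (Xs[i := X]) + mext \<Phi> (Xs[i := Y]) \<and>
      mext \<Phi> (Xs[i := vscale (map banach_completion Es ! i) c X]) = c *\<^sub>R mext \<Phi> (Xs[i := X])"
  proof
    have "vadd (banach_completion (Es ! i)) X Y =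
        cauchy_class (Es ! i) (\<lambda>k. vadd (Es ! i) (representative X k) (representative Y k))"
      using E.vadd_class[OF rX(1) rY(1)] rX(2) rY(2) by simp
    from lim[OF E.vadd_cauchy[OF rX(1) rY(1)] this]
    have "(\<lambda>k. \<Phi> ((at_index ?r k)[i := representative X k]) + \<Phi> ((at_index ?r k)[i := representative Y k])) \<longlonglongrightarrow>
        mext \<Phi> (Xs[i := vadd (banach_completion (Es ! i)) X Y])"
      by (subst (asm) mu[THEN conjunct1])
    from LIMSEQ_unique[OF this tendsto_add[OF lim[OF rX] lim[OF rY]]]
    show "mext \<Phi> (Xs[i := vadd (map banach_completion Es ! i) X Y]) = mext \<Phi> (Xs[i := X]) + mext \<Phi> (Xs[i := Y])"
      using i by simp
    have "vscale (banach_completion (Es ! i)) c X =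
        cauchy_class (Es ! i) (\<lambda>k. vscale (Es ! i) c (representative X k))"
      using E.vscale_class[OF rX(1)] rX(2) by simp
    from lim[OF E.vscale_cauchy[OF rX(1)] this]
    have "(\<lambda>k. c *\<^sub>R \<Phi> ((at_index ?r k)[i := representative X k])) \<longlonglongrightarrow>
        mext \<Phi> (Xs[i := vscale (banach_completion (Es ! i)) c X])"
      by (subst (asm) mu[THEN conjunct2])
    from LIMSEQ_unique[OF this tendsto_scaleR[OF tendsto_const lim[OF rX]]]
    show "mext \<Phi> (Xs[i := vscale (map banach_completion Es ! i) c X]) = c *\<^sub>R mext \<Phi> (Xs[i := X])"
      using i by simp
  qed
qed

lemma nrm_prod_tendsto:
  assumes Es: "\<And>E. E \<in> set Es \<Longrightarrow> seminormed E" and ss: "cauchy_tuple Es ss"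
    and Xs: "\<And>i. i < length Es \<Longrightarrow> Xs ! i = cauchy_class (Es ! i) (ss ! i)"
  shows "(\<lambda>k. \<Prod>i<length Es. nrm (Es ! i) (at_index ss k ! i)) \<longlonglongrightarrow>
    (\<Prod>i<length Es. nrm (banach_completion (Es ! i)) (Xs ! i))"
proof (rule tendsto_prod)
  fix i assume "i \<in> {..<length Es}"
  then have i: "i < length Es" by simp
  interpret E: seminormed "Es ! i" using Es i by simp
  show "(\<lambda>k. nrm (Es ! i) (at_index ss k ! i)) \<longlonglongrightarrow> nrm (banach_completion (Es ! i)) (Xs ! i)"
    using E.nrm_class[of "ss ! i"] ss i Xs by (simp add: cauchy_tuple_def)
qed

lemma mext_mbounded:
  fixes \<Phi> :: "'a list \<Rightarrow> 'b::banach"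
  assumes Es: "\<And>E. E \<in> set Es \<Longrightarrow> seminormed E" and m: "mult_on Es \<Phi>" "mbounded Es \<Phi> B" "0 \<le> B"
  shows "mbounded (map banach_completion Es) (mext \<Phi>) B"
  unfolding mbounded_def
proof
  fix Xs assume Xs: "Xs \<in> tuples (map banach_completion Es)"
  note t = tuples_completion[OF Es Xs]
  let ?r = "map representative Xs"
  have "norm (mext \<Phi> Xs) \<le> B * (\<Prod>i<length Es. nrm (banach_completion (Es ! i)) (Xs ! i))"
  proof (rule LIMSEQ_le[OF tendsto_norm[OF mext_tendsto[OF Es m t]] tendsto_mult_left[OF nrm_prod_tendsto[OF Es t(1,3)]]])
    show "\<exists>N. \<forall>k\<ge>N. norm (\<Phi> (at_index ?r k)) \<le> B * (\<Prod>i<length Es. nrm (Es ! i) (at_index ?r k ! i))"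
      using m(2) cauchy_tuple_at[OF Es t(1)] by (auto simp: mbounded_def)
  qed auto
  then show "norm (mext \<Phi> Xs) \<le> B * (\<Prod>i<length (map banach_completion Es). nrm (map banach_completion Es ! i) (Xs ! i))"
    by simp
qed

lemma mext_const:
  fixes \<Phi> :: "'a list \<Rightarrow> 'b::banach"
  assumes Es: "\<And>E. E \<in> set Es \<Longrightarrow> seminormed E" and m: "mult_on Es \<Phi>" "mbounded Es \<Phi> B" "0 \<le> B"
    and xs: "xs \<in> tuples Es"
  shows "mext \<Phi> (map2 const_class Es xs) = \<Phi> xs"
proof -
  have len: "length xs = length Es" using xs by (simp add: tuples_iff)
  let ?s = "map (\<lambda>x _. x) xs"
  have "cauchy_tuple Es ?s"
    unfolding cauchy_tuple_def
  proof (intro conjI allI impI)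
    fix i assume i: "i < length Es"
    interpret E: seminormed "Es ! i" using Es i by simp
    show "?s ! i \<in> cauchy_in (Es ! i)"
      using E.const_cauchy[of "xs ! i"] xs i len by (simp add: tuples_iff)
  qed (simp add: len)
  from mext_tendsto[OF Es m this, of "map2 const_class Es xs"]
  have "(\<lambda>k. \<Phi> (at_index ?s k)) \<longlonglongrightarrow> mext \<Phi> (map2 const_class Es xs)"
    using len by (simp add: const_class_def)
  then show ?thesis by (simp add: comp_def LIMSEQ_const_iff)
qed

lemma tuples_singleton: "tuples [V] = {[x] | x. x \<in> carr V}"
  by (auto simp: tuples_def list_all2_Cons2)

text \<open>A bounded linear map is a bounded multilinear map on lists of length one, so the facts
  about \<open>cext\<close> are special cases of those about \<open>mext\<close>.\<close>

lemma blin_iff: "blin V T B \<longleftrightarrow> mult_on [V] (\<lambda>xs. T (xs ! 0)) \<and> mbounded [V] (\<lambda>xs. T (xs ! 0)) B"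
  unfolding blin_def mult_on_def mbounded_def tuples_singleton by auto

lemma cext_eq_mext: "cext T X = mext (\<lambda>xs. T (xs ! 0)) [X]"
  by (simp add: cext_def mext_def)

lemma cext_tendsto:
  assumes V: "seminormed V" and T: "blin V T B" "0 \<le> B" and x: "x \<in> cauchy_in V"
  shows "(\<lambda>k. T (x k)) \<longlonglongrightarrow> cext T (cauchy_class V x)"
  using mext_tendsto[of "[V]" "\<lambda>xs. T (xs ! 0)" B "[x]" "[cauchy_class V x]"] assms
  by (simp add: blin_iff cext_eq_mext cauchy_tuple_def)

lemma blin_cext:
  assumes V: "seminormed V" and T: "blin V T B" "0 \<le> B"
  shows "blin (banach_completion V) (cext T) B"
  using mext_mult_on[of "[V]" "\<lambda>xs. T (xs ! 0)" B] mext_mbounded[of "[V]" "\<lambda>xs. T (xs ! 0)" B] assms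
  unfolding blin_iff cext_eq_mext mult_on_def mbounded_def
  by (auto simp: tuples_singleton)

lemma cext_const:
  assumes V: "seminormed V" and T: "blin V T B" "0 \<le> B" and v: "v \<in> carr V"
  shows "cext T (const_class V v) = T v"
  using cext_tendsto[OF V T seminormed.const_cauchy[OF V v]] by (simp add: const_class_def LIMSEQ_const_iff)

lemma cext_representative:
  assumes V: "seminormed V" and T: "blin V T B" "0 \<le> B" and X: "X \<in> carr (banach_completion V)"
  shows "(\<lambda>k. T (representative X k)) \<longlonglongrightarrow> cext T X"
  using cext_tendsto[OF V T seminormed.representative_cauchy[OF V X]]
  by (simp add: seminormed.class_representative[OF V X])

text \<open>Used to confine the values of the extension to the closure of the embedded
  algebra.\<close>

lemma cext_closed:
  assumes V: "seminormed V" and T: "blin V T B" "0 \<le> B" and X: "X \<in> carr (banach_completion V)"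
    and S: "closed S" "\<And>v. v \<in> carr V \<Longrightarrow> T v \<in> S"
  shows "cext T X \<in> S"
  by (rule closed_sequentially[OF S(1) _ cext_representative[OF V T X]])
     (use S(2) seminormed.representative_carr[OF V X] in auto)

section \<open>Linear extension to tensor products\<close>

text \<open>The list is a formal linear combination as in \<open>tensor_sum\<close>; different lists
  may represent the same tensor.\<close>

definition lsum :: "('a \<Rightarrow> 'b::real_vector) \<Rightarrow> (real \<times> 'a) list \<Rightarrow> 'b" where
  "lsum \<Phi> cs = (\<Sum>(c, x)\<leftarrow>cs. c *\<^sub>R \<Phi> x)"

lemma lsum_simps [simp]:
  "lsum \<Phi> [] = 0" "lsum \<Phi> (p # cs) = fst p *\<^sub>R \<Phi> (snd p) + lsum \<Phi> cs"
  "lsum \<Phi> (cs @ ds) = lsum \<Phi> cs + lsum \<Phi> ds"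
  by (auto simp: lsum_def case_prod_beta)

abbreviation scale_list :: "real \<Rightarrow> (real \<times> 'a) list \<Rightarrow> (real \<times> 'a) list" where
  "scale_list k \<equiv> map (\<lambda>(c, x). (k * c, x))"

lemma lsum_scale: "lsum \<Phi> (scale_list k cs) = k *\<^sub>R lsum \<Phi> cs"
  by (induction cs) (auto simp: scaleR_add_right)

lemma snd_scale_list: "snd ` set (scale_list k cs) = snd ` set cs"
  by (induction cs) auto

lemma lsum_linear: "linear g \<Longrightarrow> g (lsum \<Phi> cs) = lsum (\<lambda>x. g (\<Phi> x)) cs"
  by (induction cs) (auto simp: linear_add linear_scale linear_0)

lemma lsum_cong: "(\<And>x. x \<in> snd ` set cs \<Longrightarrow> \<Phi> x = \<Psi> x) \<Longrightarrow> lsum \<Phi> cs = lsum \<Psi> cs"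
  by (induction cs) auto

lemma lsum_plus: "lsum (\<lambda>x. \<Phi> x + \<Psi> x) cs = lsum \<Phi> cs + lsum \<Psi> cs"
  by (induction cs) (auto simp: scaleR_add_right)

lemma lsum_scaleR: "lsum (\<lambda>x. k *\<^sub>R \<Phi> x) cs = k *\<^sub>R lsum \<Phi> cs"
  by (induction cs) (auto simp: scaleR_add_right)

lemma lsum_mult: "lsum (\<lambda>x. k * \<Phi> x) cs = k * (lsum \<Phi> cs :: real)"
  using lsum_scaleR[of k \<Phi> cs] by simp

lemma lsum_zero [simp]: "lsum (\<lambda>x. 0) cs = 0"
  by (induction cs) auto

lemma lsum_swap: "lsum (\<lambda>x. lsum (\<lambda>y. F x y) ds) cs = lsum (\<lambda>y. lsum (\<lambda>x. F x y) cs) ds"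
  by (induction cs) (simp_all add: lsum_plus lsum_scaleR)

lemma tendsto_lsum:
  fixes \<Phi> :: "'i \<Rightarrow> 'a \<Rightarrow> 'b::real_normed_vector"
  assumes "\<And>x. x \<in> snd ` set cs \<Longrightarrow> ((\<lambda>i. \<Phi> i x) \<longlongrightarrow> L x) F"
  shows "((\<lambda>i. lsum (\<Phi> i) cs) \<longlongrightarrow> lsum L cs) F"
  using assms by (induction cs) (auto intro!: tendsto_intros)

lemma mforms_iff: "A \<in> mforms Es \<longleftrightarrow> mult_on Es A"
  by (simp add: mforms_def mult_on_def)

lemma tensor_sum_apply: "mult_on Es A \<Longrightarrow> tensor_sum Es cs A = lsum A cs"
  by (simp add: tensor_sum_def mforms_iff lsum_def)

lemma tensor_sum_append: "tensor_sum Es (cs @ ds) = (\<lambda>A. tensor_sum Es cs A + tensor_sum Es ds A)"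
  by (auto simp: tensor_sum_def)

lemma tensor_sum_scale: "tensor_sum Es (scale_list k cs) = (\<lambda>A. k * tensor_sum Es cs A)"
proof
  fix A show "tensor_sum Es (scale_list k cs) A = k * tensor_sum Es cs A"
    by (cases "mult_on Es A") (simp_all add: tensor_sum_apply lsum_scale, simp add: tensor_sum_def mforms_iff)
qed

definition over_tuples :: "('a, 'm) vspace_scheme list \<Rightarrow> (real \<times> 'a list) list \<Rightarrow> bool" where
  "over_tuples Es cs \<longleftrightarrow> snd ` set cs \<subseteq> tuples Es"

lemma over_tuples_append [simp]: "over_tuples Es (cs @ ds) \<longleftrightarrow> over_tuples Es cs \<and> over_tuples Es ds"
  and over_tuples_scale [simp]: "over_tuples Es (scale_list k cs) \<longleftrightarrow> over_tuples Es cs"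
  unfolding over_tuples_def snd_scale_list by auto

lemma carr_alg_tensor: "carr (alg_tensor Es) = {tensor_sum Es cs | cs. over_tuples Es cs}"
  by (simp add: alg_tensor_def over_tuples_def)

text \<open>Tensors are functionals on real forms only. A linear functional that is 1 on the
  difference of the two vector values turns \<Phi> into such a form, on which equal tensors
  agree.\<close>

lemma lsum_eqI:
  fixes \<Phi> :: "'a list \<Rightarrow> 'b::real_vector"
  assumes m: "mult_on Es \<Phi>" and eq: "tensor_sum Es cs = tensor_sum Es ds"
  shows "lsum \<Phi> cs = lsum \<Phi> ds"
proof (rule ccontr)
  let ?v = "lsum \<Phi> cs - lsum \<Phi> ds"
  assume "lsum \<Phi> cs \<noteq> lsum \<Phi> ds"
  then have "independent {?v}" by simp
  then obtain g :: "'b \<Rightarrow> real" where g: "linear g" "g ?v = 1"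
    using linear_independent_extend[of "{?v}" "\<lambda>_. 1::real"] by auto
  have "mult_on Es (\<lambda>xs. g (\<Phi> xs))"
    using m g(1) unfolding mult_on_def by (simp add: linear_add linear_scale)
  then have "lsum (\<lambda>xs. g (\<Phi> xs)) cs = lsum (\<lambda>xs. g (\<Phi> xs)) ds"
    using tensor_sum_apply eq by metis
  then have "g ?v = 0" by (simp add: linear_diff[OF g(1)] lsum_linear[OF g(1)])
  then show False using g(2) by simp
qed

definition tens_ext ::
    "('a, 'm) vspace_scheme list \<Rightarrow> ('a list \<Rightarrow> 'b::real_vector) \<Rightarrow> (('a list \<Rightarrow> real) \<Rightarrow> real) \<Rightarrow> 'b" where
  "tens_ext Es \<Phi> u = lsum \<Phi> (SOME cs. over_tuples Es cs \<and> tensor_sum Es cs = u)"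

text \<open>The chosen representation depends on \<open>u\<close> alone and serves all \<Phi> at
  once. Hence any linear dependence of \<Phi> on a parameter carries over to the extension.\<close>

lemma tens_ext_some:
  assumes "u \<in> carr (alg_tensor Es)"
  obtains cs where "over_tuples Es cs" "tensor_sum Es cs = u" "\<And>\<Phi>. tens_ext Es \<Phi> u = lsum \<Phi> cs"
proof -
  let ?cs = "SOME cs. over_tuples Es cs \<and> tensor_sum Es cs = u"
  have "\<exists>cs. over_tuples Es cs \<and> tensor_sum Es cs = u" using assms by (auto simp: carr_alg_tensor)
  then have "over_tuples Es ?cs \<and> tensor_sum Es ?cs = u" by (rule someI_ex)
  then show ?thesis using that[of ?cs] by (simp add: tens_ext_def)
qed

lemma tens_ext_tensor_sum:
  fixes \<Phi> :: "'a list \<Rightarrow> 'b::real_vector"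
  assumes "mult_on Es \<Phi>" "over_tuples Es cs"
  shows "tens_ext Es \<Phi> (tensor_sum Es cs) = lsum \<Phi> cs"
proof -
  have u: "tensor_sum Es cs \<in> carr (alg_tensor Es)" using assms(2) by (auto simp: carr_alg_tensor)
  obtain ds where "over_tuples Es ds" "tensor_sum Es ds = tensor_sum Es cs"
      "\<And>\<Psi> :: 'a list \<Rightarrow> 'b. tens_ext Es \<Psi> (tensor_sum Es cs) = lsum \<Psi> ds"
    by (rule tens_ext_some[OF u]) blast
  then show ?thesis using lsum_eqI[OF assms(1)] by metis
qed

lemma alg_tensor_closed:
  assumes "u \<in> carr (alg_tensor Es)"
  shows "v \<in> carr (alg_tensor Es) \<Longrightarrow> (\<lambda>A. u A + v A) \<in> carr (alg_tensor Es)"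
    and "(\<lambda>A. k * u A) \<in> carr (alg_tensor Es)"
proof -
  obtain cs where cs: "over_tuples Es cs" "u = tensor_sum Es cs" using assms by (auto simp: carr_alg_tensor)
  show "(\<lambda>A. k * u A) \<in> carr (alg_tensor Es)"
    using cs tensor_sum_scale[of Es k cs] over_tuples_scale[of Es k cs] unfolding carr_alg_tensor
    by (intro CollectI exI[of _ "scale_list k cs"]) simp
  assume "v \<in> carr (alg_tensor Es)"
  then obtain ds where "over_tuples Es ds" "v = tensor_sum Es ds" by (auto simp: carr_alg_tensor)
  then show "(\<lambda>A. u A + v A) \<in> carr (alg_tensor Es)"
    using cs tensor_sum_append[of Es cs ds] unfolding carr_alg_tensor
    by (intro CollectI exI[of _ "cs @ ds"]) simp
qed

lemma tens_ext_linear: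
  assumes m: "mult_on Es \<Phi>" and u: "u \<in> carr (alg_tensor Es)"
  shows "v \<in> carr (alg_tensor Es) \<Longrightarrow> tens_ext Es \<Phi> (\<lambda>A. u A + v A) = tens_ext Es \<Phi> u + tens_ext Es \<Phi> v"
    and "tens_ext Es \<Phi> (\<lambda>A. k * u A) = k *\<^sub>R tens_ext Es \<Phi> u"
proof -
  obtain cs where cs: "over_tuples Es cs" "u = tensor_sum Es cs" using u by (auto simp: carr_alg_tensor)
  show "tens_ext Es \<Phi> (\<lambda>A. k * u A) = k *\<^sub>R tens_ext Es \<Phi> u"
    using tens_ext_tensor_sum[OF m, of "scale_list k cs"] tens_ext_tensor_sum[OF m cs(1)] cs
    by (simp add: tensor_sum_scale lsum_scale)
  assume "v \<in> carr (alg_tensor Es)"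
  then obtain ds where ds: "over_tuples Es ds" "v = tensor_sum Es ds" by (auto simp: carr_alg_tensor)
  show "tens_ext Es \<Phi> (\<lambda>A. u A + v A) = tens_ext Es \<Phi> u + tens_ext Es \<Phi> v"
    using tens_ext_tensor_sum[OF m, of "cs @ ds"] tens_ext_tensor_sum[OF m cs(1)] tens_ext_tensor_sum[OF m ds(1)] cs ds
    by (simp add: tensor_sum_append)
qed

lemma tens_ext_subspace:
  assumes u: "u \<in> carr (alg_tensor Es)" and S: "subspace S" "\<And>xs. xs \<in> tuples Es \<Longrightarrow> \<Phi> xs \<in> S"
  shows "tens_ext Es \<Phi> u \<in> S"
proof -
  have "lsum \<Phi> cs \<in> S" if "over_tuples Es cs" for cs
    using that S by (induction cs) (auto simp: over_tuples_def subspace_0 subspace_add subspace_scale)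
  then show ?thesis using tens_ext_some[OF u] by metis
qed

section \<open>The projective seminorm\<close>

definition proj_cost :: "'a nspace list \<Rightarrow> (real \<times> 'a list) list \<Rightarrow> real" where
  "proj_cost Es cs = (\<Sum>(c, xs)\<leftarrow>cs. \<bar>c\<bar> * (\<Prod>i<length Es. nrm (Es ! i) (xs ! i)))"

lemma proj_cost_simps [simp]:
  "proj_cost Es [] = 0"
  "proj_cost Es (p # cs) = \<bar>fst p\<bar> * (\<Prod>i<length Es. nrm (Es ! i) (snd p ! i)) + proj_cost Es cs"
  "proj_cost Es (cs @ ds) = proj_cost Es cs + proj_cost Es ds"
  by (auto simp: proj_cost_def case_prod_beta)

lemma proj_cost_scale: "proj_cost Es (scale_list k cs) = \<bar>k\<bar> * proj_cost Es cs"
  by (induction cs) (auto simp: abs_mult algebra_simps)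

definition nonneg_space :: "'a nspace \<Rightarrow> bool" where
  "nonneg_space E \<longleftrightarrow> (\<forall>x\<in>carr E. 0 \<le> nrm E x)"

lemma alg_projective_tensor_simps [simp]:
  "carr (alg_projective_tensor Es) = carr (alg_tensor Es)"
  "vadd (alg_projective_tensor Es) = (\<lambda>u v A. u A + v A)"
  "vscale (alg_projective_tensor Es) = (\<lambda>c u A. c * u A)"
  by (simp_all add: alg_projective_tensor_def alg_tensor_def)

lemma nrm_alg_projective:
  "nrm (alg_projective_tensor Es) u = (INF cs\<in>{cs. over_tuples Es cs \<and> tensor_sum Es cs = u}. proj_cost Es cs)"
  by (simp add: alg_projective_tensor_def proj_cost_def over_tuples_def)

section \<open>The infimum over representations and its universal property\<close>

context
  fixes Es :: "'a nspace list"
  assumes nonneg: "\<And>E. E \<in> set Es \<Longrightarrow> nonneg_space E"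
begin

lemma nrm_prod_nonneg: "xs \<in> tuples Es \<Longrightarrow> 0 \<le> (\<Prod>i<length Es. nrm (Es ! i) (xs ! i))"
  using nonneg by (intro prod_nonneg) (auto simp: tuples_iff nonneg_space_def)

lemma proj_cost_nonneg: "over_tuples Es cs \<Longrightarrow> 0 \<le> proj_cost Es cs"
  by (induction cs) (auto simp: over_tuples_def nrm_prod_nonneg)

lemma nrm_projective_le:
  assumes "over_tuples Es cs"
  shows "nrm (alg_projective_tensor Es) (tensor_sum Es cs) \<le> proj_cost Es cs"
  unfolding nrm_alg_projective
  by (rule cINF_lower) (use assms proj_cost_nonneg in \<open>auto intro!: bdd_belowI[of _ 0]\<close>)

lemma nrm_projective_ge:
  assumes "u \<in> carr (alg_tensor Es)" "\<And>cs. over_tuples Es cs \<Longrightarrow> tensor_sum Es cs = u \<Longrightarrow> b \<le> proj_cost Es cs"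
  shows "b \<le> nrm (alg_projective_tensor Es) u"
  unfolding nrm_alg_projective
  by (rule cINF_greatest) (use assms in \<open>auto simp: carr_alg_tensor\<close>)

lemma nrm_projective_approx:
  assumes "u \<in> carr (alg_tensor Es)" "0 < e"
  shows "\<exists>cs. over_tuples Es cs \<and> tensor_sum Es cs = u \<and> proj_cost Es cs < nrm (alg_projective_tensor Es) u + e"
  using nrm_projective_ge[OF assms(1), of "nrm (alg_projective_tensor Es) u + e"] assms(2) by force

lemma nrm_projective_scale_le:
  assumes u: "u \<in> carr (alg_tensor Es)"
  shows "nrm (alg_projective_tensor Es) (\<lambda>A. k * u A) \<le> \<bar>k\<bar> * nrm (alg_projective_tensor Es) u"
proof (rule field_le_epsilon)
  fix e :: real assume e: "0 < e"
  \<comment> \<open>The summand 1 keeps the quotient meaningful for \<open>k = 0\<close>, and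
    multiplication by \<bar>k\<bar> gives at most \<open>e\<close>.\<close>
  then have "0 < e / (\<bar>k\<bar> + 1)" by simp
  then obtain cs where cs: "over_tuples Es cs" "tensor_sum Es cs = u"
      "proj_cost Es cs < nrm (alg_projective_tensor Es) u + e / (\<bar>k\<bar> + 1)"
    using nrm_projective_approx[OF u] by blast
  have "nrm (alg_projective_tensor Es) (\<lambda>A. k * u A) \<le> \<bar>k\<bar> * proj_cost Es cs"
    using nrm_projective_le[of "scale_list k cs"] cs by (simp add: tensor_sum_scale proj_cost_scale)
  also have "\<dots> \<le> \<bar>k\<bar> * (nrm (alg_projective_tensor Es) u + e / (\<bar>k\<bar> + 1))"
    using cs(3) by (intro mult_left_mono) auto
  also have "\<dots> = \<bar>k\<bar> * nrm (alg_projective_tensor Es) u + (\<bar>k\<bar> / (\<bar>k\<bar> + 1)) * e"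
    by (simp add: distrib_left)
  also have "(\<bar>k\<bar> / (\<bar>k\<bar> + 1)) * e \<le> 1 * e" using e by (intro mult_right_mono) auto
  finally show "nrm (alg_projective_tensor Es) (\<lambda>A. k * u A) \<le> \<bar>k\<bar> * nrm (alg_projective_tensor Es) u + e"
    by simp
qed

lemma seminormed_projective: "seminormed (alg_projective_tensor Es)"
proof (rule seminormedI[where ev = "\<lambda>u. u"])
  let ?N = "nrm (alg_projective_tensor Es)"
  fix x :: "('a list \<Rightarrow> real) \<Rightarrow> real" and k :: real assume "x \<in> carr (alg_projective_tensor Es)"
  then have x: "x \<in> carr (alg_tensor Es)" by simp
  have "?N (\<lambda>A. k * x A) = \<bar>k\<bar> * ?N x"
  proof (rule antisym[OF nrm_projective_scale_le[OF x]])
    show "\<bar>k\<bar> * ?N x \<le> ?N (\<lambda>A. k * x A)"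
    proof (cases "k = 0")
      case True
      have "0 \<le> ?N (\<lambda>A. k * x A)"
        by (rule nrm_projective_ge[OF alg_tensor_closed(2)[OF x]]) (use proj_cost_nonneg in auto)
      then show ?thesis using True by simp
    next
      case False
      \<comment> \<open>The upper bound for the factor \<open>inverse k\<close>, applied to the
        scaled tensor, yields the lower bound for \<open>k\<close>.\<close>
      have "?N (\<lambda>A. inverse k * (k * x A)) \<le> \<bar>inverse k\<bar> * ?N (\<lambda>A. k * x A)"
        by (rule nrm_projective_scale_le[OF alg_tensor_closed(2)[OF x]])
      moreover have "(\<lambda>A. inverse k * (k * x A)) = x" using False by auto
      ultimately have "?N x \<le> \<bar>inverse k\<bar> * ?N (\<lambda>A. k * x A)" by simp
      then have "\<bar>k\<bar> * ?N x \<le> \<bar>k\<bar> * (\<bar>inverse k\<bar> * ?N (\<lambda>A. k * x A))" by (rule mult_left_mono) simp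
      also have "\<dots> = ?N (\<lambda>A. k * x A)" using False by (simp add: abs_inverse)
      finally show ?thesis .
    qed
  qed
  then show "?N (vscale (alg_projective_tensor Es) k x) = \<bar>k\<bar> * ?N x" by simp
  fix y assume "y \<in> carr (alg_projective_tensor Es)"
  then have y: "y \<in> carr (alg_tensor Es)" by simp
  have "?N (\<lambda>A. x A + y A) \<le> ?N x + ?N y"
  proof (rule field_le_epsilon)
    fix e :: real assume "0 < e"
    then have "0 < e / 2" by simp
    obtain cs where cs: "over_tuples Es cs" "tensor_sum Es cs = x" "proj_cost Es cs < ?N x + e / 2"
      using nrm_projective_approx[OF x \<open>0 < e / 2\<close>] by blast
    obtain ds where ds: "over_tuples Es ds" "tensor_sum Es ds = y" "proj_cost Es ds < ?N y + e / 2"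
      using nrm_projective_approx[OF y \<open>0 < e / 2\<close>] by blast
    have "?N (\<lambda>A. x A + y A) \<le> proj_cost Es cs + proj_cost Es ds"
      using nrm_projective_le[of "cs @ ds"] cs ds by (simp add: tensor_sum_append)
    then show "?N (\<lambda>A. x A + y A) \<le> ?N x + ?N y + e" using cs ds by simp
  qed
  then show "?N (vadd (alg_projective_tensor Es) x y) \<le> ?N x + ?N y" by simp
qed (auto intro: alg_tensor_closed)

text \<open>By the triangle inequality every representation of a tensor costs at least the norm of
  the image divided by \<open>B\<close>, hence so does the infimum.\<close>

lemma blin_projective:
  assumes m: "mult_on Es \<Phi>" "mbounded Es \<Phi> B" "0 \<le> B"
  shows "blin (alg_projective_tensor Es) (tens_ext Es \<Phi>) B"
proof -
  have le: "norm (lsum \<Phi> cs) \<le> B * proj_cost Es cs" if "over_tuples Es cs" for cs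
    using that
  proof (induction cs)
    case (Cons p cs)
    have "norm (fst p *\<^sub>R \<Phi> (snd p)) \<le> \<bar>fst p\<bar> * (B * (\<Prod>i<length Es. nrm (Es ! i) (snd p ! i)))"
      using m(2) Cons.prems by (auto simp: over_tuples_def mbounded_def intro!: mult_left_mono)
    then show ?case
      using Cons norm_triangle_ineq[of "fst p *\<^sub>R \<Phi> (snd p)" "lsum \<Phi> cs"]
      by (simp add: over_tuples_def algebra_simps)
  qed simp
  have "norm (tens_ext Es \<Phi> u) \<le> B * nrm (alg_projective_tensor Es) u" if u: "u \<in> carr (alg_tensor Es)" for u
  \<comment> \<open>The estimate of the infimum divides by \<open>B\<close>.\<close>
  proof (cases "B = 0")
    case True
    obtain cs where "over_tuples Es cs" "tens_ext Es \<Phi> u = lsum \<Phi> cs" by (rule tens_ext_some[OF u]) blast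
    then show ?thesis using le[of cs] True by simp
  next
    case False
    have "norm (tens_ext Es \<Phi> u) / B \<le> nrm (alg_projective_tensor Es) u"
    proof (rule nrm_projective_ge[OF u])
      fix cs assume cs: "over_tuples Es cs" "tensor_sum Es cs = u"
      then have "tens_ext Es \<Phi> u = lsum \<Phi> cs" using tens_ext_tensor_sum[OF m(1) cs(1)] by simp
      then show "norm (tens_ext Es \<Phi> u) / B \<le> proj_cost Es cs"
        using le[OF cs(1)] m(3) False by (simp add: divide_le_eq mult.commute)
    qed
    then show ?thesis using m(3) False by (simp add: divide_le_eq mult.commute)
  qed
  then show ?thesis
    unfolding blin_def alg_projective_tensor_simps using tens_ext_linear[OF m(1)] by blast
qed

end

section \<open>Semi-inner products and Hilbert completions\<close>

locale semi_inner =
  fixes V :: "'a ispace"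
  assumes iadd_closed: "x \<in> carr V \<Longrightarrow> y \<in> carr V \<Longrightarrow> vadd V x y \<in> carr V"
    and iscale_closed: "x \<in> carr V \<Longrightarrow> vscale V c x \<in> carr V"
    and inn_commute: "x \<in> carr V \<Longrightarrow> y \<in> carr V \<Longrightarrow> inn V x y = inn V y x"
    and inn_add: "x \<in> carr V \<Longrightarrow> y \<in> carr V \<Longrightarrow> z \<in> carr V \<Longrightarrow> inn V (vadd V x y) z = inn V x z + inn V y z"
    and inn_scale: "x \<in> carr V \<Longrightarrow> z \<in> carr V \<Longrightarrow> inn V (vscale V c x) z = c * inn V x z"
    and inn_nonneg: "x \<in> carr V \<Longrightarrow> 0 \<le> inn V x x"
begin

lemma inn_add_right: "x \<in> carr V \<Longrightarrow> y \<in> carr V \<Longrightarrow> z \<in> carr V \<Longrightarrow> inn V z (vadd V x y) = inn V z x + inn V z y"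
  using inn_commute inn_add iadd_closed by metis

lemma inn_scale_right: "x \<in> carr V \<Longrightarrow> z \<in> carr V \<Longrightarrow> inn V z (vscale V c x) = c * inn V z x"
  using inn_commute inn_scale iscale_closed by metis

text \<open>The quadratic polynomial \<open>t \<mapsto> inn V (x + t y) (x + t y)\<close> is
  nonnegative, and its minimum gives the inequality. Null vectors are possible, so the case in which
  it degenerates to an affine function is treated separately.\<close>

lemma inn_square_le:
  assumes x: "x \<in> carr V" and y: "y \<in> carr V"
  shows "(inn V x y)\<^sup>2 \<le> inn V x x * inn V y y"
proof -
  have q: "0 \<le> inn V x x + 2 * t * inn V x y + t\<^sup>2 * inn V y y" for t
  proof -
    have "0 \<le> inn V (vadd V x (vscale V t y)) (vadd V x (vscale V t y))"
      by (intro inn_nonneg iadd_closed iscale_closed x y)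
    also have "\<dots> = inn V x x + 2 * t * inn V x y + t\<^sup>2 * inn V y y"
      using x y inn_commute[OF x y]
      by (simp add: inn_add inn_add_right inn_scale inn_scale_right iadd_closed iscale_closed power2_eq_square algebra_simps)
    finally show ?thesis .
  qed
  show ?thesis
  proof (cases "inn V y y = 0")
    case True
    have "inn V x y = 0"
    proof (rule ccontr)
      assume "inn V x y \<noteq> 0"
      \<comment> \<open>At this \<open>t\<close> the affine function has the value -1.\<close>
      then show False using q[of "- (inn V x x + 1) / (2 * inn V x y)"] True by (simp add: field_simps)
    qed
    then show ?thesis using True by simp
  next
    case False
    then have pos: "0 < inn V y y" using inn_nonneg[OF y] by simp
    have "0 \<le> inn V x x - (inn V x y)\<^sup>2 / inn V y y"
      using q[of "- inn V x y / inn V y y"] False by (simp add: power2_eq_square)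
    then show ?thesis using pos by (simp add: field_simps)
  qed
qed

lemma normed_of_simps [simp]:
  "carr (normed_of V) = carr V" "vadd (normed_of V) = vadd V" "vscale (normed_of V) = vscale V"
  "nrm (normed_of V) x = sqrt (inn V x x)"
  by (simp_all add: normed_of_def)

lemma inn_le: "x \<in> carr V \<Longrightarrow> y \<in> carr V \<Longrightarrow> \<bar>inn V x y\<bar> \<le> sqrt (inn V x x) * sqrt (inn V y y)"
  using inn_square_le[of x y] by (simp add: real_le_rsqrt real_sqrt_mult[symmetric])

lemma nrm_vadd_le:
  assumes x: "x \<in> carr V" and y: "y \<in> carr V"
  shows "nrm (normed_of V) (vadd V x y) \<le> nrm (normed_of V) x + nrm (normed_of V) y"
proof -
  have "inn V (vadd V x y) (vadd V x y) = inn V x x + 2 * inn V x y + inn V y y"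
    using x y inn_commute[OF x y] by (simp add: inn_add inn_add_right iadd_closed)
  also have "\<dots> \<le> (sqrt (inn V x x) + sqrt (inn V y y))\<^sup>2"
    using inn_le[OF x y] inn_nonneg[OF x] inn_nonneg[OF y] by (simp add: power2_sum)
  finally show ?thesis using inn_nonneg[OF x] inn_nonneg[OF y] by (simp add: real_le_lsqrt)
qed

lemma nrm_vscale: "x \<in> carr V \<Longrightarrow> nrm (normed_of V) (vscale V c x) = \<bar>c\<bar> * nrm (normed_of V) x"
  by (simp add: inn_scale inn_scale_right iscale_closed real_sqrt_mult mult.assoc[symmetric] power2_eq_square[symmetric])

lemma nonneg_space_normed_of: "nonneg_space (normed_of V)"
  using inn_nonneg by (simp add: nonneg_space_def)

lemma tuples_pair: "xs \<in> tuples [normed_of V, normed_of V] \<longleftrightarrow> (\<exists>x y. xs = [x, y] \<and> x \<in> carr V \<and> y \<in> carr V)"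
  by (auto simp: tuples_def list_all2_Cons2)

text \<open>Seen as a bounded bilinear map on lists of length two, the inner product is extended to
  the completion by \<open>mext\<close>.\<close>

lemma inn_mult_on: "mult_on [normed_of V, normed_of V] (\<lambda>xs. inn V (xs ! 0) (xs ! 1))"
  unfolding mult_on_def
  by (auto simp: tuples_pair less_Suc_eq inn_add inn_add_right inn_scale inn_scale_right)

lemma inn_mbounded: "mbounded [normed_of V, normed_of V] (\<lambda>xs. inn V (xs ! 0) (xs ! 1)) 1"
  unfolding mbounded_def using inn_le by (auto simp: tuples_pair lessThan_Suc mult.commute)

end

lemma hilbert_completion_simps [simp]:
  "carr (hilbert_completion V) = carr (banach_completion (normed_of V))"
  "vadd (hilbert_completion V) = vadd (banach_completion (normed_of V))"
  "vscale (hilbert_completion V) = vscale (banach_completion (normed_of V))"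
  by (simp_all add: hilbert_completion_def Let_def)

lemma inn_hilbert_completion:
  "inn (hilbert_completion V) X Y = mext (\<lambda>xs. inn V (xs ! 0) (xs ! 1)) [X, Y]"
  by (simp add: hilbert_completion_def Let_def mext_def)

locale semi_inner_completion = semi_inner V + seminormed "normed_of V" for V :: "'a ispace"
begin

lemma sn_pair: "E \<in> set [normed_of V, normed_of V] \<Longrightarrow> seminormed E"
  using seminormed_axioms by auto

lemma inn_tendsto:
  assumes "x \<in> cauchy_in (normed_of V)" "y \<in> cauchy_in (normed_of V)"
  shows "(\<lambda>k. inn V (x k) (y k)) \<longlonglongrightarrow>
    inn (hilbert_completion V) (cauchy_class (normed_of V) x) (cauchy_class (normed_of V) y)"
proof -
  have "(\<lambda>k. (\<lambda>xs. inn V (xs ! 0) (xs ! 1)) (at_index [x, y] k)) \<longlonglongrightarrow>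
      mext (\<lambda>xs. inn V (xs ! 0) (xs ! 1)) [cauchy_class (normed_of V) x, cauchy_class (normed_of V) y]"
    by (rule mext_tendsto[where Es = "[normed_of V, normed_of V]", OF sn_pair inn_mult_on inn_mbounded zero_le_one])
       (use assms in \<open>auto simp: cauchy_tuple_def less_Suc_eq\<close>)
  then show ?thesis by (simp add: inn_hilbert_completion)
qed

lemma inn_representative_tendsto:
  assumes "X \<in> carr (hilbert_completion V)" "Y \<in> carr (hilbert_completion V)"
  shows "(\<lambda>k. inn V (representative X k) (representative Y k)) \<longlonglongrightarrow> inn (hilbert_completion V) X Y"
  using inn_tendsto[OF representative_cauchy representative_cauchy] assms class_representative by simp

lemma semi_inner_hilbert_completion: "semi_inner (hilbert_completion V)"
proof
  let ?H = "hilbert_completion V"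
  fix X Y Z :: "(nat \<Rightarrow> 'a) set" and c :: real
  assume X: "X \<in> carr ?H"
  then have X': "X \<in> carr (banach_completion (normed_of V))" by simp
  show "vscale ?H c X \<in> carr ?H" using completion_closed(2)[OF X'] by simp
  show "0 \<le> inn ?H X X"
    by (rule LIMSEQ_le_const[OF inn_representative_tendsto[OF X X]])
       (use inn_nonneg representative_carr[OF X'] in auto)
  have mm: "mult_on [banach_completion (normed_of V), banach_completion (normed_of V)] (mext (\<lambda>xs. inn V (xs ! 0) (xs ! 1)))"
    using mext_mult_on[OF sn_pair inn_mult_on inn_mbounded zero_le_one] by simp
  show "inn ?H (vscale ?H c X) Z = c * inn ?H X Z" if Z: "Z \<in> carr ?H"
    using mm[unfolded mult_on_def, rule_format, of "[X, Z]" 0 X X c] X' Z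
    by (simp add: inn_hilbert_completion tuples_def)
  assume Y: "Y \<in> carr ?H"
  then have Y': "Y \<in> carr (banach_completion (normed_of V))" by simp
  show "vadd ?H X Y \<in> carr ?H" using completion_closed(1)[OF X' Y'] by simp
  show "inn ?H X Y = inn ?H Y X"
    using LIMSEQ_unique[OF inn_representative_tendsto[OF X Y]] inn_representative_tendsto[OF Y X]
      inn_commute representative_carr[OF X'] representative_carr[OF Y'] by simp
  show "inn ?H (vadd ?H X Y) Z = inn ?H X Z + inn ?H Y Z" if Z: "Z \<in> carr ?H"
    using mm[unfolded mult_on_def, rule_format, of "[X, Z]" 0 X Y] X' Y' Z
    by (simp add: inn_hilbert_completion tuples_def)
qed

text \<open>The completion has two candidates for a norm, the limit of the norms and the square root
  of the limit inner product; continuity of the square root identifies them.\<close>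

lemma nrm_hilbert_completion:
  assumes "X \<in> carr (hilbert_completion V)"
  shows "nrm (normed_of (hilbert_completion V)) X = nrm (banach_completion (normed_of V)) X"
proof -
  have X: "X \<in> carr (banach_completion (normed_of V))" using assms by simp
  have "(\<lambda>k. nrm (normed_of V) (representative X k)) \<longlonglongrightarrow> nrm (normed_of (hilbert_completion V)) X"
    using tendsto_real_sqrt[OF inn_representative_tendsto[OF assms assms]] by (simp add: normed_of_def)
  moreover have "(\<lambda>k. nrm (normed_of V) (representative X k)) \<longlonglongrightarrow> nrm (banach_completion (normed_of V)) X"
    using nrm_class[OF representative_cauchy[OF X]] class_representative[OF X] by simp
  ultimately show ?thesis by (rule LIMSEQ_unique)
qed

lemma blin_hilbert_completion:
  assumes "blin (normed_of V) T B" "0 \<le> B"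
  shows "blin (normed_of (hilbert_completion V)) (cext T) B"
  using blin_cext[OF seminormed_axioms assms] nrm_hilbert_completion
  unfolding blin_def by (simp add: normed_of_def)

end

section \<open>The algebraic Hilbert tensor product\<close>

abbreviation prod_form :: "'a ispace list \<Rightarrow> 'a list \<Rightarrow> 'a list \<Rightarrow> real" where
  "prod_form Es xs ys \<equiv> \<Prod>i<length Es. inn (Es ! i) (xs ! i) (ys ! i)"

lemma prod_form_commute:
  assumes "\<And>E. E \<in> set Es \<Longrightarrow> semi_inner E" "xs \<in> tuples Es" "ys \<in> tuples Es"
  shows "prod_form Es xs ys = prod_form Es ys xs"
proof (rule prod.cong[OF refl])
  fix i assume "i \<in> {..<length Es}"
  then have i: "i < length Es" by simp
  interpret E: semi_inner "Es ! i" using assms(1) i by simp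
  show "inn (Es ! i) (xs ! i) (ys ! i) = inn (Es ! i) (ys ! i) (xs ! i)"
    using assms(2,3) i by (intro E.inn_commute) (auto simp: tuples_iff)
qed

lemma mult_on_prod_form:
  assumes Es: "\<And>E. E \<in> set Es \<Longrightarrow> semi_inner E" and ys: "ys \<in> tuples Es"
  shows "mult_on Es (\<lambda>xs. prod_form Es xs ys)"
  unfolding mult_on_def
proof (intro ballI allI impI)
  fix xs i x y and c :: real
  assume xs: "xs \<in> tuples Es" and i: "i < length Es" and x: "x \<in> carr (Es ! i)" and y: "y \<in> carr (Es ! i)"
  interpret E: semi_inner "Es ! i" using Es i by simp
  have yi: "ys ! i \<in> carr (Es ! i)" using ys i by (simp add: tuples_iff)
  have "prod_form Es (xs[i := z]) ys = inn (Es ! i) z (ys ! i) * (\<Prod>j\<in>{..<length Es} - {i}. inn (Es ! j) (xs ! j) (ys ! j))" for z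
    using i xs by (subst prod.remove[of _ i]) (auto simp: tuples_iff intro!: prod.cong)
  then show "prod_form Es (xs[i := vadd (Es ! i) x y]) ys = prod_form Es (xs[i := x]) ys + prod_form Es (xs[i := y]) ys \<and>
     prod_form Es (xs[i := vscale (Es ! i) c x]) ys = c *\<^sub>R prod_form Es (xs[i := x]) ys"
    using E.inn_add[OF x y yi] E.inn_scale[OF x yi] by (simp add: distrib_right)
qed

lemma alg_hilbert_tensor_simps [simp]:
  "carr (alg_hilbert_tensor Es) = carr (alg_tensor Es)"
  "vadd (alg_hilbert_tensor Es) = (\<lambda>u v A. u A + v A)"
  "vscale (alg_hilbert_tensor Es) = (\<lambda>c u A. c * u A)"
  by (simp_all add: alg_hilbert_tensor_def alg_tensor_def)

section \<open>The semi-inner product induced on the algebraic tensor product\<close>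

context
  fixes Es :: "'a ispace list"
  assumes Es: "\<And>E. E \<in> set Es \<Longrightarrow> semi_inner E"
begin

lemma inn_alg_hilbert:
  assumes cs: "over_tuples Es cs" and ds: "over_tuples Es ds"
  shows "inn (alg_hilbert_tensor Es) (tensor_sum Es cs) (tensor_sum Es ds) = lsum (\<lambda>ys. lsum (\<lambda>xs. prod_form Es xs ys) cs) ds"
proof -
  let ?u = "tensor_sum Es cs"
  have val: "?u (\<lambda>xs. prod_form Es xs ys) = lsum (\<lambda>xs. prod_form Es xs ys) cs" if "ys \<in> tuples Es" for ys
    by (rule tensor_sum_apply[OF mult_on_prod_form[OF Es that]])
  have sym: "lsum (\<lambda>xs. prod_form Es xs ys) cs = lsum (\<lambda>xs. prod_form Es ys xs) cs" if "ys \<in> tuples Es" for ys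
    by (rule lsum_cong, rule prod_form_commute[OF Es _ that]) (use cs in \<open>auto simp: over_tuples_def\<close>)
  \<comment> \<open>A tensor is 0 by convention at functions that are not multilinear, so the outer
    evaluation in the definition yields the double sum only after this is known.\<close>
  have "mult_on Es (\<lambda>ys. ?u (\<lambda>xs. prod_form Es xs ys))"
    unfolding mult_on_def
  proof (intro ballI allI impI)
    fix ys i x y and c :: real
    assume ys: "ys \<in> tuples Es" and i: "i < length Es" and x: "x \<in> carr (Es ! i)" and y: "y \<in> carr (Es ! i)"
    interpret E: semi_inner "Es ! i" using Es i by simp
    have mem: "z \<in> snd ` set cs \<Longrightarrow> z \<in> tuples Es" for z using cs by (auto simp: over_tuples_def)
    have upd: "?u (\<lambda>xs. prod_form Es xs (ys[i := z])) = lsum (\<lambda>xs. prod_form Es (ys[i := z]) xs) cs"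
      if "z \<in> carr (Es ! i)" for z
      using val[OF tuples_update[OF ys that]] sym[OF tuples_update[OF ys that]] by simp
    have "prod_form Es (ys[i := vadd (Es ! i) x y]) z = prod_form Es (ys[i := x]) z + prod_form Es (ys[i := y]) z"
      "prod_form Es (ys[i := vscale (Es ! i) c x]) z = c *\<^sub>R prod_form Es (ys[i := x]) z"
      if "z \<in> snd ` set cs" for z
    proof -
      have "mult_on Es (\<lambda>xs. prod_form Es xs z)" by (rule mult_on_prod_form[OF Es mem[OF that]])
      from this[unfolded mult_on_def, rule_format, OF ys i x y]
      show "prod_form Es (ys[i := vadd (Es ! i) x y]) z = prod_form Es (ys[i := x]) z + prod_form Es (ys[i := y]) z"
        "prod_form Es (ys[i := vscale (Es ! i) c x]) z = c *\<^sub>R prod_form Es (ys[i := x]) z" by simp_all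
    qed
    then show "?u (\<lambda>xs. prod_form Es xs (ys[i := vadd (Es ! i) x y])) =
        ?u (\<lambda>xs. prod_form Es xs (ys[i := x])) + ?u (\<lambda>xs. prod_form Es xs (ys[i := y])) \<and>
        ?u (\<lambda>xs. prod_form Es xs (ys[i := vscale (Es ! i) c x])) = c *\<^sub>R ?u (\<lambda>xs. prod_form Es xs (ys[i := x]))"
      unfolding upd[OF x] upd[OF y] upd[OF E.iadd_closed[OF x y]] upd[OF E.iscale_closed[OF x]]
        lsum_plus[symmetric] lsum_scaleR[symmetric]
      by (intro conjI lsum_cong)
  qed
  then have "inn (alg_hilbert_tensor Es) ?u (tensor_sum Es ds) = lsum (\<lambda>ys. ?u (\<lambda>xs. prod_form Es xs ys)) ds"
    by (simp add: alg_hilbert_tensor_def tensor_sum_apply)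
  also have "\<dots> = lsum (\<lambda>ys. lsum (\<lambda>xs. prod_form Es xs ys) cs) ds"
    by (rule lsum_cong, rule val) (use ds in \<open>auto simp: over_tuples_def\<close>)
  finally show ?thesis .
qed

text \<open>Positivity is left as a hypothesis here; for the spaces at hand it is obtained by
  approximation from the algebraic Fock space.\<close>

lemma semi_inner_alg_hilbert:
  assumes nonneg: "\<And>cs. over_tuples Es cs \<Longrightarrow> 0 \<le> lsum (\<lambda>ys. lsum (\<lambda>xs. prod_form Es xs ys) cs) cs"
  shows "semi_inner_completion (alg_hilbert_tensor Es)"
proof -
  let ?V = "alg_hilbert_tensor Es"
  interpret semi_inner ?V
  proof
    fix x y z :: "('a list \<Rightarrow> real) \<Rightarrow> real" and c :: real
    assume x: "x \<in> carr ?V"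
    then have x': "x \<in> carr (alg_tensor Es)" by simp
    obtain cs where cs: "over_tuples Es cs" "x = tensor_sum Es cs" using x by (auto simp: carr_alg_tensor)
    show "vscale ?V c x \<in> carr ?V" using alg_tensor_closed(2)[OF x'] by simp
    show "0 \<le> inn ?V x x" unfolding cs(2) inn_alg_hilbert[OF cs(1) cs(1)] by (rule nonneg[OF cs(1)])
    show "inn ?V (vscale ?V c x) z = c * inn ?V x z" if "z \<in> carr ?V"
    proof -
      obtain ds where ds: "over_tuples Es ds" "z = tensor_sum Es ds" using \<open>z \<in> carr ?V\<close> by (auto simp: carr_alg_tensor)
      show ?thesis
        using inn_alg_hilbert[of "scale_list c cs" ds] inn_alg_hilbert[of cs ds] cs ds
        by (simp add: tensor_sum_scale lsum_scale lsum_mult)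
    qed
    assume y: "y \<in> carr ?V"
    then have y': "y \<in> carr (alg_tensor Es)" by simp
    obtain es where es: "over_tuples Es es" "y = tensor_sum Es es" using y by (auto simp: carr_alg_tensor)
    show "vadd ?V x y \<in> carr ?V" using alg_tensor_closed(1)[OF x' y'] by simp
    show "inn ?V (vadd ?V x y) z = inn ?V x z + inn ?V y z" if "z \<in> carr ?V"
    proof -
      obtain ds where ds: "over_tuples Es ds" "z = tensor_sum Es ds" using \<open>z \<in> carr ?V\<close> by (auto simp: carr_alg_tensor)
      show ?thesis
        using inn_alg_hilbert[of "cs @ es" ds] inn_alg_hilbert[of cs ds] inn_alg_hilbert[of es ds] cs ds es
        by (simp add: tensor_sum_append lsum_plus)
    qed
    show "inn ?V x y = inn ?V y x"
    proof -
      have "lsum (\<lambda>ys. lsum (\<lambda>xs. prod_form Es xs ys) cs) es = lsum (\<lambda>ys. lsum (\<lambda>xs. prod_form Es ys xs) cs) es"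
        using cs(1) es(1) by (intro lsum_cong prod_form_commute[OF Es]) (auto simp: over_tuples_def)
      then show ?thesis
        unfolding cs(2) es(2) inn_alg_hilbert[OF cs(1) es(1)] inn_alg_hilbert[OF es(1) cs(1)] by (rule trans[OF _ lsum_swap])
    qed
  qed
  have "seminormed (normed_of ?V)"
    by (rule seminormedI[where ev = "\<lambda>u. u"])
       (use nrm_vadd_le nrm_vscale iadd_closed iscale_closed in \<open>simp_all del: normed_of_simps(4)\<close>, auto)
  then show ?thesis by (simp add: semi_inner_completion_def semi_inner_axioms)
qed

lemma blin_alg_hilbert:
  assumes m: "mult_on Es \<Phi>"
    and B: "\<And>cs. over_tuples Es cs \<Longrightarrow>
      norm (lsum \<Phi> cs) \<le> B * sqrt (lsum (\<lambda>ys. lsum (\<lambda>xs. prod_form Es xs ys) cs) cs)"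
  shows "blin (normed_of (alg_hilbert_tensor Es)) (tens_ext Es \<Phi>) B"
proof -
  have "norm (tens_ext Es \<Phi> u) \<le> B * sqrt (inn (alg_hilbert_tensor Es) u u)" if "u \<in> carr (alg_tensor Es)" for u
  proof -
    obtain cs where cs: "over_tuples Es cs" "u = tensor_sum Es cs" using \<open>u \<in> _\<close> by (auto simp: carr_alg_tensor)
    show ?thesis
      unfolding cs(2) inn_alg_hilbert[OF cs(1) cs(1)] tens_ext_tensor_sum[OF m cs(1)] by (rule B[OF cs(1)])
  qed
  then show ?thesis
    unfolding blin_def using tens_ext_linear[OF m] by (simp add: normed_of_def alg_hilbert_tensor_def alg_tensor_def)
qed

end

section \<open>Extension to the completed tensor products\<close>

lemma fock_mult_assoc: "fock_mult (fock_mult u v) w = fock_mult u (fock_mult v w)"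
proof (induction u rule: fock_induct)
  case (tensor xs)
  show ?case
  proof (induction v rule: fock_induct)
    case (tensor ys)
    show ?case
      by (induction w rule: fock_induct)
         (simp_all add: fock_mult_tensor linear_add[OF linear_fock_mult_right] linear_scale[OF linear_fock_mult_right])
  qed (simp_all add: linear_add[OF linear_fock_mult_right] linear_scale[OF linear_fock_mult_right]
      linear_add[OF linear_fock_mult_left] linear_scale[OF linear_fock_mult_left])
qed (simp_all add: linear_add[OF linear_fock_mult_left] linear_scale[OF linear_fock_mult_left])

lemma fock_mult_one_left: "fock_mult (tensor []) v = v"
  by (induction v rule: fock_induct)
     (simp_all add: fock_mult_tensor linear_add[OF linear_fock_mult_right] linear_scale[OF linear_fock_mult_right])

lemma fock_prod_append: "fock_prod (us @ vs) = fock_mult (fock_prod us) (fock_prod vs)"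
  by (induction us) (simp_all add: fock_mult_assoc fock_mult_one_left)

lemma alg_power_simps [simp]:
  "carr (alg_power n) = {u. degree_part n u = u}" "vadd (alg_power n) = (+)"
  "vscale (alg_power n) = (*\<^sub>R)" "inn (alg_power n) = fock_inner"
  by (simp_all add: alg_power_def)

lemma semi_inner_alg_power: "semi_inner_completion (alg_power n)"
proof -
  interpret semi_inner "alg_power n"
    by standard (auto simp: homogeneous_add homogeneous_scale fock_inner_add_left
        fock_inner_scale_left fock_inner_nonneg intro: fock_inner_commute)
  have "seminormed (normed_of (alg_power n))"
    by (rule seminormedI[where ev = "\<lambda>u (_ :: unit). u"])
       (use nrm_vadd_le nrm_vscale iadd_closed iscale_closed in \<open>simp_all del: normed_of_simps(4)\<close>)
  then show ?thesis by (simp add: semi_inner_completion_def semi_inner_axioms)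
qed

abbreviation apower :: "nat \<Rightarrow> 'h::real_inner fock nspace" where
  "apower n \<equiv> normed_of (alg_power n)"

abbreviation npower :: "nat \<Rightarrow> (nat \<Rightarrow> 'h::real_inner fock) set nspace" where
  "npower n \<equiv> normed_of (hilbert_power n)"

lemma seminormed_apower: "seminormed (apower n)"
  by (rule semi_inner_alg_power[unfolded semi_inner_completion_def, THEN conjunct2])

lemma apower_simps [simp]:
  "carr (apower n) = {u. degree_part n u = u}" "vadd (apower n) = (+)"
  "vscale (apower n) = (*\<^sub>R)" "nrm (apower n) = fock_norm"
  by (auto simp: normed_of_def fock_norm_def)

lemma seminormed_apowers: "E \<in> set (map apower ns) \<Longrightarrow> seminormed E"
  using seminormed_apower by auto

lemma semi_inner_hilbert_power: "semi_inner (hilbert_power n)"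
  unfolding hilbert_power_def
  by (rule semi_inner_completion.semi_inner_hilbert_completion[OF semi_inner_alg_power])

lemma semi_inner_hilbert_powers: "E \<in> set (map hilbert_power ns) \<Longrightarrow> semi_inner E"
  using semi_inner_hilbert_power by auto

lemma hilbert_power_simps [simp]:
  "carr (hilbert_power n) = carr (banach_completion (apower n))"
  "vadd (hilbert_power n) = vadd (banach_completion (apower n))"
  "vscale (hilbert_power n) = vscale (banach_completion (apower n))"
  by (simp_all add: hilbert_power_def)

lemma npower_simps [simp]:
  "carr (npower n) = carr (banach_completion (apower n))"
  "vadd (npower n) = vadd (banach_completion (apower n))"
  "vscale (npower n) = vscale (banach_completion (apower n))"
  by (simp_all add: normed_of_def)

lemma nrm_npower: "X \<in> carr (banach_completion (apower n)) \<Longrightarrow> nrm (npower n) X = nrm (banach_completion (apower n)) X"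
  using semi_inner_completion.nrm_hilbert_completion[OF semi_inner_alg_power, of X n] by (simp add: hilbert_power_def)

lemma nonneg_npowers: "E \<in> set (map npower ns) \<Longrightarrow> nonneg_space E"
  using semi_inner.nonneg_space_normed_of[OF semi_inner_hilbert_power] by auto

lemma tuples_apower: "us \<in> tuples (map apower ns) \<longleftrightarrow> homogeneous_list ns us"
  by (auto simp: tuples_iff homogeneous_list_def list_all2_conv_all_nth)

lemma tuples_hilbert_power: "tuples (map hilbert_power ns) = tuples (map banach_completion (map apower ns))"
  and tuples_npower: "tuples (map npower ns) = tuples (map banach_completion (map apower ns))"
  by (auto simp: tuples_iff)

lemma completion_apower:
  assumes "Xs \<in> tuples (map hilbert_power ns)"
  shows "cauchy_tuple (map apower ns) (map representative Xs)" "length Xs = length ns"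
    and "\<And>i. i < length (map apower ns) \<Longrightarrow> Xs ! i = cauchy_class (map apower ns ! i) (map representative Xs ! i)"
proof -
  have sn: "\<And>E. E \<in> set (map apower ns) \<Longrightarrow> seminormed E" by (rule seminormed_apowers)
  note Xs = assms[unfolded tuples_hilbert_power]
  show "cauchy_tuple (map apower ns) (map representative Xs)" by (rule tuples_completion(1)[OF sn Xs])
  show "length Xs = length ns" using assms by (simp add: tuples_iff)
  show "Xs ! i = cauchy_class (map apower ns ! i) (map representative Xs ! i)" if "i < length (map apower ns)" for i
    by (rule tuples_completion(3)[OF sn Xs]) (use that in auto)
qed

text \<open>Multilinearity involves neither norms nor inner products, so it passes between
  \<open>hilbert_power\<close>, \<open>npower\<close> and the completions of \<open>apower\<close>,
  which share carriers and operations.\<close>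

lemma mult_on_cong:
  assumes "length Es = length Fs"
    and "\<And>i. i < length Es \<Longrightarrow> carr (Es ! i) = carr (Fs ! i) \<and> vadd (Es ! i) = vadd (Fs ! i) \<and> vscale (Es ! i) = vscale (Fs ! i)"
  shows "mult_on Es \<Phi> \<longleftrightarrow> mult_on Fs \<Phi>"
proof -
  have "tuples Es = tuples Fs" using assms by (auto simp: tuples_iff)
  then show ?thesis using assms unfolding mult_on_def by simp
qed

lemma tuples_append: "xs \<in> tuples Es \<Longrightarrow> ys \<in> tuples Fs \<Longrightarrow> xs @ ys \<in> tuples (Es @ Fs)"
  by (auto simp: tuples_def intro: list_all2_appendI)

lemma mult_on_append_left:
  assumes m: "mult_on (Es @ Fs) \<Phi>" and ys: "ys \<in> tuples Fs"
  shows "mult_on Es (\<lambda>xs. \<Phi> (xs @ ys))"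
  unfolding mult_on_def
proof (intro ballI allI impI)
  fix xs i x y and c :: real
  assume xs: "xs \<in> tuples Es" and i: "i < length Es" and x: "x \<in> carr (Es ! i)" and y: "y \<in> carr (Es ! i)"
  have "(xs @ ys)[i := z] = xs[i := z] @ ys" for z using xs i by (simp add: list_update_append tuples_iff)
  then show "\<Phi> (xs[i := vadd (Es ! i) x y] @ ys) = \<Phi> (xs[i := x] @ ys) + \<Phi> (xs[i := y] @ ys) \<and>
     \<Phi> (xs[i := vscale (Es ! i) c x] @ ys) = c *\<^sub>R \<Phi> (xs[i := x] @ ys)"
    using m[unfolded mult_on_def, rule_format, OF tuples_append[OF xs ys], of i x y c] i x y
    by (simp add: nth_append)
qed

lemma mult_on_append_right:
  assumes m: "mult_on (Es @ Fs) \<Phi>" and xs: "xs \<in> tuples Es"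
  shows "mult_on Fs (\<lambda>ys. \<Phi> (xs @ ys))"
  unfolding mult_on_def
proof (intro ballI allI impI)
  fix ys i x y and c :: real
  assume ys: "ys \<in> tuples Fs" and i: "i < length Fs" and x: "x \<in> carr (Fs ! i)" and y: "y \<in> carr (Fs ! i)"
  have "(xs @ ys)[length Es + i := z] = xs @ ys[i := z]" for z using xs by (simp add: list_update_append tuples_iff)
  then show "\<Phi> (xs @ ys[i := vadd (Fs ! i) x y]) = \<Phi> (xs @ ys[i := x]) + \<Phi> (xs @ ys[i := y]) \<and>
     \<Phi> (xs @ ys[i := vscale (Fs ! i) c x]) = c *\<^sub>R \<Phi> (xs @ ys[i := x])"
    using m[unfolded mult_on_def, rule_format, OF tuples_append[OF xs ys], of "length Es + i" x y c] i x y
    by (simp add: nth_append)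
qed

lemma cext_plus:
  assumes V: "seminormed V" and T: "blin V T B" "0 \<le> B" "blin V T' B'" "0 \<le> B'" "blin V T'' B''" "0 \<le> B''"
    and eq: "\<And>v. v \<in> carr V \<Longrightarrow> T'' v = T v + T' v" and X: "X \<in> carr (banach_completion V)"
  shows "cext T'' X = cext T X + cext T' X"
  using LIMSEQ_unique[OF cext_representative[OF V T(5,6) X]]
    tendsto_add[OF cext_representative[OF V T(1,2) X] cext_representative[OF V T(3,4) X]]
    eq[OF seminormed.representative_carr[OF V X]] by simp

lemma cext_scale:
  assumes V: "seminormed V" and T: "blin V T B" "0 \<le> B" "blin V T'' B''" "0 \<le> B''"
    and eq: "\<And>v. v \<in> carr V \<Longrightarrow> T'' v = c *\<^sub>R T v" and X: "X \<in> carr (banach_completion V)"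
  shows "cext T'' X = c *\<^sub>R cext T X"
  using LIMSEQ_unique[OF cext_representative[OF V T(3,4) X]]
    tendsto_scaleR[OF tendsto_const cext_representative[OF V T(1,2) X], of c]
    eq[OF seminormed.representative_carr[OF V X]] by simp

lemma fock_norm_prod:
  assumes "homogeneous_list ns us"
  shows "fock_norm (fock_prod us) = (\<Prod>u\<leftarrow>us. fock_norm u)"
proof -
  have "fock_inner (fock_prod us) (fock_prod us) = (\<Prod>u\<leftarrow>us. fock_inner u u)"
    using fock_inner_prod[OF assms assms] by (simp add: zip_same_conv_map comp_def)
  moreover have "sqrt (\<Prod>u\<leftarrow>us. fock_inner u u) = (\<Prod>u\<leftarrow>us. sqrt (fock_inner u u))"
    by (induction us) (simp_all add: real_sqrt_mult)
  ultimately show ?thesis by (simp add: fock_norm_def)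
qed

lemma prod_nrm_apower:
  assumes "homogeneous_list ns us"
  shows "(\<Prod>i<length (map apower ns). nrm (map apower ns ! i) (us ! i)) = (\<Prod>u\<leftarrow>us. fock_norm u)"
proof -
  have "length us = length ns" using assms by (auto simp: homogeneous_list_def dest: list_all2_lengthD)
  then show ?thesis by (simp add: prod.list_conv_set_nth atLeast0LessThan)
qed

text \<open>The degrees \<open>ls\<close> belong to the blocks of L and \<open>ms\<close> to those
  of J. In \<open>bound\<close> the element \<open>U\<close> is arbitrary in its degree and not only
  a product, which gives continuity for the Hilbert norm; the other factors enter one by one, as for
  the projective norm. The set \<open>S\<close> is closed and a subspace because the extension
  alternates between limits and linear combinations.\<close>

locale fock_extension =
  fixes \<Lambda> :: "'h::real_inner fock \<Rightarrow> 'b::banach" and ls ms :: "nat list" and Bd :: real and S :: "'b set"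
  assumes linear_\<Lambda>: "linear \<Lambda>" and Bd: "0 \<le> Bd"
    and bound: "\<And>U vs. degree_part (sum_list ls) U = U \<Longrightarrow> homogeneous_list ms vs \<Longrightarrow>
      norm (\<Lambda> (fock_mult U (fock_prod vs))) \<le> Bd * fock_norm U * (\<Prod>v\<leftarrow>vs. fock_norm v)"
    and S: "closed S" "subspace S" "\<And>u. \<Lambda> u \<in> S"
begin

definition base :: "'h fock list \<Rightarrow> 'b" where
  "base us = \<Lambda> (fock_prod us)"

lemma base_mult_on: "mult_on (map apower (ls @ ms)) base"
proof -
  have "multilinear base"
    unfolding base_def by (rule multilinear_linear[OF multilinear_fock_prod linear_\<Lambda>])
  then show ?thesis by (auto simp: mult_on_def multilinear_def tuples_iff simp del: map_append)
qed

lemma base_mbounded: "mbounded (map apower (ls @ ms)) base Bd"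
  unfolding mbounded_def
proof
  fix us :: "'h fock list" assume "us \<in> tuples (map apower (ls @ ms))"
  then have h: "homogeneous_list (ls @ ms) us" by (simp add: tuples_apower del: map_append)
  then obtain u v where uv: "us = u @ v" "homogeneous_list ls u" "homogeneous_list ms v"
    unfolding homogeneous_list_def list_all2_append1 by blast
  have "norm (base us) \<le> Bd * fock_norm (fock_prod u) * (\<Prod>v\<leftarrow>v. fock_norm v)"
    unfolding base_def uv(1) fock_prod_append by (rule bound[OF degree_part_fock_prod[OF uv(2)] uv(3)])
  also have "\<dots> = Bd * (\<Prod>u\<leftarrow>us. fock_norm u)"
    by (simp add: fock_norm_prod[OF uv(2)] uv(1))
  finally show "norm (base us) \<le> Bd * (\<Prod>i<length (map apower (ls @ ms)). nrm (map apower (ls @ ms) ! i) (us ! i))"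
    unfolding prod_nrm_apower[OF h] .
qed

definition \<Psi> :: "'h power list \<Rightarrow> 'b" where
  "\<Psi> = mext base"

lemma \<Psi>_mult_on: "mult_on (map hilbert_power ls @ map hilbert_power ms) \<Psi>"
proof -
  have "mult_on (map banach_completion (map apower (ls @ ms))) \<Psi>"
    unfolding \<Psi>_def by (rule mext_mult_on[OF seminormed_apowers base_mult_on base_mbounded Bd])
  also have "?this \<longleftrightarrow> mult_on (map hilbert_power (ls @ ms)) \<Psi>"
    by (rule mult_on_cong) (simp_all del: map_append)
  finally show ?thesis by simp
qed

abbreviation rep_at :: "nat \<Rightarrow> 'h power list \<Rightarrow> 'h fock list" where
  "rep_at k xs \<equiv> map (\<lambda>X. representative X k) xs"

lemma rep_at_homogeneous:
  assumes "xs \<in> tuples (map hilbert_power ns)"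
  shows "homogeneous_list ns (rep_at k xs)"
proof -
  have "at_index (map representative xs) k \<in> tuples (map apower ns)"
    by (rule cauchy_tuple_at[OF seminormed_apowers[of _ ns] completion_apower(1)[OF assms]])
  then show ?thesis by (simp add: tuples_apower comp_def)
qed

lemma \<Psi>_tendsto:
  assumes xs: "xs \<in> tuples (map hilbert_power ls)" and ys: "ys \<in> tuples (map hilbert_power ms)"
  shows "(\<lambda>k. base (rep_at k xs @ rep_at k ys)) \<longlonglongrightarrow> \<Psi> (xs @ ys)"
proof -
  have "xs @ ys \<in> tuples (map hilbert_power (ls @ ms))"
    using tuples_append[OF xs ys] by simp
  note t = completion_apower[OF this]
  have "(\<lambda>k. base (at_index (map representative (xs @ ys)) k)) \<longlonglongrightarrow> \<Psi> (xs @ ys)"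
    unfolding \<Psi>_def
    by (rule mext_tendsto[OF seminormed_apowers[of _ "ls @ ms"] base_mult_on base_mbounded Bd t(1) _ t(3)]) (use t(2) in auto)
  then show ?thesis by (simp add: comp_def)
qed

text \<open>Collapses a combination of tuples from the completed powers into one homogeneous element
  of the algebraic Fock space, which can be inserted for \<open>U\<close> in
  \<open>bound\<close>.\<close>

definition approx :: "nat \<Rightarrow> (real \<times> 'h power list) list \<Rightarrow> 'h fock" where
  "approx k cs = lsum (\<lambda>xs. fock_prod (rep_at k xs)) cs"

lemma approx_homogeneous:
  assumes "over_tuples (map hilbert_power ls) cs"
  shows "degree_part (sum_list ls) (approx k cs) = approx k cs"
proof -
  have "lsum (\<lambda>xs. degree_part (sum_list ls) (fock_prod (rep_at k xs))) cs = lsum (\<lambda>xs. fock_prod (rep_at k xs)) cs"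
    using assms by (intro lsum_cong degree_part_fock_prod rep_at_homogeneous) (auto simp: over_tuples_def)
  then show ?thesis by (simp add: approx_def lsum_linear[OF linear_degree_part])
qed

text \<open>Realises the inner product on tensors of completed powers as a limit of Fock inner
  products. Both its positivity and the bound for the Hilbert norm rest on this.\<close>

lemma fock_inner_approx_tendsto:
  assumes cs: "over_tuples (map hilbert_power ls) cs"
  shows "(\<lambda>k. fock_inner (approx k cs) (approx k cs)) \<longlonglongrightarrow>
    lsum (\<lambda>ys. lsum (\<lambda>xs. prod_form (map hilbert_power ls) xs ys) cs) cs"
proof -
  have "fock_inner (approx k cs) (approx k cs) =
      lsum (\<lambda>ys. lsum (\<lambda>xs. fock_inner (fock_prod (rep_at k xs)) (fock_prod (rep_at k ys))) cs) cs" for k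
    unfolding approx_def lsum_linear[OF linear_fock_inner_right] lsum_linear[OF linear_fock_inner_left] ..
  moreover have "(\<lambda>k. fock_inner (fock_prod (rep_at k xs)) (fock_prod (rep_at k ys))) \<longlonglongrightarrow> prod_form (map hilbert_power ls) xs ys"
    if xs: "xs \<in> tuples (map hilbert_power ls)" and ys: "ys \<in> tuples (map hilbert_power ls)" for xs ys
  proof -
    have len: "length xs = length ls" "length ys = length ls" using xs ys by (auto simp: tuples_iff)
    have "fock_inner (fock_prod (rep_at k xs)) (fock_prod (rep_at k ys)) =
        (\<Prod>i<length ls. fock_inner (representative (xs ! i) k) (representative (ys ! i) k))" for k
      unfolding fock_inner_prod[OF rep_at_homogeneous[OF xs] rep_at_homogeneous[OF ys]]
      by (simp add: prod.list_conv_set_nth len atLeast0LessThan)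
    moreover have "(\<lambda>k. \<Prod>i<length ls. fock_inner (representative (xs ! i) k) (representative (ys ! i) k)) \<longlonglongrightarrow>
        prod_form (map hilbert_power ls) xs ys"
      unfolding length_map
    proof (rule tendsto_prod)
      fix i assume "i \<in> {..<length ls}"
      then have i: "i < length ls" by simp
      interpret P: semi_inner_completion "alg_power (ls ! i)" by (rule semi_inner_alg_power)
      show "(\<lambda>k. fock_inner (representative (xs ! i) k) (representative (ys ! i) k)) \<longlonglongrightarrow>
          inn (map hilbert_power ls ! i) (xs ! i) (ys ! i)"
        using P.inn_representative_tendsto[of "xs ! i" "ys ! i"] xs ys i
        by (simp add: tuples_iff hilbert_power_def[symmetric])
    qed
    ultimately show ?thesis by simp
  qed
  ultimately show ?thesis
    using cs unfolding over_tuples_def by (simp only:, intro tendsto_lsum) blast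
qed

text \<open>Positivity, because the expression is a limit of squared Fock norms of homogeneous
  elements.\<close>

sublocale A: semi_inner_completion "alg_hilbert_tensor (map hilbert_power ls :: 'h power ispace list)"
proof (rule semi_inner_alg_hilbert)
  fix E :: "'h power ispace" assume "E \<in> set (map hilbert_power ls)"
  then show "semi_inner E" by (rule semi_inner_hilbert_powers)
next
  fix cs :: "(real \<times> 'h power list) list" assume cs: "over_tuples (map hilbert_power ls) cs"
  show "0 \<le> lsum (\<lambda>ys. lsum (\<lambda>xs. prod_form (map hilbert_power ls) xs ys) cs) cs"
    by (rule LIMSEQ_le_const[OF fock_inner_approx_tendsto[OF cs]])
       (use fock_inner_nonneg[OF approx_homogeneous[OF cs]] in auto)
qed

abbreviation nprod :: "'h power list \<Rightarrow> real" where
  "nprod ys \<equiv> \<Prod>i<length ms. nrm (npower (ms ! i)) (ys ! i)"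

lemma nprod_nonneg: "ys \<in> tuples (map npower ms) \<Longrightarrow> 0 \<le> nprod ys"
  using nrm_prod_nonneg[OF nonneg_npowers, where xs = ys and Es = "map npower ms"] by simp

text \<open>The limit of the inequality \<open>bound\<close> for the approximating elements: the
  image, the Hilbert norm of the first factor and the norms of the others all converge.\<close>

lemma lsum_\<Psi>_bound:
  assumes cs: "over_tuples (map hilbert_power ls) cs" and ys: "ys \<in> tuples (map hilbert_power ms)"
  shows "norm (lsum (\<lambda>xs. \<Psi> (xs @ ys)) cs) \<le>
    (Bd * nprod ys) * sqrt (lsum (\<lambda>ys. lsum (\<lambda>xs. prod_form (map hilbert_power ls) xs ys) cs) cs)"
    (is "_ \<le> (Bd * nprod ys) * sqrt ?I")
proof (rule LIMSEQ_le)
  have "(\<lambda>k. lsum (\<lambda>xs. base (rep_at k xs @ rep_at k ys)) cs) \<longlonglongrightarrow> lsum (\<lambda>xs. \<Psi> (xs @ ys)) cs"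
    using cs by (intro tendsto_lsum \<Psi>_tendsto ys) (auto simp: over_tuples_def)
  moreover have "lsum (\<lambda>xs. base (rep_at k xs @ rep_at k ys)) cs = \<Lambda> (fock_mult (approx k cs) (fock_prod (rep_at k ys)))" for k
    unfolding approx_def base_def fock_prod_append lsum_linear[OF linear_fock_mult_left] lsum_linear[OF linear_\<Lambda>] ..
  ultimately have "(\<lambda>k. \<Lambda> (fock_mult (approx k cs) (fock_prod (rep_at k ys)))) \<longlonglongrightarrow> lsum (\<lambda>xs. \<Psi> (xs @ ys)) cs"
    by simp
  from tendsto_norm[OF this]
  show "(\<lambda>k. norm (\<Lambda> (fock_mult (approx k cs) (fock_prod (rep_at k ys))))) \<longlonglongrightarrow> norm (lsum (\<lambda>xs. \<Psi> (xs @ ys)) cs)" .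
  let ?P = "map apower ms :: 'h fock nspace list"
  have "(\<lambda>k. \<Prod>i<length (?P). nrm (?P ! i) (at_index (map representative ys) k ! i)) \<longlonglongrightarrow>
      (\<Prod>i<length (?P). nrm (banach_completion (?P ! i)) (ys ! i))"
  proof (rule nrm_prod_tendsto)
    show "seminormed E" if "E \<in> set (?P)" for E
      using that by (rule seminormed_apowers)
    show "cauchy_tuple (?P) (map representative ys)" by (rule completion_apower(1)[OF ys])
    show "ys ! i = cauchy_class (?P ! i) (map representative ys ! i)" if "i < length (?P)" for i
      by (rule completion_apower(3)[OF ys that])
  qed
  also have "(\<lambda>k. \<Prod>i<length (?P). nrm (?P ! i) (at_index (map representative ys) k ! i)) =
      (\<lambda>k. \<Prod>v\<leftarrow>rep_at k ys. fock_norm v)"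
    using prod_nrm_apower[OF rep_at_homogeneous[OF ys]] by (simp add: comp_def)
  also have "(\<Prod>i<length (?P). nrm (banach_completion (?P ! i)) (ys ! i)) = nprod ys"
    unfolding length_map
    by (rule prod.cong[OF refl]) (use ys in \<open>auto simp: tuples_iff nrm_npower\<close>)
  finally show "(\<lambda>k. (Bd * (\<Prod>v\<leftarrow>rep_at k ys. fock_norm v)) * fock_norm (approx k cs)) \<longlonglongrightarrow> (Bd * nprod ys) * sqrt ?I"
    unfolding fock_norm_def[of "approx _ cs"]
    by (intro tendsto_mult tendsto_const tendsto_real_sqrt fock_inner_approx_tendsto[OF cs])
  show "\<exists>N. \<forall>k\<ge>N. norm (\<Lambda> (fock_mult (approx k cs) (fock_prod (rep_at k ys)))) \<le>
      (Bd * (\<Prod>v\<leftarrow>rep_at k ys. fock_norm v)) * fock_norm (approx k cs)"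
    using bound[OF approx_homogeneous[OF cs] rep_at_homogeneous[OF ys]] by (auto simp: mult_ac)
qed

text \<open>The odd stages are linear extensions to algebraic tensor products, the even ones
  extensions to completions. The first two treat the factors from L with \<open>ys\<close> as a
  parameter, the next two the factors from J with the element from L as a parameter, and \<Theta>5
  and \<open>extension\<close> treat the outer product.\<close>

definition \<Theta>1 :: "'h power list \<Rightarrow> (('h power list \<Rightarrow> real) \<Rightarrow> real) \<Rightarrow> 'b" where
  "\<Theta>1 ys = tens_ext (map hilbert_power ls) (\<lambda>xs. \<Psi> (xs @ ys))"

lemma \<Theta>1_blin:
  assumes ys: "ys \<in> tuples (map hilbert_power ms)"
  shows "blin (normed_of (alg_hilbert_tensor (map hilbert_power ls))) (\<Theta>1 ys) (Bd * nprod ys)"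
  unfolding \<Theta>1_def
  by (rule blin_alg_hilbert[OF semi_inner_hilbert_powers mult_on_append_left[OF \<Psi>_mult_on ys] lsum_\<Psi>_bound[OF _ ys]])

text \<open>One representation of \<open>u\<close> serves all parameters \<open>ys\<close>, so
  multilinearity is inherited term by term from \<Psi>.\<close>

lemma \<Theta>1_mult_on:
  assumes u: "u \<in> carr (alg_tensor (map hilbert_power ls))"
  shows "mult_on (map hilbert_power ms) (\<lambda>ys. \<Theta>1 ys u)"
proof -
  obtain cs where cs: "over_tuples (map hilbert_power ls) cs"
    and eq: "\<And>\<Phi> :: 'h power list \<Rightarrow> 'b. tens_ext (map hilbert_power ls) \<Phi> u = lsum \<Phi> cs"
    by (rule tens_ext_some[OF u]) blast
  have m: "mult_on (map hilbert_power ms) (\<lambda>ys. \<Psi> (xs @ ys))" if "xs \<in> snd ` set cs" for xs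
    by (rule mult_on_append_right[OF \<Psi>_mult_on]) (use cs that in \<open>auto simp: over_tuples_def\<close>)
  show ?thesis
    unfolding mult_on_def \<Theta>1_def eq lsum_plus[symmetric] lsum_scaleR[symmetric]
    by (intro ballI allI impI conjI lsum_cong) (use m in \<open>simp_all add: mult_on_def\<close>)
qed

abbreviation Aspace :: "'h power ctensor nspace" where
  "Aspace \<equiv> normed_of (hilbert_tensor (map hilbert_power ls))"
abbreviation Bspace :: "'h power ctensor nspace" where
  "Bspace \<equiv> projective_tensor (map npower ms)"
abbreviation AV :: "(('h power list \<Rightarrow> real) \<Rightarrow> real) nspace" where
  "AV \<equiv> normed_of (alg_hilbert_tensor (map hilbert_power ls))"

lemma Aspace_simps:
  "carr Aspace = carr (banach_completion AV)" "vadd Aspace = vadd (banach_completion AV)"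
  "vscale Aspace = vscale (banach_completion AV)"
  by (simp_all add: hilbert_tensor_def normed_of_def)

definition \<Theta>2 :: "'h power list \<Rightarrow> 'h power ctensor \<Rightarrow> 'b" where
  "\<Theta>2 ys = cext (\<Theta>1 ys)"

lemma tuples_npower_hilbert: "tuples (map npower ns) = tuples (map hilbert_power ns)"
  by (simp add: tuples_npower tuples_hilbert_power)

lemma \<Theta>2_blin:
  assumes ys: "ys \<in> tuples (map npower ms)"
  shows "blin Aspace (\<Theta>2 ys) (Bd * nprod ys)"
  unfolding \<Theta>2_def hilbert_tensor_def
  using ys nprod_nonneg[OF ys] Bd unfolding tuples_npower_hilbert
  by (intro A.blin_hilbert_completion \<Theta>1_blin mult_nonneg_nonneg)

lemma mult_on_npower: "mult_on (map npower ms) \<Phi> \<longleftrightarrow> mult_on (map hilbert_power ms) \<Phi>"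
  by (rule mult_on_cong) simp_all

text \<open>Linearity in each parameter holds before completion and is preserved by limits.\<close>

lemma \<Theta>2_mult_on:
  assumes a: "a \<in> carr Aspace"
  shows "mult_on (map npower ms) (\<lambda>ys. \<Theta>2 ys a)"
proof -
  have "mult_on (map hilbert_power ms) (\<lambda>ys. \<Theta>2 ys a)"
    unfolding mult_on_def
  proof (intro ballI allI impI)
    fix ys :: "'h power list" and i and x y :: "'h power" and c :: real
    assume ys: "ys \<in> tuples (map hilbert_power ms)" and i: "i < length (map hilbert_power ms :: 'h power ispace list)"
      and x: "x \<in> carr (map hilbert_power ms ! i)" and y: "y \<in> carr (map hilbert_power ms ! i)"
    interpret H: semi_inner "map hilbert_power ms ! i" using semi_inner_hilbert_power i by simp
    have B: "blin AV (\<Theta>1 (ys[i := z])) (Bd * nprod (ys[i := z]))" "0 \<le> Bd * nprod (ys[i := z])"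
      if "z \<in> carr (map hilbert_power ms ! i)" for z
      using \<Theta>1_blin[OF tuples_update[OF ys that]] nprod_nonneg[of "ys[i := z]"] tuples_update[OF ys that] Bd
      unfolding tuples_npower_hilbert by simp_all
    have a': "a \<in> carr (banach_completion AV)" using a by (simp add: Aspace_simps)
    have m: "\<Theta>1 (ys[i := vadd (map hilbert_power ms ! i) x y]) u = \<Theta>1 (ys[i := x]) u + \<Theta>1 (ys[i := y]) u"
      "\<Theta>1 (ys[i := vscale (map hilbert_power ms ! i) c x]) u = c *\<^sub>R \<Theta>1 (ys[i := x]) u" if "u \<in> carr AV" for u
    proof -
      have "mult_on (map hilbert_power ms) (\<lambda>ys. \<Theta>1 ys u)" by (rule \<Theta>1_mult_on) (use that in simp)
      from this[unfolded mult_on_def, rule_format, OF ys i x y]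
      show "\<Theta>1 (ys[i := vadd (map hilbert_power ms ! i) x y]) u = \<Theta>1 (ys[i := x]) u + \<Theta>1 (ys[i := y]) u"
        "\<Theta>1 (ys[i := vscale (map hilbert_power ms ! i) c x]) u = c *\<^sub>R \<Theta>1 (ys[i := x]) u" by blast+
    qed
    show "\<Theta>2 (ys[i := vadd (map hilbert_power ms ! i) x y]) a = \<Theta>2 (ys[i := x]) a + \<Theta>2 (ys[i := y]) a \<and>
        \<Theta>2 (ys[i := vscale (map hilbert_power ms ! i) c x]) a = c *\<^sub>R \<Theta>2 (ys[i := x]) a"
      unfolding \<Theta>2_def
      using cext_plus[OF A.seminormed_axioms B[OF x] B[OF y] B[OF H.iadd_closed[OF x y]] m(1) a']
        cext_scale[OF A.seminormed_axioms B[OF x] B[OF H.iscale_closed[OF x]] m(2) a'] by blast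
  qed
  then show ?thesis unfolding mult_on_npower .
qed

lemma nrm_Aspace_nonneg: "a \<in> carr Aspace \<Longrightarrow> 0 \<le> nrm Aspace a"
  using semi_inner.nonneg_space_normed_of[OF A.semi_inner_hilbert_completion]
  by (simp add: nonneg_space_def hilbert_tensor_def)

lemma \<Theta>2_mbounded:
  assumes a: "a \<in> carr Aspace"
  shows "mbounded (map npower ms) (\<lambda>ys. \<Theta>2 ys a) (Bd * nrm Aspace a)"
  unfolding mbounded_def
proof
  fix ys :: "'h power list" assume ys: "ys \<in> tuples (map npower ms)"
  have "norm (\<Theta>2 ys a) \<le> (Bd * nprod ys) * nrm Aspace a"
    using \<Theta>2_blin[OF ys] a unfolding blin_def by blast
  then show "norm (\<Theta>2 ys a) \<le> Bd * nrm Aspace a * (\<Prod>i<length (map npower ms). nrm (map npower ms ! i) (ys ! i))"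
    by (simp add: mult_ac)
qed

definition \<Theta>3 :: "'h power ctensor \<Rightarrow> (('h power list \<Rightarrow> real) \<Rightarrow> real) \<Rightarrow> 'b" where
  "\<Theta>3 a = tens_ext (map npower ms) (\<lambda>ys. \<Theta>2 ys a)"

abbreviation BV :: "(('h power list \<Rightarrow> real) \<Rightarrow> real) nspace" where
  "BV \<equiv> alg_projective_tensor (map npower ms)"

lemma BV_seminormed: "seminormed BV"
  by (rule seminormed_projective[OF nonneg_npowers])

lemma \<Theta>3_blin:
  assumes a: "a \<in> carr Aspace"
  shows "blin BV (\<Theta>3 a) (Bd * nrm Aspace a)" "0 \<le> Bd * nrm Aspace a"
proof -
  show 0: "0 \<le> Bd * nrm Aspace a" using Bd nrm_Aspace_nonneg[OF a] by simp
  show "blin BV (\<Theta>3 a) (Bd * nrm Aspace a)"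
    unfolding \<Theta>3_def by (rule blin_projective[OF nonneg_npowers \<Theta>2_mult_on[OF a] \<Theta>2_mbounded[OF a] 0])
qed

lemma Aspace_closed:
  "a \<in> carr Aspace \<Longrightarrow> a' \<in> carr Aspace \<Longrightarrow> vadd Aspace a a' \<in> carr Aspace"
  "a \<in> carr Aspace \<Longrightarrow> vscale Aspace c a \<in> carr Aspace"
  unfolding Aspace_simps by (rule A.completion_closed; assumption)+

text \<open>The parameter is now the element from L: the same representation of \<open>v\<close> is
  used for all of them, and each term is linear in it by \<open>\<Theta>2_blin\<close>.\<close>

lemma \<Theta>3_linear:
  assumes a: "a \<in> carr Aspace" and v: "v \<in> carr BV"
  shows "a' \<in> carr Aspace \<Longrightarrow> \<Theta>3 (vadd Aspace a a') v = \<Theta>3 a v + \<Theta>3 a' v"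
    and "\<Theta>3 (vscale Aspace c a) v = c *\<^sub>R \<Theta>3 a v"
proof -
  have "v \<in> carr (alg_tensor (map npower ms))" using v by simp
  then obtain cs where cs: "over_tuples (map npower ms) cs"
    and eq: "\<And>\<Phi> :: 'h power list \<Rightarrow> 'b. tens_ext (map npower ms) \<Phi> v = lsum \<Phi> cs"
    using tens_ext_some[of v "map npower ms"] by metis
  have b: "blin Aspace (\<Theta>2 ys) (Bd * nprod ys)" if "ys \<in> snd ` set cs" for ys
    using \<Theta>2_blin cs that by (auto simp: over_tuples_def)
  show "\<Theta>3 (vscale Aspace c a) v = c *\<^sub>R \<Theta>3 a v"
    unfolding \<Theta>3_def eq lsum_scaleR[symmetric]
    by (rule lsum_cong) (use b a in \<open>simp add: blin_def\<close>)
  show "\<Theta>3 (vadd Aspace a a') v = \<Theta>3 a v + \<Theta>3 a' v" if "a' \<in> carr Aspace"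
    unfolding \<Theta>3_def eq lsum_plus[symmetric]
    by (rule lsum_cong) (use b a that in \<open>simp add: blin_def\<close>)
qed

definition \<Theta>4 :: "'h power ctensor \<Rightarrow> 'h power ctensor \<Rightarrow> 'b" where
  "\<Theta>4 a = cext (\<Theta>3 a)"

lemma \<Theta>4_blin: "a \<in> carr Aspace \<Longrightarrow> blin Bspace (\<Theta>4 a) (Bd * nrm Aspace a)"
  unfolding \<Theta>4_def projective_tensor_def by (rule blin_cext[OF BV_seminormed \<Theta>3_blin])

lemma \<Theta>4_linear:
  assumes a: "a \<in> carr Aspace" and b: "b \<in> carr Bspace"
  shows "a' \<in> carr Aspace \<Longrightarrow> \<Theta>4 (vadd Aspace a a') b = \<Theta>4 a b + \<Theta>4 a' b"
    and "\<Theta>4 (vscale Aspace c a) b = c *\<^sub>R \<Theta>4 a b"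
proof -
  have b': "b \<in> carr (banach_completion BV)" using b by (simp add: projective_tensor_def)
  show "\<Theta>4 (vscale Aspace c a) b = c *\<^sub>R \<Theta>4 a b"
    unfolding \<Theta>4_def
    by (rule cext_scale[OF BV_seminormed \<Theta>3_blin[OF a] \<Theta>3_blin[OF Aspace_closed(2)[OF a]] \<Theta>3_linear(2)[OF a] b'])
  show "\<Theta>4 (vadd Aspace a a') b = \<Theta>4 a b + \<Theta>4 a' b" if a': "a' \<in> carr Aspace"
    unfolding \<Theta>4_def
    by (rule cext_plus[OF BV_seminormed \<Theta>3_blin[OF a] \<Theta>3_blin[OF a'] \<Theta>3_blin[OF Aspace_closed(1)[OF a a']]
          \<Theta>3_linear(1)[OF a _ a'] b'])
qed

lemma tuples_AB: "xs \<in> tuples [Aspace, Bspace] \<longleftrightarrow> (\<exists>a b. xs = [a, b] \<and> a \<in> carr Aspace \<and> b \<in> carr Bspace)"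
  by (auto simp: tuples_def list_all2_Cons2)

lemma \<Theta>4_mult_on: "mult_on [Aspace, Bspace] (\<lambda>ab. \<Theta>4 (ab ! 0) (ab ! 1))"
proof -
  have "\<Theta>4 a (vadd Bspace b b') = \<Theta>4 a b + \<Theta>4 a b'" "\<Theta>4 a (vscale Bspace c b) = c *\<^sub>R \<Theta>4 a b"
    if "a \<in> carr Aspace" "b \<in> carr Bspace" "b' \<in> carr Bspace" for a b b' c
    using \<Theta>4_blin[OF that(1)] that by (auto simp: blin_def)
  then show ?thesis unfolding mult_on_def using \<Theta>4_linear by (auto simp: tuples_AB less_Suc_eq)
qed

lemma \<Theta>4_mbounded: "mbounded [Aspace, Bspace] (\<lambda>ab. \<Theta>4 (ab ! 0) (ab ! 1)) Bd"
  unfolding mbounded_def using \<Theta>4_blin by (auto simp: tuples_AB blin_def lessThan_Suc mult_ac)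

lemma nonneg_AB: "E \<in> set [Aspace, Bspace] \<Longrightarrow> nonneg_space E"
  using nrm_Aspace_nonneg seminormed.nrm_completion_nonneg[OF BV_seminormed]
  by (auto simp: nonneg_space_def projective_tensor_def)

definition \<Theta>5 :: "(('h power ctensor list \<Rightarrow> real) \<Rightarrow> real) \<Rightarrow> 'b" where
  "\<Theta>5 = tens_ext [Aspace, Bspace] (\<lambda>ab. \<Theta>4 (ab ! 0) (ab ! 1))"

abbreviation RV :: "(('h power ctensor list \<Rightarrow> real) \<Rightarrow> real) nspace" where
  "RV \<equiv> alg_projective_tensor [Aspace, Bspace]"

lemma RV_seminormed: "seminormed RV"
  by (rule seminormed_projective[OF nonneg_AB])

lemma \<Theta>5_blin: "blin RV \<Theta>5 Bd"
  unfolding \<Theta>5_def by (rule blin_projective[OF nonneg_AB \<Theta>4_mult_on \<Theta>4_mbounded Bd])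

definition extension :: "'h power ctensor ctensor \<Rightarrow> 'b" where
  "extension = cext \<Theta>5"

lemma extension_blin: "blin (projective_tensor [Aspace, Bspace]) extension Bd"
  unfolding extension_def projective_tensor_def[of "[_, _]"] by (rule blin_cext[OF RV_seminormed \<Theta>5_blin Bd])

text \<open>The values stay in \<open>S\<close> at every stage, because it is a subspace at the
  linear extensions and because it is closed at the completions.\<close>

lemma extension_closed:
  assumes "X \<in> carr (projective_tensor [Aspace, Bspace])"
  shows "extension X \<in> S"
proof -
  have \<Psi>: "\<Psi> (xs @ ys) \<in> S" if "xs \<in> tuples (map hilbert_power ls)" "ys \<in> tuples (map hilbert_power ms)" for xs ys
    by (rule closed_sequentially[OF S(1) _ \<Psi>_tendsto[OF that]]) (simp add: base_def S(3))
  have 1: "\<Theta>1 ys u \<in> S" if "ys \<in> tuples (map hilbert_power ms)" "u \<in> carr AV" for ys u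
    unfolding \<Theta>1_def by (rule tens_ext_subspace[OF _ S(2)]) (use \<Psi> that in auto)
  have 2: "\<Theta>2 ys a \<in> S" if ys: "ys \<in> tuples (map npower ms)" and a: "a \<in> carr Aspace" for ys a
  proof -
    have ys': "ys \<in> tuples (map hilbert_power ms)" using ys by (simp add: tuples_npower_hilbert)
    have "0 \<le> Bd * nprod ys" using Bd nprod_nonneg[OF ys] by simp
    from cext_closed[OF A.seminormed_axioms \<Theta>1_blin[OF ys'] this a[unfolded Aspace_simps] S(1) 1[OF ys']]
    show ?thesis by (simp add: \<Theta>2_def)
  qed
  have 3: "\<Theta>3 a v \<in> S" if "a \<in> carr Aspace" "v \<in> carr BV" for a v
    unfolding \<Theta>3_def by (rule tens_ext_subspace[OF _ S(2)]) (use 2 that in auto)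
  have 4: "\<Theta>4 a b \<in> S" if "a \<in> carr Aspace" "b \<in> carr Bspace" for a b
    unfolding \<Theta>4_def
    by (rule cext_closed[OF BV_seminormed \<Theta>3_blin[OF that(1)] that(2)[unfolded projective_tensor_def] S(1) 3[OF that(1)]])
  have 5: "\<Theta>5 w \<in> S" if "w \<in> carr RV" for w
    unfolding \<Theta>5_def by (rule tens_ext_subspace[OF _ S(2)]) (use 4 that in \<open>auto simp: tuples_AB\<close>)
  show ?thesis
    unfolding extension_def
    by (rule cext_closed[OF RV_seminormed \<Theta>5_blin Bd assms[unfolded projective_tensor_def[of "[_, _]"]] S(1) 5])
qed

lemma tensor_sum_single_carr: "xs \<in> tuples Es \<Longrightarrow> tensor_sum Es [(1, xs)] \<in> carr (alg_tensor Es)"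
  by (auto simp: carr_alg_tensor over_tuples_def)

lemma tens_ext_single:
  "mult_on Es \<Phi> \<Longrightarrow> xs \<in> tuples Es \<Longrightarrow> tens_ext Es \<Phi> (tensor_sum Es [(1, xs)]) = \<Phi> xs"
  by (simp add: tens_ext_tensor_sum over_tuples_def)

text \<open>Each stage agrees with the preceding one on constant classes and elementary tensors, so
  unwinding the tower leads back to \<open>base\<close>.\<close>

lemma extension_elem:
  assumes us: "homogeneous_list ls us" and vs: "homogeneous_list ms vs"
  shows "extension (projective_elem [Aspace, Bspace]
      [hilbert_elem (map hilbert_power ls) (map2 (\<lambda>n. const_class (apower n)) ls us),
       projective_elem (map npower ms) (map2 (\<lambda>n. const_class (apower n)) ms vs)]) = \<Lambda> (fock_prod (us @ vs))"
proof -
  let ?xs = "map2 (\<lambda>n. const_class (apower n)) ls us" and ?ys = "map2 (\<lambda>n. const_class (apower n)) ms vs"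
  have t: "map2 (\<lambda>n. const_class (apower n)) ns ws \<in> tuples (map hilbert_power ns)" if "homogeneous_list ns ws"
    for ns and ws :: "'h fock list"
    using that by (auto simp: homogeneous_list_def list_all2_conv_all_nth tuples_iff
        intro!: seminormed.const_class_carr[OF seminormed_apower])
  note xs = t[OF us] and ys = t[OF vs]
  have ys': "?ys \<in> tuples (map npower ms)" using ys by (simp add: tuples_npower_hilbert)
  have len: "length us = length ls" "length vs = length ms"
    using us vs by (auto simp: homogeneous_list_def dest: list_all2_lengthD)
  have uv: "us @ vs \<in> tuples (map apower (ls @ ms))"
    unfolding tuples_apower using us vs by (simp add: homogeneous_list_def list_all2_appendI)
  have "map2 const_class (map apower (ls @ ms)) (us @ vs) = ?xs @ ?ys"
    using len by (auto simp: map_zip_map intro!: nth_equalityI simp: nth_append)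
  moreover have "mext base (map2 const_class (map apower (ls @ ms)) (us @ vs)) = base (us @ vs)"
    by (rule mext_const[OF seminormed_apowers[of _ "ls @ ms"] base_mult_on base_mbounded Bd uv])
  ultimately have p: "\<Psi> (?xs @ ?ys) = \<Lambda> (fock_prod (us @ vs))"
    unfolding \<Psi>_def base_def by simp
  let ?a = "hilbert_elem (map hilbert_power ls) ?xs" and ?b = "projective_elem (map npower ms) ?ys"
  have ts1: "tensor_sum (map hilbert_power ls) [(1, ?xs)] \<in> carr AV"
    using tensor_sum_single_carr[OF xs] by simp
  have ts2: "tensor_sum (map npower ms) [(1, ?ys)] \<in> carr BV"
    using tensor_sum_single_carr[OF ys'] by simp
  have a: "?a \<in> carr Aspace"
    unfolding Aspace_simps hilbert_elem_def by (rule A.const_class_carr[OF ts1])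
  have b: "?b \<in> carr Bspace"
    unfolding projective_elem_def projective_tensor_def by (rule seminormed.const_class_carr[OF BV_seminormed ts2])
  have ab: "[?a, ?b] \<in> tuples [Aspace, Bspace]" using a b by (simp add: tuples_AB)
  have ts3: "tensor_sum [Aspace, Bspace] [(1, [?a, ?b])] \<in> carr RV"
    using tensor_sum_single_carr[OF ab] by simp
  have "extension (projective_elem [Aspace, Bspace] [?a, ?b]) = \<Theta>5 (tensor_sum [Aspace, Bspace] [(1, [?a, ?b])])"
    unfolding extension_def projective_elem_def[of "[_, _]"] by (rule cext_const[OF RV_seminormed \<Theta>5_blin Bd ts3])
  also have "\<dots> = \<Theta>4 ?a ?b" unfolding \<Theta>5_def tens_ext_single[OF \<Theta>4_mult_on ab] by simp
  also have "\<dots> = \<Theta>3 ?a (tensor_sum (map npower ms) [(1, ?ys)])"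
    unfolding \<Theta>4_def projective_elem_def by (rule cext_const[OF BV_seminormed \<Theta>3_blin[OF a[unfolded projective_elem_def]] ts2])
  also have "\<dots> = \<Theta>2 ?ys ?a" unfolding \<Theta>3_def by (rule tens_ext_single[OF \<Theta>2_mult_on[OF a] ys'])
  also have "\<dots> = \<Theta>1 ?ys (tensor_sum (map hilbert_power ls) [(1, ?xs)])"
    unfolding \<Theta>2_def hilbert_elem_def
    by (rule cext_const[OF A.seminormed_axioms \<Theta>1_blin[OF ys] _ ts1]) (use Bd nprod_nonneg[OF ys'] in simp)
  also have "\<dots> = \<Psi> (?xs @ ?ys)"
    unfolding \<Theta>1_def by (rule tens_ext_single[OF mult_on_append_left[OF \<Psi>_mult_on ys] xs])
  finally show ?thesis using p by simp
qed

end

section \<open>Wick operators\<close>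

lemma linear_wick_op: "linear (\<lambda>F. wick_op q F u)"
  unfolding wick_op_def by (rule linear_lin_ext[OF multilinear_wick])

text \<open>The terms subtracted in the recursion cancel precisely the annihilation part of
  \<open>xi\<close>. This makes the coefficient of a Wick operator recoverable from its value at the
  vacuum.\<close>

lemma wick_vacuum: "wick q xs (tensor []) = tensor xs"
proof (induction "length xs" arbitrary: xs rule: less_induct)
  case less
  show ?case
  proof (cases xs)
    case (Cons f fs)
    have "wick q fs (tensor []) = tensor fs" using less Cons by simp
    moreover have "wick q (drop_nth i fs) (tensor []) = tensor (drop_nth i fs)" if "i < length fs" for i
      using less[of "drop_nth i fs"] Cons that by (simp add: length_drop_nth)
    ultimately show ?thesis by (simp add: Cons xi_def creation_tensor annihilation_tensor)
  qed simp
qed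

lemma wick_op_vacuum: "wick_op q F (tensor []) = F"
  by (rule fock_linear_eqI[OF linear_wick_op linear_ident]) (simp add: wick_op_tensor wick_vacuum)

lemma wick_op_inject: "wick_op q F = wick_op q G \<longleftrightarrow> F = G"
  using wick_op_vacuum by metis

lemma wick_op_add: "wick_op q (F + G) = (\<lambda>u. wick_op q F u + wick_op q G u)"
  and wick_op_scale: "wick_op q (c *\<^sub>R F) = (\<lambda>u. c *\<^sub>R wick_op q F u)"
  by (simp_all add: fun_eq_iff linear_add[OF linear_wick_op] linear_scale[OF linear_wick_op])

lemma field_algebra_zero: "(\<lambda>u. 0) \<in> field_algebra q"
  using field_algebra.scale[OF field_algebra.one, where q = q and c = 0] by simp

lemma field_algebra_sum:
  assumes "finite I" "\<And>i. i \<in> I \<Longrightarrow> A i \<in> field_algebra q"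
  shows "(\<lambda>u. \<Sum>i\<in>I. A i u) \<in> field_algebra q"
  using assms by (induction I) (auto intro: field_algebra_zero field_algebra.add)

lemma wick_field_algebra: "wick q xs \<in> field_algebra q"
proof (induction "length xs" arbitrary: xs rule: less_induct)
  case less
  show ?case
  proof (cases xs)
    case Nil
    then show ?thesis using field_algebra.one by simp
  next
    case (Cons f fs)
    have 1: "xi q f \<circ> wick q fs \<in> field_algebra q"
      using less Cons by (intro field_algebra.mult field_algebra.field) simp
    have "(\<lambda>u. \<Sum>i<length fs. (q ^ i * (f \<bullet> fs ! i)) *\<^sub>R wick q (drop_nth i fs) u) \<in> field_algebra q"
      using less Cons by (intro field_algebra_sum field_algebra.scale) (auto simp: length_drop_nth)
    from field_algebra.add[OF 1 field_algebra.scale[OF this, where c = "- 1"]] show ?thesis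
      by (simp add: Cons comp_def)
  qed
qed

lemma wick_op_field_algebra: "wick_op q F \<in> field_algebra q"
  by (induction F rule: fock_induct)
     (simp_all add: wick_op_add wick_op_scale wick_op_tensor wick_field_algebra field_algebra.add field_algebra.scale)

text \<open>The recursion for \<open>wick\<close>, solved for its first term: composition with
  \<open>xi q f\<close> produces the Wick operator of \<open>f # xs\<close> and those of the
  contractions of \<open>f\<close> with \<open>xs\<close>, that is, creation and annihilation act on
  the coefficient.\<close>

lemma xi_wick_op: "xi q f (wick_op q G u) = wick_op q (xi q f G) u"
proof (rule fock_linear_eqI[of "\<lambda>G. xi q f (wick_op q G u)" "\<lambda>G. wick_op q (xi q f G) u"])
  show "linear (\<lambda>G. xi q f (wick_op q G u))"
    using linear_compose[OF linear_wick_op linear_xi] by (simp add: comp_def)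
  show "linear (\<lambda>G. wick_op q (xi q f G) u)"
    using linear_compose[OF linear_xi linear_wick_op] by (simp add: comp_def)
  fix xs :: "'a list"
  show "xi q f (wick_op q (tensor xs) u) = wick_op q (xi q f (tensor xs)) u"
  proof -
    have "xi q f (tensor xs) = tensor (f # xs) + (\<Sum>i<length xs. (q ^ i * (f \<bullet> xs ! i)) *\<^sub>R tensor (drop_nth i xs))"
      by (simp add: xi_def creation_tensor annihilation_tensor)
    then show ?thesis
      by (simp add: wick_op_tensor linear_add[OF linear_wick_op] linear_sum[OF linear_wick_op]
          linear_scale[OF linear_wick_op])
  qed
qed

lemma wick_wick_op: "wick q xs (wick_op q G u) = wick_op q (wick q xs G) u"
proof (induction "length xs" arbitrary: xs rule: less_induct)
  case less
  show ?case
  proof (cases xs)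
    case (Cons f fs)
    have "wick q fs (wick_op q G u) = wick_op q (wick q fs G) u" using less Cons by simp
    moreover have "wick q (drop_nth i fs) (wick_op q G u) = wick_op q (wick q (drop_nth i fs) G) u" if "i < length fs" for i
      using less[of "drop_nth i fs"] Cons that by (simp add: length_drop_nth)
    ultimately show ?thesis
      by (simp add: Cons xi_wick_op linear_diff[OF linear_wick_op] linear_sum[OF linear_wick_op] linear_scale[OF linear_wick_op])
  qed simp
qed

text \<open>The coefficient of a product is the left factor applied to the coefficient of the right
  one. Thus Wick operators are closed under composition and exhaust the algebra.\<close>

lemma wick_op_wick_op: "wick_op q F \<circ> wick_op q G = wick_op q (wick_op q F G)"
proof
  fix u
  have "wick_op q F (wick_op q G u) = wick_op q (wick_op q F G) u"
    by (induction F rule: fock_induct)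
       (simp_all add: wick_op_add wick_op_scale wick_op_tensor wick_wick_op)
  then show "(wick_op q F \<circ> wick_op q G) u = wick_op q (wick_op q F G) u" by simp
qed

lemma field_algebra_wick_op: "field_algebra q = range (wick_op q)"
proof (intro equalityI subsetI)
  fix A :: "'a fock \<Rightarrow> 'a fock" assume "A \<in> field_algebra q"
  then show "A \<in> range (wick_op q)"
  proof induction
    case one
    have "wick_op q (tensor []) = id" by (simp add: wick_op_tensor)
    then show ?case by (metis rangeI)
  next
    case (field f)
    have "wick_op q (tensor [f]) = xi q f" by (simp add: wick_op_tensor)
    then show ?case by (metis rangeI)
  next
    case (add A B)
    then show ?case using wick_op_add[symmetric] by (auto simp: image_iff)
  next
    case (scale A c)
    then show ?case using wick_op_scale[symmetric] by (auto simp: image_iff)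
  next
    case (mult A B)
    then obtain F G where "A = wick_op q F" "B = wick_op q G" by auto
    then show ?case using wick_op_wick_op[of q F G] by (metis rangeI)
  qed
qed (auto intro: wick_op_field_algebra)

section \<open>An isometric embedding of the Wick algebra into a Banach space\<close>

instance bcontfun :: (metric_space, banach) banach ..

definition weight :: "real \<Rightarrow> nat \<Rightarrow> real" where
  "weight q k = (real k + 1) * C_const q powr (3 / 2) * D_const q ^ k"

definition fock_sum_norm :: "real \<Rightarrow> 'h::real_inner fock \<Rightarrow> real" where
  "fock_sum_norm q F = (\<Sum>k | degree_part k F \<noteq> 0. weight q k * fock_norm (degree_part k F))"

lemma algebra_norm_wick_op: "algebra_norm q (wick_op q F) = fock_sum_norm q F"
proof -
  have "(THE G. wick_op q G = wick_op q F) = F" by (simp add: wick_op_inject)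
  then show ?thesis by (simp add: algebra_norm_def fock_sum_norm_def weight_def)
qed

lemma weight_nonneg: "\<bar>q\<bar> < 1 \<Longrightarrow> 0 \<le> weight q k"
  by (simp add: weight_def D_const_def)

lemma fock_degree_bound: "\<exists>N. \<forall>k\<ge>N. degree_part k F = 0"
proof (induction F rule: fock_induct)
  case (add u v)
  then obtain M N where "\<forall>k\<ge>M. degree_part k u = 0" "\<forall>k\<ge>N. degree_part k v = 0" by blast
  then show ?case by (intro exI[of _ "max M N"]) (simp add: linear_add[OF linear_degree_part])
next
  case (scale c u)
  then show ?case by (auto simp: linear_scale[OF linear_degree_part])
next
  case (tensor xs)
  show ?case by (intro exI[of _ "Suc (length xs)"]) (simp add: degree_part_tensor)
qed

text \<open>The given \<open>N\<close> does not survive an induction, since high degrees may cancel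
  in a sum. Some valid bound is found first, and the vanishing terms are dropped afterwards.\<close>

lemma fock_decompose: "\<forall>k\<ge>N. degree_part k F = 0 \<Longrightarrow> F = (\<Sum>k<N. degree_part k F)"
proof -
  have 1: "\<exists>N. \<forall>M\<ge>N. F = (\<Sum>k<M. degree_part k F)"
  proof (induction F rule: fock_induct)
    case (add u v)
    then obtain M N where "\<forall>K\<ge>M. u = (\<Sum>k<K. degree_part k u)" "\<forall>K\<ge>N. v = (\<Sum>k<K. degree_part k v)" by blast
    then show ?case by (intro exI[of _ "max M N"]) (simp add: linear_add[OF linear_degree_part] sum.distrib)
  next
    case (scale c u)
    then obtain M where "\<forall>K\<ge>M. u = (\<Sum>k<K. degree_part k u)" by blast
    then show ?case by (intro exI[of _ M]) (simp add: linear_scale[OF linear_degree_part] scaleR_sum_right[symmetric])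
  next
    case (tensor xs)
    show ?case by (intro exI[of _ "Suc (length xs)"]) (simp add: degree_part_tensor)
  qed
  assume N: "\<forall>k\<ge>N. degree_part k F = 0"
  obtain M where M: "\<forall>K\<ge>M. F = (\<Sum>k<K. degree_part k F)" using 1 by blast
  have "F = (\<Sum>k<max M N. degree_part k F)" using M by simp
  also have "\<dots> = (\<Sum>k<N. degree_part k F)"
    by (rule sum.mono_neutral_right) (use N in auto)
  finally show ?thesis .
qed

text \<open>Absorbs the weights: the norm of \<open>wick_op q F\<close> is the plain sum of the
  norms of the homogeneous parts of \<open>scaled q F\<close>.\<close>

definition scaled :: "real \<Rightarrow> 'h::real_inner fock \<Rightarrow> 'h fock" where
  "scaled q = lin_ext (\<lambda>xs. weight q (length xs) *\<^sub>R tensor xs)"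

lemma multilinear_scaled: "multilinear (\<lambda>xs :: 'h::real_inner list. weight q (length xs) *\<^sub>R tensor xs)"
  using multilinear_tensor[where 'a = 'h] unfolding multilinear_def by (simp add: scaleR_add_right mult.commute)

lemma linear_scaled: "linear (scaled q)"
  unfolding scaled_def by (rule linear_lin_ext[OF multilinear_scaled])

lemma degree_part_scaled: "degree_part k (scaled q F) = weight q k *\<^sub>R degree_part k F"
proof (induction F rule: fock_induct)
  case (tensor xs)
  show ?case
    by (simp add: scaled_def lin_ext_tensor[OF multilinear_scaled] degree_part_tensor linear_scale[OF linear_degree_part])
qed (simp_all add: linear_add[OF linear_degree_part] linear_scale[OF linear_degree_part] linear_add[OF linear_scaled]
       linear_scale[OF linear_scaled] scaleR_add_right mult.commute)

lemma fock_norm_scale: "fock_norm (c *\<^sub>R u) = \<bar>c\<bar> * fock_norm u"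
  by (simp add: fock_norm_def fock_inner_scale_left fock_inner_scale_right real_sqrt_mult mult.assoc[symmetric]
      power2_eq_square[symmetric])

lemma fock_norm_zero [simp]: "fock_norm 0 = 0"
  by (simp add: fock_norm_def fock_inner_zero_left)

lemma degree_part_idem: "degree_part k (degree_part k u) = degree_part k u"
  by (simp add: degree_part_degree_part)

lemma fock_sum_norm_scaled:
  assumes q: "\<bar>q\<bar> < 1" and N: "\<forall>k\<ge>N. degree_part k F = 0"
  shows "fock_sum_norm q F = (\<Sum>k<N. fock_norm (degree_part k (scaled q F)))"
proof -
  have "fock_sum_norm q F = (\<Sum>k<N. weight q k * fock_norm (degree_part k F))"
    unfolding fock_sum_norm_def
    by (rule sum.mono_neutral_left) (use N in \<open>auto simp: not_less[symmetric]\<close>)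
  then show ?thesis using weight_nonneg[OF q] by (simp add: degree_part_scaled fock_norm_scale)
qed

lemma fock_inner_le:
  assumes "degree_part n u = u" "degree_part n v = v"
  shows "\<bar>fock_inner u v\<bar> \<le> fock_norm u * fock_norm v"
proof -
  interpret P: semi_inner_completion "alg_power n" by (rule semi_inner_alg_power)
  show ?thesis using P.inn_le[of u v] assms by (simp add: fock_norm_def)
qed

text \<open>The unit ball of the supremum over degrees, which is dual to the sum over
  degrees.\<close>

definition unit_bounded :: "'h::real_inner fock \<Rightarrow> bool" where
  "unit_bounded H \<longleftrightarrow> (\<forall>k. fock_norm (degree_part k H) \<le> 1)"

lemma fock_inner_unit_bounded:
  assumes H: "unit_bounded H" and N: "\<forall>k\<ge>N. degree_part k F = 0"
  shows "\<bar>fock_inner F H\<bar> \<le> (\<Sum>k<N. fock_norm (degree_part k F))"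
proof -
  have "fock_inner F H = (\<Sum>k<N. fock_inner (degree_part k F) (degree_part k H))"
    by (subst fock_decompose[OF N]) (simp add: fock_inner_sum_left fock_inner_degree_part[symmetric])
  also have "\<bar>\<dots>\<bar> \<le> (\<Sum>k<N. fock_norm (degree_part k F))"
  proof (rule order.trans[OF sum_abs sum_mono])
    fix k
    have "\<bar>fock_inner (degree_part k F) (degree_part k H)\<bar> \<le> fock_norm (degree_part k F) * fock_norm (degree_part k H)"
      by (rule fock_inner_le[OF degree_part_idem degree_part_idem])
    also have "\<dots> \<le> fock_norm (degree_part k F) * 1"
      using H fock_norm_nonneg[OF degree_part_idem, of k F] unfolding unit_bounded_def by (intro mult_left_mono) auto
    finally show "\<bar>fock_inner (degree_part k F) (degree_part k H)\<bar> \<le> fock_norm (degree_part k F)" by simp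
  qed
  finally show ?thesis .
qed

lemma fock_inner_attained:
  assumes N: "\<forall>k\<ge>N. degree_part k F = 0"
  shows "\<exists>H. unit_bounded H \<and> fock_inner F H = (\<Sum>k<N. fock_norm (degree_part k F))"
proof -
  let ?n = "\<lambda>k. fock_norm (degree_part k F)"
  \<comment> \<open>The homogeneous parts are normalised; where the norm is 0, the coefficient is 0
    by the convention for division.\<close>
  let ?H = "\<Sum>k<N. (1 / ?n k) *\<^sub>R degree_part k F"
  have n0: "0 \<le> ?n k" for k by (rule fock_norm_nonneg[OF degree_part_idem])
  have dH: "degree_part j ?H = (if j < N then (1 / ?n j) *\<^sub>R degree_part j F else 0)" for j
  proof -
    have "degree_part j ?H = (\<Sum>k<N. if k = j then (1 / ?n j) *\<^sub>R degree_part j F else 0)"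
      by (simp add: linear_sum[OF linear_degree_part] linear_scale[OF linear_degree_part] degree_part_degree_part if_distrib cong: if_cong)
    then show ?thesis by simp
  qed
  have "unit_bounded ?H"
    unfolding unit_bounded_def dH using n0 by (simp add: fock_norm_scale)
  moreover have "fock_inner F ?H = (\<Sum>k<N. ?n k)"
  proof -
    have "fock_inner F (degree_part k F) = (?n k)\<^sup>2" for k
    proof -
      have "fock_inner F (degree_part k F) = fock_inner (degree_part k F) (degree_part k F)"
        by (metis fock_inner_commute fock_inner_degree_part)
      then show ?thesis using fock_inner_nonneg[OF degree_part_idem, of k F] by (simp add: fock_norm_def)
    qed
    then show ?thesis by (simp add: fock_inner_sum_right fock_inner_scale_right power2_eq_square)
  qed
  ultimately show ?thesis by blast
qed

text \<open>The value 0 outside the dual ball makes this a bounded function on the whole type. The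
  copy \<open>discrete\<close> of the Fock space makes every function continuous, so
  \<open>bcontfun\<close> is the space of all bounded functions.\<close>

definition pairing :: "real \<Rightarrow> 'h::real_inner fock \<Rightarrow> 'h fock discrete \<Rightarrow> real" where
  "pairing q F x = (let H = of_discrete x in if unit_bounded H then fock_inner (scaled q F) H else 0)"

definition embed :: "real \<Rightarrow> 'h::real_inner fock \<Rightarrow> 'h fock discrete \<Rightarrow>\<^sub>C real" where
  "embed q F = Bcontfun (pairing q F)"

section \<open>The isometry and its inverse on the closure of the image\<close>

context
  fixes q :: real
  assumes q: "\<bar>q\<bar> < 1"
begin

lemma scaled_degree: "\<forall>k\<ge>N. degree_part k F = 0 \<Longrightarrow> \<forall>k\<ge>N. degree_part k (scaled q F) = 0"
  by (simp add: degree_part_scaled)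

lemma abs_pairing_le: "\<bar>pairing q F x\<bar> \<le> fock_sum_norm q F"
proof -
  obtain N where N: "\<forall>k\<ge>N. degree_part k F = 0" using fock_degree_bound by blast
  have "0 \<le> (\<Sum>k<N. fock_norm (degree_part k (scaled q F)))"
    by (intro sum_nonneg fock_norm_nonneg[OF degree_part_idem])
  then show ?thesis
    using fock_inner_unit_bounded[OF _ scaled_degree[OF N], of "of_discrete x"]
    by (simp add: pairing_def Let_def fock_sum_norm_scaled[OF q N])
qed

lemma apply_embed: "apply_bcontfun (embed q F) = pairing q F"
  unfolding embed_def
proof (rule Bcontfun_inverse)
  have "continuous_on UNIV (pairing q F)"
    unfolding continuous_on_open_vimage[OF open_UNIV] by (simp add: open_discrete)
  moreover have "bounded (range (pairing q F))"
    by (rule boundedI[of _ "fock_sum_norm q F"]) (auto simp: abs_pairing_le)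
  ultimately show "pairing q F \<in> bcontfun" by (simp add: bcontfun_def)
qed

lemma linear_embed: "linear (embed q)"
  by (rule linearI; rule bcontfun_eqI)
     (auto simp: apply_embed pairing_def Let_def linear_add[OF linear_scaled] linear_scale[OF linear_scaled]
       fock_inner_add_left fock_inner_scale_left)

text \<open>Degreewise Cauchy-Schwarz gives the upper bound, and the normalised homogeneous parts of
  \<open>scaled q F\<close> attain it.\<close>

lemma norm_embed: "norm (embed q F) = fock_sum_norm q F"
proof (rule antisym)
  show "norm (embed q F) \<le> fock_sum_norm q F"
    by (rule norm_bound) (simp add: apply_embed abs_pairing_le)
  obtain N where N: "\<forall>k\<ge>N. degree_part k F = 0" using fock_degree_bound by blast
  obtain H where H: "unit_bounded H" "fock_inner (scaled q F) H = fock_sum_norm q F"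
    using fock_inner_attained[OF scaled_degree[OF N]] fock_sum_norm_scaled[OF q N] by auto
  have "fock_sum_norm q F \<le> norm (apply_bcontfun (embed q F) (discrete H))"
    using H by (simp add: apply_embed pairing_def discrete_inverse)
  also have "\<dots> \<le> norm (embed q F)" by (rule norm_bounded)
  finally show "fock_sum_norm q F \<le> norm (embed q F)" .
qed

lemma norm_embed_homogeneous:
  assumes "degree_part n F = F"
  shows "norm (embed q F) = weight q n * fock_norm F"
proof -
  have "degree_part k F = (if k = n then F else 0)" for k
    using degree_part_degree_part[of k n F] assms by simp
  then have "{k. degree_part k F \<noteq> 0} = (if F = 0 then {} else {n})" by auto
  then show ?thesis using assms by (simp add: norm_embed fock_sum_norm_def)
qed

lemma alg_A_simps [simp]:
  "carr (alg_A q) = range (wick_op q)" "vadd (alg_A q) = (\<lambda>A B u. A u + B u)"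
  "vscale (alg_A q) = (\<lambda>c A u. c *\<^sub>R A u)" "nrm (alg_A q) = algebra_norm q"
  by (simp_all add: alg_A_def field_algebra_wick_op)

lemma nrm_alg_A: "nrm (alg_A q) (wick_op q F) = norm (embed q F)"
  by (simp add: algebra_norm_wick_op norm_embed)

lemma vadd_alg_A: "vadd (alg_A q) (wick_op q F) (wick_op q G) = wick_op q (F + G)"
  and vscale_alg_A: "vscale (alg_A q) c (wick_op q F) = wick_op q (c *\<^sub>R F)"
  by (simp_all add: wick_op_add wick_op_scale)

lemma ndist_alg_A: "ndist (alg_A q) (wick_op q F) (wick_op q G) = norm (embed q F - embed q G)"
  unfolding ndist_def vscale_alg_A vadd_alg_A nrm_alg_A by (simp add: linear_diff[OF linear_embed])

lemma seminormed_alg_A: "seminormed (alg_A q :: ('h::real_inner fock \<Rightarrow> 'h fock) nspace)"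
proof (rule seminormedI[where ev = "\<lambda>A. A"])
  let ?A = "alg_A q :: ('h fock \<Rightarrow> 'h fock) nspace"
  fix A :: "'h fock \<Rightarrow> 'h fock" and c assume "A \<in> carr ?A"
  then obtain F where F: "A = wick_op q F" by auto
  show "vscale ?A c A \<in> carr ?A" unfolding F vscale_alg_A by simp
  show "nrm ?A (vscale ?A c A) = \<bar>c\<bar> * nrm ?A A"
    unfolding F vscale_alg_A nrm_alg_A by (simp add: linear_scale[OF linear_embed])
  fix B assume "B \<in> carr ?A"
  then obtain G where G: "B = wick_op q G" by auto
  show "vadd ?A A B \<in> carr ?A" unfolding F G vadd_alg_A by simp
  show "nrm ?A (vadd ?A A B) \<le> nrm ?A A + nrm ?A B"
    unfolding F G vadd_alg_A nrm_alg_A by (simp add: linear_add[OF linear_embed] norm_triangle_ineq)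
qed auto

text \<open>The inverse of the embedding, continued to the closure: a limit of embedded coefficients
  is sent to the class of the corresponding Wick operators.\<close>

definition limit_class :: "('h::real_inner fock discrete \<Rightarrow>\<^sub>C real) \<Rightarrow> (nat \<Rightarrow> 'h fock \<Rightarrow> 'h fock) set" where
  "limit_class b = cauchy_class (alg_A q) (\<lambda>k. wick_op q ((SOME s. (\<lambda>k. embed q (s k)) \<longlonglongrightarrow> b) k))"

lemma wick_op_cauchy:
  assumes "(\<lambda>k. embed q (s k)) \<longlonglongrightarrow> b"
  shows "(\<lambda>k. wick_op q (s k)) \<in> cauchy_in (alg_A q)"
proof -
  have "\<exists>N. \<forall>m\<ge>N. \<forall>n\<ge>N. ndist (alg_A q) (wick_op q (s m)) (wick_op q (s n)) < e" if "0 < e" for e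
    using metric_CauchyD[OF LIMSEQ_imp_Cauchy[OF assms] that] by (simp add: ndist_alg_A dist_norm)
  then show ?thesis by (auto simp: cauchy_in_def)
qed

text \<open>The embedding is isometric, so two sequences with the same limit have Wick operators at
  distance tending to 0, and the choice in the definition does not matter.\<close>

lemma limit_class_eq:
  assumes s: "(\<lambda>k. embed q (s k)) \<longlonglongrightarrow> b"
  shows "limit_class b = cauchy_class (alg_A q) (\<lambda>k. wick_op q (s k))"
proof -
  let ?t = "SOME s. (\<lambda>k. embed q (s k)) \<longlonglongrightarrow> b"
  have t: "(\<lambda>k. embed q (?t k)) \<longlonglongrightarrow> b" by (rule someI[of "\<lambda>s. (\<lambda>k. embed q (s k)) \<longlonglongrightarrow> b", OF s])
  have "(\<lambda>k. ndist (alg_A q) (wick_op q (?t k)) (wick_op q (s k))) \<longlonglongrightarrow> 0"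
    unfolding ndist_alg_A using tendsto_norm[OF tendsto_diff[OF t s]] by simp
  then show ?thesis
    unfolding limit_class_def
    by (subst seminormed.cauchy_class_eq_iff[OF seminormed_alg_A wick_op_cauchy[OF t] wick_op_cauchy[OF s]])
qed

lemma closure_embedE:
  assumes "b \<in> closure (range (embed q))"
  obtains s where "(\<lambda>k. embed q (s k)) \<longlonglongrightarrow> b"
proof -
  obtain x where x: "\<And>n. x n \<in> range (embed q)" "x \<longlonglongrightarrow> b" using assms unfolding closure_sequential by blast
  then have "\<forall>n. \<exists>F. x n = embed q F" by blast
  then obtain s where "\<forall>n. x n = embed q (s n)" using choice[of "\<lambda>n F. x n = embed q F"] by blast
  then have "x = (\<lambda>n. embed q (s n))" by blast
  then show ?thesis using that x(2) by blast
qed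

lemma subspace_closure_embed: "subspace (closure (range (embed q)))"
proof -
  note l = linear_add[OF linear_embed] linear_scale[OF linear_embed]
  have "0 \<in> closure (range (embed q))"
    by (metis closure_subset linear_0[OF linear_embed] rangeI subsetD)
  moreover have "a + b \<in> closure (range (embed q))" if a: "a \<in> closure (range (embed q))" and b: "b \<in> closure (range (embed q))" for a b
  proof -
    obtain s where "(\<lambda>k. embed q (s k)) \<longlonglongrightarrow> a" by (rule closure_embedE[OF a])
    moreover obtain t where "(\<lambda>k. embed q (t k)) \<longlonglongrightarrow> b" by (rule closure_embedE[OF b])
    ultimately have "(\<lambda>k. embed q (s k + t k)) \<longlonglongrightarrow> a + b" using tendsto_add unfolding l by blast
    then show ?thesis unfolding closure_sequential by (intro exI[of _ "\<lambda>k. embed q (s k + t k)"]) auto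
  qed
  moreover have "c *\<^sub>R a \<in> closure (range (embed q))" if a: "a \<in> closure (range (embed q))" for a c
  proof -
    obtain s where "(\<lambda>k. embed q (s k)) \<longlonglongrightarrow> a" by (rule closure_embedE[OF a])
    then have "(\<lambda>k. embed q (c *\<^sub>R s k)) \<longlonglongrightarrow> c *\<^sub>R a" unfolding l by (intro tendsto_scaleR tendsto_const)
    then show ?thesis unfolding closure_sequential by (intro exI[of _ "\<lambda>k. embed q (c *\<^sub>R s k)"]) auto
  qed
  ultimately show ?thesis by (auto simp: subspace_def)
qed

lemma limit_class_carr:
  assumes "b \<in> closure (range (embed q))"
  shows "limit_class b \<in> carr (banach_A q)"
proof -
  obtain s where s: "(\<lambda>k. embed q (s k)) \<longlonglongrightarrow> b" by (rule closure_embedE[OF assms])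
  show ?thesis
    unfolding limit_class_eq[OF s] banach_A_def seminormed.carr_completion[OF seminormed_alg_A]
    by (rule imageI[OF wick_op_cauchy[OF s]])
qed

lemma nrm_limit_class:
  assumes "b \<in> closure (range (embed q))"
  shows "nrm (banach_A q) (limit_class b) = norm b"
proof -
  obtain s where s: "(\<lambda>k. embed q (s k)) \<longlonglongrightarrow> b" by (rule closure_embedE[OF assms])
  have "(\<lambda>k. norm (embed q (s k))) \<longlonglongrightarrow> nrm (banach_A q) (limit_class b)"
    using seminormed.nrm_class[OF seminormed_alg_A wick_op_cauchy[OF s]]
    unfolding limit_class_eq[OF s] banach_A_def nrm_alg_A .
  then show ?thesis using LIMSEQ_unique tendsto_norm[OF s] by blast
qed

lemma limit_class_add:
  assumes "a \<in> closure (range (embed q))" "b \<in> closure (range (embed q))"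
  shows "limit_class (a + b) = vadd (banach_A q) (limit_class a) (limit_class b)"
proof -
  obtain s where s: "(\<lambda>k. embed q (s k)) \<longlonglongrightarrow> a" by (rule closure_embedE[OF assms(1)])
  obtain t where t: "(\<lambda>k. embed q (t k)) \<longlonglongrightarrow> b" by (rule closure_embedE[OF assms(2)])
  have "(\<lambda>k. embed q (s k + t k)) \<longlonglongrightarrow> a + b"
    using tendsto_add[OF s t] by (simp add: linear_add[OF linear_embed])
  from limit_class_eq[OF this] show ?thesis
    using seminormed.vadd_class[OF seminormed_alg_A wick_op_cauchy[OF s] wick_op_cauchy[OF t]]
    unfolding limit_class_eq[OF s] limit_class_eq[OF t] banach_A_def vadd_alg_A by simp
qed

lemma limit_class_scale:
  assumes "a \<in> closure (range (embed q))"
  shows "limit_class (c *\<^sub>R a) = vscale (banach_A q) c (limit_class a)"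
proof -
  obtain s where s: "(\<lambda>k. embed q (s k)) \<longlonglongrightarrow> a" by (rule closure_embedE[OF assms(1)])
  have "(\<lambda>k. embed q (c *\<^sub>R s k)) \<longlonglongrightarrow> c *\<^sub>R a"
    using tendsto_scaleR[OF tendsto_const s] by (simp add: linear_scale[OF linear_embed])
  from limit_class_eq[OF this] show ?thesis
    using seminormed.vscale_class[OF seminormed_alg_A wick_op_cauchy[OF s]]
    unfolding limit_class_eq[OF s] banach_A_def vscale_alg_A by simp
qed

lemma limit_class_embed: "limit_class (embed q F) = const_class (alg_A q) (wick_op q F)"
  unfolding const_class_def using limit_class_eq[of "\<lambda>_. F" "embed q F"] by simp

lemma bounded_linear_limit_class:
  assumes T: "blin V T B" and cl: "\<And>x. x \<in> carr V \<Longrightarrow> T x \<in> closure (range (embed q))"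
  shows "bounded_linear_on V (banach_A q) (\<lambda>x. limit_class (T x))"
  unfolding bounded_linear_on_def
proof (intro conjI ballI allI exI[of _ B])
  fix x assume x: "x \<in> carr V"
  show "limit_class (T x) \<in> carr (banach_A q)" by (rule limit_class_carr[OF cl[OF x]])
  show "nrm (banach_A q) (limit_class (T x)) \<le> B * nrm V x"
    unfolding nrm_limit_class[OF cl[OF x]] using T x by (simp add: blin_def)
  fix c show "limit_class (T (vscale V c x)) = vscale (banach_A q) c (limit_class (T x))"
    using T x limit_class_scale[OF cl[OF x]] by (simp add: blin_def)
next
  fix x y assume x: "x \<in> carr V" and y: "y \<in> carr V"
  show "limit_class (T (vadd V x y)) = vadd (banach_A q) (limit_class (T x)) (limit_class (T y))"
    using T x y limit_class_add[OF cl[OF x] cl[OF y]] by (simp add: blin_def)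
qed

lemma op_norm_limit_class:
  assumes T: "blin V T B" and cl: "\<And>x. x \<in> carr V \<Longrightarrow> T x \<in> closure (range (embed q))"
    and V: "carr V \<noteq> {}" "nonneg_space V" and B: "0 \<le> B"
  shows "op_norm V (banach_A q) (\<lambda>x. limit_class (T x)) \<le> B"
  unfolding op_norm_def
proof (rule cSUP_least[OF V(1)])
  fix x assume x: "x \<in> carr V"
  have "norm (T x) \<le> B * nrm V x" using T x by (simp add: blin_def)
  moreover have "0 \<le> nrm V x" using V(2) x by (simp add: nonneg_space_def)
  ultimately show "nrm (banach_A q) (limit_class (T x)) / nrm V x \<le> B"
    \<comment> \<open>If the norm of \<open>x\<close> is 0, the quotient is 0 by convention and
      \<open>B\<close> is nonnegative.\<close>
    unfolding nrm_limit_class[OF cl[OF x]] using B by (cases "nrm V x = 0") (auto simp: divide_le_eq)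
qed

end

section \<open>The contraction map\<close>

lemma set_splice: "set (splice xs ys) = set xs \<union> set ys"
  by (induction xs ys rule: splice.induct) auto

lemma distinct_concat_splice:
  "distinct (concat (splice xs ys)) \<longleftrightarrow>
    distinct (concat xs) \<and> distinct (concat ys) \<and> set (concat xs) \<inter> set (concat ys) = {}"
  by (induction xs ys rule: splice.induct) (auto simp: set_splice)

lemma length_concat_splice: "length (concat (splice xs ys)) = length (concat xs) + length (concat ys)"
  by (induction xs ys rule: splice.induct) auto

text \<open>The first and second components of the pairs are all different, so the paired elements
  are twice as many as the pairs. The additive form avoids truncated subtraction.\<close>

lemma length_unpaired:
  assumes \<sigma>: "\<sigma> \<in> contractions K" and K: "distinct K"
  shows "length (unpaired K \<sigma>) + 2 * card \<sigma> = length K"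
proof -
  have inj1: "inj_on fst \<sigma>" and inj2: "inj_on snd \<sigma>"
    using contractions_disjoint[OF \<sigma>] by (fastforce simp: inj_on_def)+
  have disj: "fst ` \<sigma> \<inter> snd ` \<sigma> = {}"
  proof (rule ccontr)
    assume "fst ` \<sigma> \<inter> snd ` \<sigma> \<noteq> {}"
    then obtain a b c where ab: "(a, b) \<in> \<sigma>" and ca: "(c, a) \<in> \<sigma>" by force
    have "a \<noteq> b" "c \<noteq> a" using contractions_irrefl[OF \<sigma> K] ab ca by blast+
    then show False using contractions_disjoint[OF \<sigma> ab ca] by auto
  qed
  have "Field \<sigma> = fst ` \<sigma> \<union> snd ` \<sigma>" by (simp add: Field_def Domain_fst Range_snd)
  then have F: "card (Field \<sigma>) = 2 * card \<sigma>"
    using disj finite_contraction[OF \<sigma>] by (simp add: card_Un_disjoint card_image inj1 inj2)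
  have "length (unpaired K \<sigma>) = card (set K - Field \<sigma>)"
    using distinct_card[of "unpaired K \<sigma>"] K by (simp add: unpaired_def set_diff_eq)
  also have "\<dots> = length K - 2 * card \<sigma>"
    using card_Diff_subset[of "Field \<sigma>" "set K"] contractions_Field[OF \<sigma>] F distinct_card[OF K]
    by (simp add: finite_subset)
  finally show ?thesis
    using card_mono[OF _ contractions_Field[OF \<sigma>]] F distinct_card[OF K] by simp
qed

text \<open>Here \<open>Is\<close> and \<pi> matter only for the exponent \<open>crbar2\<close>, so
  \<open>L\<close> is left arbitrary; it becomes the unpaired part of \<open>Is\<close> in
  \<open>wick_op_Xi\<close>.\<close>

locale R_map =
  fixes q :: real and Is :: "'i list list" and L :: "'i list list" and Js :: "'j list list" and \<pi> :: "('i \<times> 'i) set"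
  assumes q: "\<bar>q\<bar> < 1" and dL: "distinct (concat L)" and dJ: "distinct (concat Js)"
begin

abbreviation K where "K \<equiv> concat (L \<wr> Js)"
text \<open>The nodes of the network, coarser than the partition: no pair joins two elements of L,
  so all of L forms one block. Its tensor is then arbitrary and not a product over the blocks of
  L.\<close>

definition Bs where "Bs = map Inl (concat L) # map (map Inr) Js"

lemma concat_Bs: "concat Bs = map Inl (concat L) @ map Inr (concat Js)"
  by (simp add: Bs_def map_concat)

lemma concat_blocks: "concat (map (map Inl) L) = map Inl (concat L)" "concat (map (map Inr) Js) = map Inr (concat Js)"
  by (simp_all add: map_concat)

lemma distinct_K: "distinct K"
  unfolding interleave_def distinct_concat_splice concat_blocks using dL dJ by (auto simp: distinct_map)

lemma set_K: "set K = set (concat Bs)"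
  by (auto simp: interleave_def set_splice concat_Bs)

lemma length_K: "length K = length (concat L) + length (concat Js)"
  unfolding interleave_def length_concat_splice concat_blocks by simp

lemma distinct_Bs: "distinct (concat Bs)"
  unfolding concat_Bs using dL dJ by (auto simp: distinct_map)

lemma R_contractions_block: "R_contractions L Js \<subseteq> block_contractions (L \<wr> Js)"
  by (auto simp: R_contractions_def)

lemma R_contraction:
  assumes "\<sigma> \<in> R_contractions L Js"
  shows "\<sigma> \<in> contractions K"
    and "(x, y) \<in> \<sigma> \<Longrightarrow> A \<in> set Bs \<Longrightarrow> \<not> (x \<in> set A \<and> y \<in> set A)"
proof -
  have \<sigma>: "\<sigma> \<in> block_contractions (L \<wr> Js)" using assms R_contractions_block by blast
  show "\<sigma> \<in> contractions K" by (rule block_contractions_contractions[OF \<sigma>])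
  assume xy: "(x, y) \<in> \<sigma>" and A: "A \<in> set Bs"
  have nl: "\<not> (x \<in> range Inl \<and> y \<in> range Inl)" using assms xy by (auto simp: R_contractions_def)
  have nb: "\<not> (x \<in> set B \<and> y \<in> set B)" if "B \<in> set (L \<wr> Js)" for B
    using \<sigma>[unfolded block_contractions_iff, THEN conjunct2, THEN conjunct2] xy that by blast
  consider "A = map Inl (concat L)" | "A \<in> set (map (map Inr) Js)" using A by (auto simp: Bs_def)
  then show "\<not> (x \<in> set A \<and> y \<in> set A)"
  proof cases
    case 1
    then show ?thesis using nl by auto
  next
    case 2
    then show ?thesis by (intro nb) (simp add: interleave_def set_splice)
  qed
qed

section \<open>The map on coefficients and its norm\<close>

definition coeff where
  "coeff \<sigma> = q ^ crbar2 Is Js \<pi> \<sigma> * q ^ crbar K \<sigma>"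

abbreviation con :: "(('i + 'j) \<times> ('i + 'j)) set \<Rightarrow> 'h::real_inner list \<Rightarrow> 'h fock" where
  "con \<sigma> \<equiv> contract (concat Bs) \<sigma> (unpaired K \<sigma>)"

text \<open>The map of the theorem before Wick quantisation: it takes a tensor to the coefficient of
  the resulting operator.\<close>

definition Xi :: "'h::real_inner fock \<Rightarrow> 'h fock" where
  "Xi u = (\<Sum>\<sigma>\<in>R_contractions L Js. coeff \<sigma> *\<^sub>R lin_ext (con \<sigma>) u)"

lemma multilinear_con: "\<sigma> \<in> R_contractions L Js \<Longrightarrow> multilinear (con \<sigma> :: 'h::real_inner list \<Rightarrow> _)"
  by (rule multilinear_contract[OF distinct_Bs distinct_K set_K R_contraction(1)])

lemma linear_Xi: "linear (Xi :: 'h::real_inner fock \<Rightarrow> _)"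
  unfolding Xi_def[abs_def]
  by (intro linear_compose_sum ballI linear_compose_scale_right linear_lin_ext multilinear_con)

text \<open>\<open>crbar2\<close> is a natural number, so the factor due to \<pi> has modulus at
  most 1.\<close>

lemma abs_coeff_le: "\<bar>coeff \<sigma>\<bar> \<le> \<bar>q\<bar> ^ crbar K \<sigma>"
proof -
  have "\<bar>q\<bar> ^ crbar2 Is Js \<pi> \<sigma> \<le> 1" using q by (simp add: power_le_one)
  then show ?thesis by (simp add: coeff_def abs_mult power_abs mult_left_le_one_le)
qed

definition "Bd = C_const q powr (3 / 2) * D_const q ^ (length (concat L) + length (concat Js)) *
      (\<Prod>K\<leftarrow>L \<wr> Js. real (length K) + 1)"

lemma D_pos: "0 < D_const q" using q by (simp add: D_const_def)

lemma Bd_nonneg: "0 \<le> Bd"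
  unfolding Bd_def using D_pos by (intro mult_nonneg_nonneg prod_list_nonneg) auto

lemma sum_weight_le: "(\<Sum>\<sigma>\<in>R_contractions L Js. \<bar>coeff \<sigma>\<bar> * weight q (length (unpaired K \<sigma>))) \<le> Bd"
proof -
  let ?r = "\<bar>q\<bar>" and ?k = "\<lambda>\<sigma>. length (unpaired K \<sigma>)"
  let ?C = "C_const q powr (3 / 2) * D_const q ^ length K"
  have r: "0 \<le> ?r" "?r \<le> 1" using q by auto
  have w: "\<bar>coeff \<sigma>\<bar> * weight q (?k \<sigma>) \<le> ?C * (contraction_weight ?r K \<sigma> * (real (?k \<sigma>) + 1))"
    if "\<sigma> \<in> R_contractions L Js" for \<sigma>
  proof -
    \<comment> \<open>\<open>D_const q\<close> is the inverse of 1 - r, so the two factors 1 - r of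
      each pair cancel the powers belonging to its two elements.\<close>
    have "D_const q ^ length K * (1 - ?r) ^ (2 * card \<sigma>) = D_const q ^ ?k \<sigma>"
    proof -
      have "D_const q * (1 - ?r) = 1" using q by (simp add: D_const_def)
      then have "(D_const q * (1 - ?r)) ^ (2 * card \<sigma>) = 1" by (simp only: power_one)
      then show ?thesis
        unfolding length_unpaired[OF R_contraction(1)[OF that] distinct_K, symmetric] power_add
        by (simp add: power_mult_distrib mult.assoc)
    qed
    then have "?C * (contraction_weight ?r K \<sigma> * (real (?k \<sigma>) + 1)) = ?r ^ crbar K \<sigma> * weight q (?k \<sigma>)"
      by (simp add: contraction_weight_def weight_def mult_ac)
    moreover have "\<bar>coeff \<sigma>\<bar> * weight q (?k \<sigma>) \<le> ?r ^ crbar K \<sigma> * weight q (?k \<sigma>)"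
      by (rule mult_right_mono[OF abs_coeff_le weight_nonneg[OF q]])
    ultimately show ?thesis by simp
  qed
  have C0: "0 \<le> ?C" using D_pos by simp
  have "(\<Sum>\<sigma>\<in>R_contractions L Js. \<bar>coeff \<sigma>\<bar> * weight q (?k \<sigma>)) \<le>
      ?C * (\<Sum>\<sigma>\<in>R_contractions L Js. contraction_weight ?r K \<sigma> * (real (?k \<sigma>) + 1))"
    unfolding sum_distrib_left by (rule sum_mono[OF w])
  also have "\<dots> \<le> ?C * (\<Sum>\<sigma>\<in>block_contractions (L \<wr> Js). contraction_weight ?r K \<sigma> * (real (?k \<sigma>) + 1))"
    by (intro mult_left_mono[OF _ C0] sum_mono2 R_contractions_block finite_block_contractions
        mult_nonneg_nonneg contraction_weight_nonneg[OF r]) auto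
  also have "\<dots> \<le> ?C * (\<Prod>K\<leftarrow>L \<wr> Js. real (length K) + 1)"
    by (rule mult_left_mono[OF sum_contraction_weight[OF r distinct_K] C0])
  finally show ?thesis by (simp only: Bd_def length_K)
qed

text \<open>\<open>U\<close> is the tensor of the first node as a whole. Every contracted tensor is
  homogeneous, so its norm in the target is its Fock norm times a single weight, and the
  coefficients can be summed by \<open>sum_weight_le\<close>.\<close>

lemma norm_embed_Xi_le:
  fixes U :: "'h::real_inner fock"
  assumes U: "degree_part (sum_list (map length L)) U = U" and vs: "homogeneous_list (map length Js) vs"
  shows "norm (embed q (Xi (fock_mult U (fock_prod vs)))) \<le> Bd * fock_norm U * (\<Prod>v\<leftarrow>vs. fock_norm v)"
proof -
  let ?us = "U # vs" and ?N = "fock_norm U * (\<Prod>v\<leftarrow>vs. fock_norm v)"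
  have h: "homogeneous_list (map length Bs) ?us"
    using U vs by (simp add: Bs_def comp_def length_concat)
  have N0: "0 \<le> ?N"
  proof (intro mult_nonneg_nonneg prod_list_nonneg)
    show "0 \<le> fock_norm U" by (rule fock_norm_nonneg[OF U])
    fix x assume "x \<in> set (map fock_norm vs)"
    then obtain i where "i < length vs" "x = fock_norm (vs ! i)" by (auto simp: in_set_conv_nth)
    moreover from this have "degree_part (length (Js ! i)) (vs ! i) = vs ! i"
      using vs by (simp add: homogeneous_list_def list_all2_conv_all_nth)
    ultimately show "0 \<le> x" using fock_norm_nonneg by blast
  qed
  have "norm (embed q (Xi (fock_prod ?us))) \<le>
      (\<Sum>\<sigma>\<in>R_contractions L Js. \<bar>coeff \<sigma>\<bar> * norm (embed q (lin_ext (con \<sigma>) (fock_prod ?us))))"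
    unfolding Xi_def linear_sum[OF linear_embed[OF q]] linear_scale[OF linear_embed[OF q]]
    by (rule order.trans[OF norm_sum]) simp
  also have "\<dots> \<le> (\<Sum>\<sigma>\<in>R_contractions L Js. (\<bar>coeff \<sigma>\<bar> * weight q (length (unpaired K \<sigma>))) * ?N)"
  proof (rule sum_mono)
    fix \<sigma> assume \<sigma>: "\<sigma> \<in> R_contractions L Js"
    have "fock_norm (lin_ext (con \<sigma>) (fock_prod ?us)) \<le> (\<Prod>u\<leftarrow>?us. fock_norm u)"
      by (rule fock_norm_contract_le[OF distinct_Bs distinct_K set_K R_contraction(1)[OF \<sigma>] R_contraction(2)[OF \<sigma>] h])
    then have "norm (embed q (lin_ext (con \<sigma>) (fock_prod ?us))) \<le> weight q (length (unpaired K \<sigma>)) * ?N"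
      unfolding norm_embed_homogeneous[OF q degree_part_contract[OF multilinear_con[OF \<sigma>]]]
      using weight_nonneg[OF q] by (intro mult_left_mono) simp_all
    from mult_left_mono[OF this, of "\<bar>coeff \<sigma>\<bar>"]
    show "\<bar>coeff \<sigma>\<bar> * norm (embed q (lin_ext (con \<sigma>) (fock_prod ?us))) \<le>
        (\<bar>coeff \<sigma>\<bar> * weight q (length (unpaired K \<sigma>))) * ?N" by (simp add: mult.assoc)
  qed
  also have "\<dots> \<le> Bd * ?N"
    unfolding sum_distrib_right[symmetric] by (rule mult_right_mono[OF sum_weight_le N0])
  finally show ?thesis by (simp add: mult.assoc)
qed

lemma extension_axioms:
  "fock_extension (\<lambda>u :: 'h::real_inner fock. embed q (Xi u)) (map length L) (map length Js) Bd (closure (range (embed q)))"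
proof (rule fock_extension.intro)
  show "linear (\<lambda>u :: 'h fock. embed q (Xi u))"
    using linear_compose[OF linear_Xi linear_embed[OF q]] by (simp add: comp_def)
  show "embed q (Xi u) \<in> closure (range (embed q))" for u :: "'h fock"
    by (rule subsetD[OF closure_subset]) (rule rangeI)
  show "norm (embed q (Xi (fock_mult U (fock_prod vs)))) \<le> Bd * fock_norm U * (\<Prod>v\<leftarrow>vs. fock_norm v)"
    if "degree_part (sum_list (map length L)) U = U" "homogeneous_list (map length Js) vs" for U :: "'h fock" and vs
    by (rule norm_embed_Xi_le[OF that])
qed (rule Bd_nonneg closed_closure subspace_closure_embed[OF q])+

text \<open>The factors stand in the order of the domain, L before J; the interleaving takes place
  only inside \<open>contract\<close>.\<close>

lemma Xi_elem:
  "fock_prod (map (\<lambda>K. tensor (map f K)) L @ map (\<lambda>K. tensor (map g K)) Js) = tensor (map (case_sum f g) (concat Bs))"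
proof -
  have "map (case_sum f g) (concat Bs) = concat (map (map f) L @ map (map g) Js)"
    by (simp add: concat_Bs map_concat comp_def)
  then show ?thesis using fock_prod_tensor[of "map (map f) L @ map (map g) Js"] by (simp add: comp_def)
qed

lemma wick_op_Xi:
  assumes "L = unpaired_blocks Is \<pi>"
  shows "wick_op q (Xi (tensor (map (case_sum f g) (concat Bs)))) = xi_R q Is Js \<pi> f g"
proof
  fix u
  have "lin_ext (con \<sigma>) (tensor (map (case_sum f g) (concat Bs))) =
      (\<Prod>(s, t)\<in>\<sigma>. case_sum f g s \<bullet> case_sum f g t) *\<^sub>R tensor (map (case_sum f g) (unpaired K \<sigma>))"
    if \<sigma>: "\<sigma> \<in> R_contractions L Js" for \<sigma>
  proof -
    have "Field \<sigma> \<subseteq> set (concat Bs)" using contractions_Field[OF R_contraction(1)[OF \<sigma>]] set_K by simp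
    moreover have "set (unpaired K \<sigma>) \<subseteq> set (concat Bs)" using set_K by (auto simp: unpaired_def)
    ultimately show ?thesis unfolding lin_ext_tensor[OF multilinear_con[OF \<sigma>]] by (rule contract_map)
  qed
  then have "wick_op q (Xi (tensor (map (case_sum f g) (concat Bs)))) u =
      (\<Sum>\<sigma>\<in>R_contractions L Js. coeff \<sigma> *\<^sub>R (\<Prod>(s, t)\<in>\<sigma>. case_sum f g s \<bullet> case_sum f g t) *\<^sub>R
        wick q (map (case_sum f g) (unpaired K \<sigma>)) u)"
    unfolding Xi_def linear_sum[OF linear_wick_op] linear_scale[OF linear_wick_op]
    by (intro sum.cong) (simp_all add: linear_scale[OF linear_wick_op] wick_op_tensor)
  then show "wick_op q (Xi (tensor (map (case_sum f g) (concat Bs)))) u = xi_R q Is Js \<pi> f g u"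
    by (simp add: xi_R_def Let_def assms[symmetric] wick_contraction_def coeff_def mult.assoc)
qed

end

lemma power_elems:
  "map2 (\<lambda>n. const_class (apower n)) (map length Ks) (map (\<lambda>K. tensor (map f K)) Ks) = map (\<lambda>K. power_elem (map f K)) Ks"
  by (induction Ks) (simp_all add: power_elem_def)

lemma distinct_concat_unpaired: "distinct (concat Is) \<Longrightarrow> distinct (concat (unpaired_blocks Is \<pi>))"
  by (induction Is) (auto simp: unpaired_blocks_def unpaired_def)

theorem theorem3p33:
  fixes q :: real and n :: nat
    and Is :: "'i list list" and Js :: "'j list list" and \<pi> :: "('i \<times> 'i) set"
  assumes "- 1 < q" and "q < 1" and "n \<ge> 1"
    and "partitioned n Is" and "partitioned (n - 1) Js"
    and "\<pi> \<in> contractions (concat Is)"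
  defines "L \<equiv> unpaired_blocks Is \<pi>"
  shows "\<exists>T :: 'h::{real_inner, complete_space} power ctensor ctensor \<Rightarrow> _.
    bounded_linear_on (R_domain L Js) (banach_A q) T \<and>
    (\<forall>f g. T (R_elem L Js f g) = const_class (alg_A q) (xi_R q Is Js \<pi> f g)) \<and>
    op_norm (R_domain L Js) (banach_A q) T \<le>
      C_const q powr (3 / 2) * D_const q ^ (length (concat L) + length (concat Js)) *
      (\<Prod>K\<leftarrow>L \<wr> Js. real (length K) + 1)"
proof -
  have q: "\<bar>q\<bar> < 1" using assms(1,2) by simp
  interpret R: R_map q Is L Js \<pi>
    by standard (use q assms(4,5) distinct_concat_unpaired in \<open>auto simp: L_def partitioned_def\<close>)
  interpret E: fock_extension "\<lambda>u :: 'h fock. embed q (R.Xi u)" "map length L" "map length Js" R.Bd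
      "closure (range (embed q))"
    by (rule R.extension_axioms)
  let ?D = "R_domain L Js :: 'h power ctensor ctensor nspace"
  have dom: "?D = projective_tensor [E.Aspace, E.Bspace]"
    by (simp add: R_domain_def comp_def)
  \<comment> \<open>The extension takes values in bounded functions; \<open>limit_class\<close>
    brings them back to the completed algebra.\<close>
  let ?T = "\<lambda>X. limit_class q (E.extension X)"
  have blin: "blin ?D E.extension R.Bd" unfolding dom by (rule E.extension_blin)
  have cl: "E.extension X \<in> closure (range (embed q))" if "X \<in> carr ?D" for X
    by (rule E.extension_closed) (use that dom in simp)
  \<comment> \<open>The zero tensor, as an empty combination, shows that the supremum in
    \<open>op_norm\<close> is taken over a nonempty set.\<close>
  have "tensor_sum [E.Aspace, E.Bspace] [] \<in> carr E.RV"
    by (auto simp: carr_alg_tensor over_tuples_def)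
  then have ne: "carr ?D \<noteq> {}"
    unfolding dom projective_tensor_def[of "[_, _]"] using seminormed.const_class_carr[OF E.RV_seminormed] by blast
  have nonneg: "nonneg_space ?D"
    unfolding dom projective_tensor_def[of "[_, _]"] nonneg_space_def
    using seminormed.nrm_completion_nonneg[OF E.RV_seminormed] by blast
  have "?T (R_elem L Js f g) = const_class (alg_A q) (xi_R q Is Js \<pi> f g)" for f g
  proof -
    have hL: "homogeneous_list (map length L) (map (\<lambda>K. tensor (map f K)) L)"
      and hJ: "homogeneous_list (map length Js) (map (\<lambda>K. tensor (map g K)) Js)"
      by (simp_all add: homogeneous_list_def list_all2_map1 list_all2_map2 degree_part_tensor list_all2_same)
    have "E.extension (R_elem L Js f g) = embed q (R.Xi (tensor (map (case_sum f g) (concat R.Bs))))"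
      using E.extension_elem[OF hL hJ] unfolding power_elems R.Xi_elem
      by (simp add: R_elem_def comp_def)
    then show ?thesis by (simp add: limit_class_embed[OF q] R.wick_op_Xi[OF L_def[THEN meta_eq_to_obj_eq]])
  qed
  then show ?thesis
    using bounded_linear_limit_class[OF q blin cl] op_norm_limit_class[OF q blin cl ne nonneg R.Bd_nonneg]
    unfolding R.Bd_def by (intro exI[of _ ?T] conjI allI)
qed

end
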